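(* Let $\Gamma$ be a discrete group having only finitely many finite subgroups up to conjugacy, and let $\mathcal{F}$ be a family of finite subgroups of $\Gamma$. Then $G_{\mathcal{F}}(\mathbb{Q}[\Gamma])$ is free abelian of rank $C_{\mathcal{F}}(\Gamma)$, where $C_{\mathcal{F}}(\Gamma)$ denotes the number of distinct ($\Gamma$-)conjugacy classes of cyclic subgroups belonging to $\mathcal{F}$.
   Context: A family $\mathcal{F}$ of finite subgroups of $\Gamma$ is a non-empty collection of finite subgroups of $\Gamma$ closed under conjugation and under taking subgroups. For a finite group $H$ and a field $\mathbb{K}$, $G(\mathbb{K}[H])$ is the Grothendieck ring of finitely generated $\mathbb{K}[H]$-modules (relations from short exact sequences; product given by $\otimes_{\mathbb{K}}$ with diagonal action). $G_{\mathcal{F}}(\mathbb{K}[\Gamma])=\varprojlim_{H\in\mathcal{F}} G(\mathbb{K}[H])$ is the subring of those $(x_H)\in\prod_{H\in\mathcal{F}}G(\mathbb{K}[H])$ such that (1) $\mathrm{res}^K_H(x_K)=x_H$ whenever $H\subseteq K$ are in $\mathcal{F}$, and (2) $C_\gamma^*(x_K)=x_H$ whenever $K=\gamma H\gamma^{-1}$, where $C_\gamma^*:G(\mathbb{K}[\gamma H\gamma^{-1}])\to G(\mathbb{K}[H])$ is induced by the homomorphism $H\to\gamma H\gamma^{-1}$, $h\mapsto \gamma h\gamma^{-1}$. *)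

theory Defs
  imports "HOL-Algebra.Algebra" "HOL-Algebra.Algebraic_Closure_Type"
begin

definition group_ring :: "('a, 'c) monoid_scheme \<Rightarrow> ('a \<Rightarrow>\<^sub>0 'k::field) ring" where
  "group_ring H = \<lparr>
     carrier = {f. Poly_Mapping.keys f \<subseteq> carrier H},
     monoid.mult = (\<lambda>f g. \<Sum>x\<in>Poly_Mapping.keys f. \<Sum>y\<in>Poly_Mapping.keys g.
       Poly_Mapping.single (x \<otimes>\<^bsub>H\<^esub> y) (Poly_Mapping.lookup f x * Poly_Mapping.lookup g y)),
     monoid.one = Poly_Mapping.single \<one>\<^bsub>H\<^esub> 1,
     ring.zero = 0,
     ring.add = (+)\<rparr>"

definition group_ring_map :: "('a \<Rightarrow> 'b) \<Rightarrow> ('a \<Rightarrow>\<^sub>0 'k::field) \<Rightarrow> ('b \<Rightarrow>\<^sub>0 'k)" where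
  "group_ring_map \<phi> f =
     (\<Sum>x\<in>Poly_Mapping.keys f. Poly_Mapping.single (\<phi> x) (Poly_Mapping.lookup f x))"

text \<open>
  The library locale \<^locale>\<open>module\<close> requires a commutative ring of scalars, so it does not apply to
  group rings of non-abelian groups. The record type is reused; its fields for a multiplication
  and a unit of the module are ignored.
\<close>
locale left_module = R?: ring R + M?: abelian_group M
  for R :: "('r, 'd) ring_scheme" (structure) and M :: "('r, 'm) module" (structure) +
  assumes smult_closed:
      "\<lbrakk>a \<in> carrier R; x \<in> carrier M\<rbrakk> \<Longrightarrow> a \<odot>\<^bsub>M\<^esub> x \<in> carrier M"
    and smult_l_distr:
      "\<lbrakk>a \<in> carrier R; b \<in> carrier R; x \<in> carrier M\<rbrakk> \<Longrightarrow>
       (a \<oplus>\<^bsub>R\<^esub> b) \<odot>\<^bsub>M\<^esub> x = a \<odot>\<^bsub>M\<^esub> x \<oplus>\<^bsub>M\<^esub> b \<odot>\<^bsub>M\<^esub> x"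
    and smult_r_distr:
      "\<lbrakk>a \<in> carrier R; x \<in> carrier M; y \<in> carrier M\<rbrakk> \<Longrightarrow>
       a \<odot>\<^bsub>M\<^esub> (x \<oplus>\<^bsub>M\<^esub> y) = a \<odot>\<^bsub>M\<^esub> x \<oplus>\<^bsub>M\<^esub> a \<odot>\<^bsub>M\<^esub> y"
    and smult_assoc:
      "\<lbrakk>a \<in> carrier R; b \<in> carrier R; x \<in> carrier M\<rbrakk> \<Longrightarrow>
       (a \<otimes>\<^bsub>R\<^esub> b) \<odot>\<^bsub>M\<^esub> x = a \<odot>\<^bsub>M\<^esub> (b \<odot>\<^bsub>M\<^esub> x)"
    and smult_one:
      "x \<in> carrier M \<Longrightarrow> \<one>\<^bsub>R\<^esub> \<odot>\<^bsub>M\<^esub> x = x"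

definition fg_modules :: "('r, 'd) ring_scheme \<Rightarrow> ('r, 'm) module set" where
  "fg_modules R = {M. left_module R M \<and>
     (\<exists>S. finite S \<and> S \<subseteq> carrier M \<and>
       (\<forall>x\<in>carrier M. \<exists>c\<in>S \<rightarrow> carrier R. x = (\<Oplus>\<^bsub>M\<^esub>s\<in>S. c s \<odot>\<^bsub>M\<^esub> s)))}"

definition linear_maps ::
    "('r, 'd) ring_scheme \<Rightarrow> ('r, 'm) module \<Rightarrow> ('r, 'n) module \<Rightarrow> ('m \<Rightarrow> 'n) set" where
  "linear_maps R M N = {f \<in> carrier M \<rightarrow> carrier N.
     (\<forall>x\<in>carrier M. \<forall>y\<in>carrier M. f (x \<oplus>\<^bsub>M\<^esub> y) = f x \<oplus>\<^bsub>N\<^esub> f y) \<and>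
     (\<forall>a\<in>carrier R. \<forall>x\<in>carrier M. f (a \<odot>\<^bsub>M\<^esub> x) = a \<odot>\<^bsub>N\<^esub> f x)}"

definition short_exact ::
    "('r, 'd) ring_scheme \<Rightarrow> ('r, 'm) module \<Rightarrow> ('r, 'm) module \<Rightarrow> ('r, 'm) module \<Rightarrow> bool" where
  "short_exact R M' M M'' \<longleftrightarrow>
     (\<exists>f\<in>linear_maps R M' M. \<exists>g\<in>linear_maps R M M''.
        inj_on f (carrier M') \<and>
        f ` carrier M' = {x \<in> carrier M. g x = \<zero>\<^bsub>M''\<^esub>} \<and>
        g ` carrier M = carrier M'')"

definition restrict_scalars :: "('s \<Rightarrow> 'r) \<Rightarrow> ('r, 'm) module \<Rightarrow> ('s, 'm) module" where
  "restrict_scalars \<phi> M = \<lparr>carrier = carrier M, monoid.mult = monoid.mult M, monoid.one = monoid.one M,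
     ring.zero = ring.zero M, ring.add = ring.add M, module.smult = (\<lambda>a. module.smult M (\<phi> a))\<rparr>"

text \<open>
  For a finite group \<open>H\<close>, every finitely generated \<open>K[H]\<close>-module is a finite-dimensional vector
  space over \<open>K\<close>, hence is isomorphic to one whose underlying set consists of functions
  \<open>nat \<Rightarrow> 'k\<close> (with finite support). So this type is a large enough universe for the modules.
  Isomorphic modules need not be equal here, but become equal in the Grothendieck group by the
  relation coming from \<open>0 \<rightarrow> M \<rightarrow> N \<rightarrow> 0 \<rightarrow> 0\<close>.
\<close>
type_synonym ('a, 'k) gmodule = "('a \<Rightarrow>\<^sub>0 'k, nat \<Rightarrow> 'k) module"
type_synonym ('a, 'k) groth = "(('a, 'k) gmodule \<Rightarrow>\<^sub>0 int) set"

definition module_frags :: "('a, 'c) monoid_scheme \<Rightarrow> (('a, 'k::field) gmodule \<Rightarrow>\<^sub>0 int) monoid" where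
  "module_frags H = free_Abelian_group (fg_modules (group_ring H))"

definition exact_relations :: "('a, 'c) monoid_scheme \<Rightarrow> ('a, 'k::field) groth" where
  "exact_relations H = generate (module_frags H)
     {frag_of M - frag_of M' - frag_of M'' | M' M M''.
        M' \<in> fg_modules (group_ring H) \<and> M \<in> fg_modules (group_ring H) \<and>
        M'' \<in> fg_modules (group_ring H) \<and> short_exact (group_ring H) M' M M''}"

definition underlying_space ::
    "('a, 'c) monoid_scheme \<Rightarrow> ('a \<Rightarrow>\<^sub>0 'k::field, 'm) module \<Rightarrow> ('k, 'm) module" where
  "underlying_space H M = restrict_scalars (Poly_Mapping.single \<one>\<^bsub>H\<^esub>) M"

definition bilinear_maps ::
    "('k::field, 'm) module \<Rightarrow> ('k, 'n) module \<Rightarrow> ('k, 'p) module \<Rightarrow> ('m \<Rightarrow> 'n \<Rightarrow> 'p) set" where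
  "bilinear_maps V W P = {b.
     (\<forall>v\<in>carrier V. b v \<in> linear_maps ring_of_type_algebra W P) \<and>
     (\<forall>w\<in>carrier W. (\<lambda>v. b v w) \<in> linear_maps ring_of_type_algebra V P)}"

text \<open>
  \<open>T\<close> is a model of \<open>M \<otimes>\<^sub>K N\<close> with the diagonal action of \<open>H\<close>. Letting \<open>P\<close> range over the spaces
  inside \<open>nat \<Rightarrow> 'k\<close> suffices for the universal property to determine \<open>T\<close>, since these include
  copies of all finite-dimensional spaces.
\<close>
definition is_tensor_product ::
    "('a, 'c) monoid_scheme \<Rightarrow> ('a, 'k::field) gmodule \<Rightarrow> ('a, 'k) gmodule \<Rightarrow> ('a, 'k) gmodule \<Rightarrow> bool"
  where
  "is_tensor_product H M N T \<longleftrightarrow>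
     T \<in> fg_modules (group_ring H) \<and>
     (\<exists>t\<in>bilinear_maps (underlying_space H M) (underlying_space H N) (underlying_space H T).
        (\<forall>h\<in>carrier H. \<forall>x\<in>carrier M. \<forall>y\<in>carrier N.
           Poly_Mapping.single h 1 \<odot>\<^bsub>T\<^esub> t x y
             = t (Poly_Mapping.single h 1 \<odot>\<^bsub>M\<^esub> x) (Poly_Mapping.single h 1 \<odot>\<^bsub>N\<^esub> y)) \<and>
        (\<forall>(P :: ('k, nat \<Rightarrow> 'k) module) b.
           module ring_of_type_algebra P \<and>
           b \<in> bilinear_maps (underlying_space H M) (underlying_space H N) P \<longrightarrow>
           (\<exists>!u. u \<in> extensional (carrier T) \<and>
                 u \<in> linear_maps ring_of_type_algebra (underlying_space H T) P \<and>
                 (\<forall>x\<in>carrier M. \<forall>y\<in>carrier N. u (t x y) = b x y))))"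

definition tensor_frag ::
    "('a, 'c) monoid_scheme \<Rightarrow> (('a, 'k::field) gmodule \<Rightarrow>\<^sub>0 int) \<Rightarrow> (('a, 'k) gmodule \<Rightarrow>\<^sub>0 int)
      \<Rightarrow> (('a, 'k) gmodule \<Rightarrow>\<^sub>0 int)" where
  "tensor_frag H c d =
     frag_extend (\<lambda>M. frag_extend (\<lambda>N. frag_of (SOME T. is_tensor_product H M N T)) d) c"

definition trivial_module :: "('a, 'k::field) gmodule" where
  "trivial_module = \<lparr>carrier = {v. \<forall>i. i \<noteq> 0 \<longrightarrow> v i = 0}, monoid.mult = undefined, monoid.one = undefined,
     ring.zero = (\<lambda>_. 0), ring.add = (\<lambda>v w i. v i + w i),
     module.smult = (\<lambda>a v i. (\<Sum>x\<in>Poly_Mapping.keys a. Poly_Mapping.lookup a x) * v i)\<rparr>"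

text \<open>
  The unions below are over the representatives of the cosets involved: all members of the union
  are the same coset, because the operations on formal sums respect the exact relations.
\<close>
definition grothendieck_ring :: "('a, 'c) monoid_scheme \<Rightarrow> ('a, 'k::field) groth ring" where
  "grothendieck_ring H =
    (let Q = module_frags H Mod exact_relations H
     in \<lparr>carrier = carrier Q,
         monoid.mult = (\<lambda>A B. \<Union>c\<in>A. \<Union>d\<in>B. exact_relations H #>\<^bsub>module_frags H\<^esub> tensor_frag H c d),
         monoid.one = exact_relations H #>\<^bsub>module_frags H\<^esub> frag_of trivial_module,
         ring.zero = monoid.one Q,
         ring.add = monoid.mult Q\<rparr>)"

text \<open>
  The map \<open>\<phi>\<^sup>* : G(K[H']) \<rightarrow> G(K[H])\<close> induced by a group homomorphism \<open>\<phi> : H \<rightarrow> H'\<close>.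
\<close>
definition groth_pullback ::
    "('a, 'c) monoid_scheme \<Rightarrow> ('a \<Rightarrow> 'b) \<Rightarrow> ('b, 'k::field) groth \<Rightarrow> ('a, 'k) groth" where
  "groth_pullback H \<phi> A =
     (\<Union>c\<in>A. exact_relations H #>\<^bsub>module_frags H\<^esub>
        frag_extend (\<lambda>M. frag_of (restrict_scalars (group_ring_map \<phi>) M)) c)"

definition conj_subgroup :: "('a, 'c) monoid_scheme \<Rightarrow> 'a \<Rightarrow> 'a set \<Rightarrow> 'a set" where
  "conj_subgroup G \<gamma> H = \<gamma> <#\<^bsub>G\<^esub> (H #>\<^bsub>G\<^esub> inv\<^bsub>G\<^esub> \<gamma>)"

definition conj_class :: "('a, 'c) monoid_scheme \<Rightarrow> 'a set \<Rightarrow> 'a set set" where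
  "conj_class G H = {conj_subgroup G \<gamma> H | \<gamma>. \<gamma> \<in> carrier G}"

definition family_of_finite_subgroups :: "('a, 'c) monoid_scheme \<Rightarrow> 'a set set \<Rightarrow> bool" where
  "family_of_finite_subgroups G F \<longleftrightarrow>
     F \<noteq> {} \<and>
     (\<forall>H\<in>F. subgroup H G \<and> finite H) \<and>
     (\<forall>H\<in>F. \<forall>\<gamma>\<in>carrier G. conj_subgroup G \<gamma> H \<in> F) \<and>
     (\<forall>H\<in>F. \<forall>L. subgroup L G \<and> L \<subseteq> H \<longrightarrow> L \<in> F)"

definition groth_limit ::
    "'k::field itself \<Rightarrow> ('a, 'c) monoid_scheme \<Rightarrow> 'a set set \<Rightarrow> ('a set \<Rightarrow> ('a, 'k) groth) ring" where
  "groth_limit _ G F =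
    (let GR = (\<lambda>H. grothendieck_ring (G\<lparr>carrier := H\<rparr>))
     in \<lparr>carrier = {x \<in> \<Pi>\<^sub>E H\<in>F. carrier (GR H).
           (\<forall>H\<in>F. \<forall>K\<in>F. H \<subseteq> K \<longrightarrow>
              groth_pullback (G\<lparr>carrier := H\<rparr>) (\<lambda>h. h) (x K) = x H) \<and>
           (\<forall>H\<in>F. \<forall>K\<in>F. \<forall>\<gamma>\<in>carrier G. K = conj_subgroup G \<gamma> H \<longrightarrow>
              groth_pullback (G\<lparr>carrier := H\<rparr>) (\<lambda>h. \<gamma> \<otimes>\<^bsub>G\<^esub> h \<otimes>\<^bsub>G\<^esub> inv\<^bsub>G\<^esub> \<gamma>) (x K) = x H)},
         monoid.mult = (\<lambda>x y. \<lambda>H\<in>F. x H \<otimes>\<^bsub>GR H\<^esub> y H),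
         monoid.one = (\<lambda>H\<in>F. \<one>\<^bsub>GR H\<^esub>),
         ring.zero = (\<lambda>H\<in>F. \<zero>\<^bsub>GR H\<^esub>),
         ring.add = (\<lambda>x y. \<lambda>H\<in>F. x H \<oplus>\<^bsub>GR H\<^esub> y H)\<rparr>)"

definition num_cyclic_classes :: "('a, 'c) monoid_scheme \<Rightarrow> 'a set set \<Rightarrow> nat" where
  "num_cyclic_classes G F = card (conj_class G ` {H \<in> F. cyclic_group (G\<lparr>carrier := H\<rparr>)})"

definition free_abelian_of_rank :: "('a, 'c) monoid_scheme \<Rightarrow> nat \<Rightarrow> bool" where
  "free_abelian_of_rank A n \<longleftrightarrow> A \<cong> free_Abelian_group {..<n}"

end

theory Submission
  imports Defs
begin

text \<open>
  Elements of the Grothendieck group of \<open>\<rat>[H]\<close> are determined by their characters, so a compatible family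
  in the limit is determined by the values of its characters at generators of the cyclic subgroups in
  the family. A rational character takes the same value at all generators of a cyclic group, hence the
  limit is a group of rational functions on the conjugacy classes of cyclic subgroups. By Artin's theorem
  this group contains \<open>N \<int>\<^sup>n\<close> for some \<open>N > 0\<close>; pairing with Artin's virtual characters shows that its members
  have bounded denominators. A group between two such lattices is free of rank \<open>n\<close>.

  Representations are multiplicative maps into the non-unital ring of finitely supported matrices, so that
  the identity of the group may act as any idempotent. The images, kernels and quotients of intertwiners
  are then given by explicit idempotents.
\<close>

section \<open>Finitely supported matrices\<close>

text \<open>All arguments stay over \<rat>. There a simple module may have endomorphisms other than
  scalars, so a simple character need not pair to 1 with itself. Averaging still gives two facts:
  the pairing of two characters is |H| times a natural number, and it vanishes only if there is no
  nonzero intertwiner. The first bounds denominators; the second yields the common simple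
  subrepresentation through which representations with equal characters are compared. That a
  rational character agrees at all generators of a cyclic group is a Galois statement about roots of
  unity. Here it comes from the congruence of tr(A^p) and tr(A) modulo p for integer matrices: for a
  large prime p the bounded numerators of tr \<rho>(x^p) and tr \<rho>(x) must coincide, and
  suitable exponents are products of such primes. The multiple N and the denominators must be
  uniform over the family, which may be infinite. The finite number of conjugacy classes provides
  this by bounding the orders of the subgroups.\<close>

typedef (overloaded) 'a fmat = "{A :: nat \<Rightarrow> nat \<Rightarrow> 'a::field. \<exists>n. \<forall>i j. n \<le> i \<or> n \<le> j \<longrightarrow> A i j = 0}"
  morphisms entry Abs_fmat
  by (rule exI[of _ "\<lambda>_ _. 0"]) simp

setup_lifting type_definition_fmat

text \<open>An upper bound and not the exact size, so that finitely many matrices share one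
  \<open>n\<close> and all their products become sums over \<open>{..<n}\<close>.\<close>

definition fmat_bound :: "'a::field fmat \<Rightarrow> nat \<Rightarrow> bool" where
  "fmat_bound A n \<longleftrightarrow> (\<forall>i j. n \<le> i \<or> n \<le> j \<longrightarrow> entry A i j = 0)"

lemma fmat_bound_exists: "\<exists>n. fmat_bound A n"
  unfolding fmat_bound_def by transfer

lemma fmat_bound_mono: "fmat_bound A n \<Longrightarrow> n \<le> m \<Longrightarrow> fmat_bound A m"
  by (meson fmat_bound_def le_trans)

lemma fmat_bound_less: "fmat_bound A n \<Longrightarrow> entry A i j \<noteq> 0 \<Longrightarrow> i < n \<and> j < n"
  unfolding fmat_bound_def by (meson not_le)

lemma fmat_bound_uniform:
  assumes "finite J"
  shows "\<exists>n. \<forall>x\<in>J. fmat_bound (f x) n"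
proof -
  define b where "b x = (SOME n. fmat_bound (f x) n)" for x
  have b: "fmat_bound (f x) (b x)" for x
    unfolding b_def using fmat_bound_exists by (rule someI_ex)
  have "fmat_bound (f x) (\<Sum>y\<in>J. b y)" if "x \<in> J" for x
    by (rule fmat_bound_mono[OF b]) (use assms that in \<open>simp add: member_le_sum\<close>)
  then show ?thesis by blast
qed

lemma fmat_bound_two: obtains n where "fmat_bound A n" "fmat_bound B n"
  by (meson fmat_bound_exists fmat_bound_mono nle_le)

lemma fmat_bound_three: obtains n where "fmat_bound A n" "fmat_bound B n" "fmat_bound C n"
  by (metis fmat_bound_exists fmat_bound_mono nle_le)

lemma fmat_eqI: "(\<And>i j. entry A i j = entry B i j) \<Longrightarrow> A = B"
  by (metis entry_inject ext)

text \<open>The vector may have infinite support, since each row has only finitely many nonzero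
  entries; the result always has finite support.\<close>

lift_definition apply_fmat :: "'a::field fmat \<Rightarrow> (nat \<Rightarrow> 'a) \<Rightarrow> nat \<Rightarrow> 'a" is
  "\<lambda>A v i. \<Sum>j | A i j \<noteq> 0. A i j * v j" .

lemma apply_fmat_bound:
  assumes "fmat_bound A n"
  shows "apply_fmat A v i = (\<Sum>j<n. entry A i j * v j)"
  unfolding apply_fmat.rep_eq
proof (rule sum.mono_neutral_left)
  show "{j. entry A i j \<noteq> 0} \<subseteq> {..<n}"
    using fmat_bound_less[OF assms] by blast
qed auto

instantiation fmat :: (field) ring
begin

lift_definition zero_fmat :: "'a fmat" is "\<lambda>_ _. 0" by simp

lift_definition plus_fmat :: "'a fmat \<Rightarrow> 'a fmat \<Rightarrow> 'a fmat" is "\<lambda>A B i j. A i j + B i j"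
proof -
  fix A B :: "nat \<Rightarrow> nat \<Rightarrow> 'a"
  assume "\<exists>n. \<forall>i j. n \<le> i \<or> n \<le> j \<longrightarrow> A i j = 0" "\<exists>n. \<forall>i j. n \<le> i \<or> n \<le> j \<longrightarrow> B i j = 0"
  then obtain n m where "\<forall>i j. n \<le> i \<or> n \<le> j \<longrightarrow> A i j = 0" "\<forall>i j. m \<le> i \<or> m \<le> j \<longrightarrow> B i j = 0" by auto
  then show "\<exists>n. \<forall>i j. n \<le> i \<or> n \<le> j \<longrightarrow> A i j + B i j = 0"
    by (intro exI[of _ "max n m"]) auto
qed

lift_definition uminus_fmat :: "'a fmat \<Rightarrow> 'a fmat" is "\<lambda>A i j. - A i j" by simp

definition minus_fmat :: "'a fmat \<Rightarrow> 'a fmat \<Rightarrow> 'a fmat" where "A - B = A + - (B :: 'a fmat)"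

lift_definition times_fmat :: "'a fmat \<Rightarrow> 'a fmat \<Rightarrow> 'a fmat" is
  "\<lambda>A B i k. \<Sum>j | A i j \<noteq> 0. A i j * B j k"
proof -
  fix A B :: "nat \<Rightarrow> nat \<Rightarrow> 'a"
  assume "\<exists>n. \<forall>i j. n \<le> i \<or> n \<le> j \<longrightarrow> A i j = 0" "\<exists>n. \<forall>i j. n \<le> i \<or> n \<le> j \<longrightarrow> B i j = 0"
  then obtain n m where "\<forall>i j. n \<le> i \<or> n \<le> j \<longrightarrow> A i j = 0" "\<forall>i j. m \<le> i \<or> m \<le> j \<longrightarrow> B i j = 0" by auto
  then show "\<exists>n. \<forall>i k. n \<le> i \<or> n \<le> k \<longrightarrow> (\<Sum>j | A i j \<noteq> 0. A i j * B j k) = 0"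
    by (intro exI[of _ "max n m"]) auto
qed

lemma entry_times_apply: "entry (A * B) i k = apply_fmat A (\<lambda>j. entry B j k) i"
  by transfer simp

lemma entry_times_bound:
  "fmat_bound A n \<Longrightarrow> entry (A * B) i k = (\<Sum>j<n. entry A i j * entry B j k)"
  by (simp add: entry_times_apply apply_fmat_bound[of _ n])

lemma fmat_bound_times: "fmat_bound A n \<Longrightarrow> fmat_bound B n \<Longrightarrow> fmat_bound (A * B) n"
  unfolding fmat_bound_def[of "A * B"]
  by (auto simp: entry_times_bound[of _ n]) (auto simp: fmat_bound_def)

lemma fmat_bound_plus: "fmat_bound A n \<Longrightarrow> fmat_bound B n \<Longrightarrow> fmat_bound (A + B) n"
  by (simp add: fmat_bound_def plus_fmat.rep_eq)

instance
proof
  fix A B C :: "'a fmat"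
  obtain n where n: "fmat_bound A n" "fmat_bound B n" "fmat_bound C n" by (rule fmat_bound_three)
  show "A * B * C = A * (B * C)"
  proof (rule fmat_eqI)
    fix i j
    have "entry (A * B * C) i j = (\<Sum>k<n. \<Sum>l<n. entry A i l * entry B l k * entry C k j)"
      by (simp add: entry_times_bound[of _ n] n fmat_bound_times sum_distrib_right)
    also have "\<dots> = (\<Sum>l<n. \<Sum>k<n. entry A i l * entry B l k * entry C k j)" by (rule sum.swap)
    also have "\<dots> = entry (A * (B * C)) i j"
      by (simp add: entry_times_bound[of _ n] n sum_distrib_left mult.assoc)
    finally show "entry (A * B * C) i j = entry (A * (B * C)) i j" .
  qed
  show "(A + B) * C = A * C + B * C"
    by (rule fmat_eqI)
      (simp add: entry_times_bound[of _ n] n fmat_bound_plus plus_fmat.rep_eq distrib_right sum.distrib)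
  show "A * (B + C) = A * B + A * C"
    by (rule fmat_eqI)
      (simp add: entry_times_bound[of _ n] n plus_fmat.rep_eq distrib_left sum.distrib)
  show "A + B + C = A + (B + C)"
    by (rule fmat_eqI) (simp add: plus_fmat.rep_eq add.assoc)
  show "A + B = B + A"
    by (rule fmat_eqI) (simp add: plus_fmat.rep_eq add.commute)
  show "0 + A = A"
    by (rule fmat_eqI) (simp add: plus_fmat.rep_eq zero_fmat.rep_eq)
  show "- A + A = 0"
    by (rule fmat_eqI) (simp add: plus_fmat.rep_eq zero_fmat.rep_eq uminus_fmat.rep_eq)
  show "A - B = A + - B" by (simp only: minus_fmat_def)
qed

end

lemma entry_simps [simp]:
  "entry (A + B) i j = entry A i j + entry B i j"
  "entry (- A) i j = - entry A i j"
  "entry (A - B) i j = entry A i j - entry B i j"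
  "entry 0 i j = 0"
  by (simp_all add: plus_fmat.rep_eq uminus_fmat.rep_eq zero_fmat.rep_eq minus_fmat_def
      del: add_uminus_conv_diff)

lemma entry_sum [simp]: "entry (sum A J) i j = (\<Sum>x\<in>J. entry (A x) i j)"
  by (induction J rule: infinite_finite_induct) auto

text \<open>Scalars act by a separate operation because the ring contains no nonzero scalar
  matrices.\<close>

lift_definition scale_fmat :: "'a::field \<Rightarrow> 'a fmat \<Rightarrow> 'a fmat" is "\<lambda>c A i j. c * A i j"
  by (metis mult_zero_right)

lemma entry_scale [simp]: "entry (scale_fmat c A) i j = c * entry A i j"
  by (simp add: scale_fmat.rep_eq)

lemma fmat_bound_scale: "fmat_bound A n \<Longrightarrow> fmat_bound (scale_fmat c A) n"
  by (simp add: fmat_bound_def)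

lemma scale_times_left: "scale_fmat c A * B = scale_fmat c (A * B)"
proof -
  obtain n where n: "fmat_bound A n" using fmat_bound_exists by blast
  show ?thesis
    by (rule fmat_eqI) (simp add: entry_times_bound[of _ n] n fmat_bound_scale sum_distrib_left mult.assoc)
qed

lemma scale_times_right: "A * scale_fmat c B = scale_fmat c (A * B)"
proof -
  obtain n where n: "fmat_bound A n" using fmat_bound_exists by blast
  show ?thesis
    by (rule fmat_eqI) (simp add: entry_times_bound[of _ n] n sum_distrib_left mult.left_commute)
qed

lemma scale_fmat_scale [simp]: "scale_fmat c (scale_fmat d A) = scale_fmat (c * d) A"
  by (rule fmat_eqI) simp

lemma scale_fmat_one [simp]: "scale_fmat 1 A = A"
  by (rule fmat_eqI) simp

lemma apply_times: "apply_fmat (A * B) v = apply_fmat A (apply_fmat B v)"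
proof
  fix i
  obtain n where n: "fmat_bound A n" "fmat_bound B n" by (rule fmat_bound_two)
  show "apply_fmat (A * B) v i = apply_fmat A (apply_fmat B v) i"
    by (simp add: apply_fmat_bound[of _ n] n fmat_bound_times entry_times_bound[of _ n] sum_distrib_left
        sum_distrib_right mult.assoc) (rule sum.swap)
qed

lemma apply_add: "apply_fmat A (\<lambda>i. v i + w i) = (\<lambda>i. apply_fmat A v i + apply_fmat A w i)"
  by (rule ext) (simp add: apply_fmat.rep_eq algebra_simps sum.distrib)

lemma apply_smult: "apply_fmat A (\<lambda>i. c * v i) = (\<lambda>i. c * apply_fmat A v i)"
  by (rule ext) (simp add: apply_fmat.rep_eq algebra_simps sum_distrib_left)

lemma apply_zero: "apply_fmat A (\<lambda>i. 0) = (\<lambda>i. 0)"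
  by (rule ext) (simp add: apply_fmat.rep_eq)

lemma apply_zero_left [simp]: "apply_fmat 0 v = (\<lambda>i. 0)"
  by (rule ext) (simp add: apply_fmat.rep_eq)

lemma apply_plus_left: "apply_fmat (A + B) v = (\<lambda>i. apply_fmat A v i + apply_fmat B v i)"
proof
  fix i
  obtain n where n: "fmat_bound A n" "fmat_bound B n" by (rule fmat_bound_two)
  show "apply_fmat (A + B) v i = apply_fmat A v i + apply_fmat B v i"
    by (simp add: apply_fmat_bound[of _ n] n fmat_bound_plus algebra_simps sum.distrib)
qed

lemma column_eq_apply: "(\<lambda>i. entry A i j) = apply_fmat A (\<lambda>k. if k = j then 1 else 0)"
proof
  fix i
  obtain n where n: "fmat_bound A n" using fmat_bound_exists by blast
  have "(\<Sum>k<n. entry A i k * (if k = j then 1 else 0)) = (if j < n then entry A i j else 0)"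
    by (simp add: if_distrib cong: if_cong)
  then show "entry A i j = apply_fmat A (\<lambda>k. if k = j then 1 else 0) i"
    using n by (auto simp: apply_fmat_bound[of _ n] fmat_bound_def)
qed

lemma fmat_apply_eqI: "(\<And>v. apply_fmat A v = apply_fmat B v) \<Longrightarrow> A = B"
  by (rule fmat_eqI) (metis column_eq_apply)

lemma entry_times_col: "(\<lambda>i. entry (A * B) i j) = apply_fmat A (\<lambda>i. entry B i j)"
  by (rule ext) (simp add: entry_times_apply)

text \<open>Turns the images of finitely many basis vectors into a matrix: each column has finite
  support, so the whole array is bounded.\<close>

lemma fmat_of_columns:
  assumes "\<And>j. j < n \<Longrightarrow> \<exists>m. \<forall>i\<ge>m. (c j i :: 'a::field) = 0"
  obtains A where "\<And>i j. entry A i j = (if j < n then c j i else 0)"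
proof -
  obtain m where m: "\<And>i j. j < n \<Longrightarrow> m j \<le> i \<Longrightarrow> c j i = 0" using assms by metis
  \<comment> \<open>Bounds both the number of columns and every column height.\<close>
  let ?N = "n + (\<Sum>j<n. m j)"
  have "c j i = 0" if "j < n" "?N \<le> i" for i j
  proof -
    have "m j \<le> (\<Sum>j<n. m j)" using that(1) by (intro member_le_sum) auto
    with that m show ?thesis by (meson add_leE le_trans)
  qed
  then have "(\<lambda>i j. if j < n then c j i else 0) \<in> {A. \<exists>N. \<forall>i j. N \<le> i \<or> N \<le> j \<longrightarrow> A i j = 0}"
    by (intro CollectI exI[of _ ?N]) auto
  then show thesis using that[of "Abs_fmat (\<lambda>i j. if j < n then c j i else 0)"]
    by (simp add: Abs_fmat_inverse)
qed

section \<open>Trace, matrix units and idempotents\<close>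

definition trace_fmat :: "'a::field fmat \<Rightarrow> 'a" where
  "trace_fmat A = (\<Sum>i | entry A i i \<noteq> 0. entry A i i)"

lemma trace_bound:
  assumes "fmat_bound A n"
  shows "trace_fmat A = (\<Sum>i<n. entry A i i)"
  unfolding trace_fmat_def
proof (rule sum.mono_neutral_left)
  show "{i. entry A i i \<noteq> 0} \<subseteq> {..<n}"
    using fmat_bound_less[OF assms] by blast
qed auto

lemma trace_zero [simp]: "trace_fmat 0 = 0"
  by (simp add: trace_fmat_def)

lemma trace_add: "trace_fmat (A + B) = trace_fmat A + trace_fmat B"
proof -
  obtain n where n: "fmat_bound A n" "fmat_bound B n" by (rule fmat_bound_two)
  show ?thesis by (simp add: trace_bound[of _ n] n fmat_bound_plus sum.distrib)
qed

lemma trace_diff: "trace_fmat (A - B) = trace_fmat A - trace_fmat B"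
  using trace_add[of "A - B" B] by simp

lemma trace_sum: "trace_fmat (sum A J) = (\<Sum>x\<in>J. trace_fmat (A x))"
  by (induction J rule: infinite_finite_induct) (auto simp: trace_add)

lemma trace_scale: "trace_fmat (scale_fmat c A) = c * trace_fmat A"
proof -
  obtain n where n: "fmat_bound A n" using fmat_bound_exists by blast
  show ?thesis by (simp add: trace_bound[of _ n] n fmat_bound_scale sum_distrib_left)
qed

lemma trace_commute: "trace_fmat (A * B) = trace_fmat (B * A)"
proof -
  obtain n where n: "fmat_bound A n" "fmat_bound B n" by (rule fmat_bound_two)
  show ?thesis
    by (simp add: trace_bound[of _ n] n fmat_bound_times entry_times_bound[of _ n] mult.commute)
      (rule sum.swap)
qed

lift_definition unit_fmat :: "nat \<Rightarrow> nat \<Rightarrow> 'a::field \<Rightarrow> 'a fmat" is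
  "\<lambda>q p c i j. if i = q \<and> j = p then c else 0"
  by (rule_tac x = "Suc (max nat1 nat2)" in exI) auto

lemma entry_unit: "entry (unit_fmat q p c) i j = (if i = q \<and> j = p then c else 0)"
  by (simp add: unit_fmat.rep_eq)

lemma entry_mult_unit: "entry (A * unit_fmat q p c) i j = (if j = p then entry A i q * c else 0)"
proof -
  obtain n where n: "fmat_bound A n" using fmat_bound_exists by blast
  have "(\<Sum>k<n. entry A i k * (if k = q then c else 0)) = (if q < n then entry A i q * c else 0)"
    by (simp add: if_distrib cong: if_cong)
  then show ?thesis
    using n by (cases "j = p") (auto simp: entry_times_bound[of _ n] entry_unit fmat_bound_def cong: if_cong)
qed

lemma entry_unit_mult: "entry (unit_fmat q p c * A) i j = (if i = q then c * entry A p j else 0)"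
proof -
  obtain n where n: "fmat_bound (unit_fmat q p c) n" "fmat_bound A n" by (rule fmat_bound_two)
  have "(\<Sum>k<n. (if k = p then c else 0) * entry A k j) = (if p < n then c * entry A p j else 0)"
    by (simp add: if_distrib[of "\<lambda>x. x * _"] cong: if_cong)
  then show ?thesis
    using n by (cases "i = q") (auto simp: entry_times_bound[of _ n] entry_unit fmat_bound_def cong: if_cong)
qed

lemma entry_mult_unit_mult: "entry (A * unit_fmat q p c * B) i j = entry A i q * c * entry B p j"
proof -
  obtain n where n: "fmat_bound A n" using fmat_bound_exists by blast
  have *: "(\<Sum>k<n. entry A i k * (if k = q then x else 0)) = (if q < n then entry A i q * x else 0)" for x
    by (simp add: if_distrib cong: if_cong)
  show ?thesis
    unfolding mult.assoc[of A] using n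
    by (auto simp: entry_times_bound[of _ n] entry_unit_mult * fmat_bound_def)
qed

text \<open>Serves as an induction measure in place of the rank, since the number of nonzero rows
  drops with every rank-one reduction.\<close>

definition nonzero_rows :: "'a::field fmat \<Rightarrow> nat set" where
  "nonzero_rows A = {i. \<exists>j. entry A i j \<noteq> 0}"

lemma finite_nonzero_rows: "finite (nonzero_rows A)"
proof -
  obtain n where n: "fmat_bound A n" using fmat_bound_exists by blast
  have "nonzero_rows A \<subseteq> {..<n}"
    using fmat_bound_less[OF n] unfolding nonzero_rows_def by blast
  then show ?thesis using finite_subset by blast
qed

text \<open>Subtracting the rank-one matrix \<open>A Z A\<close> clears the row of a pivot.\<close>

lemma rank_one_reduction:
  assumes "(A :: 'a::field fmat) \<noteq> 0"
  obtains Z where "Z * A * Z = Z" "trace_fmat (Z * A) = 1"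
    "card (nonzero_rows (A - A * Z * A)) < card (nonzero_rows A)"
proof -
  obtain p q where pq: "entry A p q \<noteq> 0" using assms fmat_eqI[of A 0] by auto
  \<comment> \<open>The inverse of the pivot in the transposed position: then
    \<open>A * Z * A\<close> agrees with \<open>A\<close> in row \<open>p\<close> and in column
    \<open>q\<close>.\<close>
  define Z where "Z = unit_fmat q p (1 / entry A p q)"
  have AZA: "entry (A * Z * A) i j = entry A i q * entry A p j / entry A p q" for i j
    by (simp add: Z_def entry_mult_unit_mult)
  have "Z * A * Z = Z"
    by (rule fmat_eqI) (simp add: Z_def entry_mult_unit entry_unit_mult entry_unit pq)
  moreover have "trace_fmat (Z * A) = 1"
  proof -
    have "{i. entry (Z * A) i i \<noteq> 0} = {q}" using pq by (auto simp: Z_def entry_unit_mult)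
    then show ?thesis using pq by (simp add: trace_fmat_def Z_def entry_unit_mult)
  qed
  moreover have "card (nonzero_rows (A - A * Z * A)) < card (nonzero_rows A)"
  \<comment> \<open>Row \<open>p\<close> is cleared, and a zero row \<open>i\<close> stays zero
    because the subtracted entry is a multiple of \<open>entry A i q\<close>.\<close>
  proof (rule psubset_card_mono[OF finite_nonzero_rows])
    have "p \<in> nonzero_rows A - nonzero_rows (A - A * Z * A)"
      using pq by (auto simp: nonzero_rows_def AZA)
    moreover have "nonzero_rows (A - A * Z * A) \<subseteq> nonzero_rows A"
      by (auto simp: nonzero_rows_def AZA) (metis mult_eq_0_iff divide_eq_0_iff)
    ultimately show "nonzero_rows (A - A * Z * A) \<subset> nonzero_rows A" by blast
  qed
  ultimately show thesis by (rule that)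
qed

text \<open>The induction splits off a rank-one summand. For such a \<open>Y\<close> (von Neumann
  regularity) both \<open>Y * A\<close> and \<open>A * Y\<close> are idempotent, which is how
  kernels of intertwiners become explicit projections.\<close>

lemma regular_fmat: "\<exists>Y. A * Y * A = (A :: 'a::field fmat)"
proof (induction "card (nonzero_rows A)" arbitrary: A rule: less_induct)
  case less
  show ?case
  proof (cases "A = 0")
    case False
    then obtain Z where Z: "Z * A * Z = Z" and "card (nonzero_rows (A - A * Z * A)) < card (nonzero_rows A)"
      by (rule rank_one_reduction)
    with less obtain J where J: "(A - A * Z * A) * J * (A - A * Z * A) = A - A * Z * A" by blast
    \<comment> \<open>This is \<open>(1 - Z * A) * J * (1 - A * Z) + Z\<close> written out without
      the missing unit; \<open>A * (1 - Z * A)\<close> and \<open>(1 - A * Z) * A\<close> are both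
      the reduced matrix.\<close>
    let ?Y = "J - Z * A * J - J * A * Z + Z * A * J * A * Z + Z"
    have "A * ?Y * A = (A - A * Z * A) * J * (A - A * Z * A) + A * Z * A"
      by (simp add: algebra_simps)
    also have "\<dots> = A" using J by simp
    finally show ?thesis by blast
  qed simp
qed

text \<open>Splitting off the rank-one idempotent \<open>E * Z * E\<close> leaves an idempotent and
  lowers the trace by 1, so the trace of an idempotent is its rank. Dimensions of representations
  are measured in this way.\<close>

lemma trace_idempotent:
  assumes "E * E = (E :: 'a::{field,ring_char_0} fmat)"
  shows "\<exists>n. trace_fmat E = of_nat n \<and> (n = 0 \<longrightarrow> E = 0)"
  using assms
proof (induction "card (nonzero_rows E)" arbitrary: E rule: less_induct)
  case less
  show ?case
  proof (cases "E = 0")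
    case False
    then obtain Z where Z: "Z * E * Z = Z" "trace_fmat (Z * E) = 1"
      and "card (nonzero_rows (E - E * Z * E)) < card (nonzero_rows E)"
      by (rule rank_one_reduction)
    moreover have "(E - E * Z * E) * (E - E * Z * E) = E - E * Z * E"
    proof -
      have E: "E * (E * x) = E * x" for x by (metis less.prems mult.assoc)
      have "Z * (E * (Z * x)) = Z * x" for x by (metis Z(1) mult.assoc)
      then show ?thesis by (simp add: algebra_simps E less.prems)
    qed
    ultimately obtain n where n: "trace_fmat (E - E * Z * E) = of_nat n" using less by blast
    have "trace_fmat (E * Z * E) = 1"
      using trace_commute[of "E" "Z * E"] Z(2) less.prems by (simp add: mult.assoc)
    then have "trace_fmat E = of_nat (Suc n)" using n by (simp add: trace_diff algebra_simps)
    then show ?thesis by blast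
  qed (auto intro: exI[of _ 0])
qed

section \<open>Matrix representations of a finite group\<close>

lemma unit_times_unit: "unit_fmat q p c * unit_fmat p' r d = (if p = p' then unit_fmat q r (c * d) else 0)"
  by (rule fmat_eqI) (auto simp: entry_mult_unit entry_unit)

text \<open>\<open>twisted_kron A B\<close> is the matrix of the operator \<open>T \<mapsto> A T B\<close> on matrices.\<close>

lift_definition twisted_kron :: "'a::field fmat \<Rightarrow> 'a fmat \<Rightarrow> 'a fmat" is
  "\<lambda>A B i j. A (fst (prod_decode i)) (fst (prod_decode j)) * B (snd (prod_decode j)) (snd (prod_decode i))"
proof -
  fix A B :: "nat \<Rightarrow> nat \<Rightarrow> 'a"
  assume "\<exists>n. \<forall>i j. n \<le> i \<or> n \<le> j \<longrightarrow> A i j = 0" "\<exists>n. \<forall>i j. n \<le> i \<or> n \<le> j \<longrightarrow> B i j = 0"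
  then obtain n m where nm: "\<forall>i j. n \<le> i \<or> n \<le> j \<longrightarrow> A i j = 0" "\<forall>i j. m \<le> i \<or> m \<le> j \<longrightarrow> B i j = 0" by auto
  have "finite (prod_encode ` ({..<n} \<times> {..<m}))" by simp
  \<comment> \<open>Pairs in an \<open>n\<close> by \<open>m\<close> box can have codes above
    \<open>n * m\<close>, so the bound comes from finiteness of the set of codes.\<close>
  then obtain N where N: "prod_encode ` ({..<n} \<times> {..<m}) \<subseteq> {..<N}" using finite_nat_iff_bounded by blast
  have small: "i < N" if "fst (prod_decode i) < n" "snd (prod_decode i) < m" for i
  proof -
    have "prod_encode (prod_decode i) \<in> prod_encode ` ({..<n} \<times> {..<m})"
      by (rule imageI) (use that in \<open>simp add: mem_Times_iff\<close>)
    with N show ?thesis by auto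
  qed
  have "A (fst (prod_decode i)) (fst (prod_decode j)) * B (snd (prod_decode j)) (snd (prod_decode i)) = 0"
    if ij: "N \<le> i \<or> N \<le> j" for i j
  proof (rule ccontr)
    assume "\<not> ?thesis"
    then have nz: "A (fst (prod_decode i)) (fst (prod_decode j)) \<noteq> 0" "B (snd (prod_decode j)) (snd (prod_decode i)) \<noteq> 0"
      by auto
    have "x < n \<and> y < n" if "A x y \<noteq> 0" for x y using nm(1) that by (meson not_le)
    moreover have "x < m \<and> y < m" if "B x y \<noteq> 0" for x y using nm(2) that by (meson not_le)
    ultimately have "i < N" "j < N" using nz small by blast+
    with ij show False by simp
  qed
  then show "\<exists>n. \<forall>i j. n \<le> i \<or> n \<le> j \<longrightarrow>
      A (fst (prod_decode i)) (fst (prod_decode j)) * B (snd (prod_decode j)) (snd (prod_decode i)) = 0"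
    by blast
qed

lemma entry_twisted_kron:
  "entry (twisted_kron A B) i j =
   entry A (fst (prod_decode i)) (fst (prod_decode j)) * entry B (snd (prod_decode j)) (snd (prod_decode i))"
  by (simp add: twisted_kron.rep_eq)

text \<open>The codes below \<open>N\<close> need not form a box, but the initial segment and the
  box both contain the support of \<open>f\<close>, so the two sums agree.\<close>

lemma sum_prod_decode:
  fixes f :: "nat \<Rightarrow> nat \<Rightarrow> 'a::comm_monoid_add"
  assumes "\<And>a b. f a b \<noteq> 0 \<Longrightarrow> prod_encode (a, b) < N \<and> a < n \<and> b < n"
  shows "(\<Sum>j<N. f (fst (prod_decode j)) (snd (prod_decode j))) = (\<Sum>a<n. \<Sum>b<n. f a b)"
proof -
  have "(\<Sum>a<n. \<Sum>b<n. f a b) = (\<Sum>x\<in>{..<n} \<times> {..<n}. f (fst x) (snd x))"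
    by (simp add: sum.cartesian_product case_prod_beta)
  also have "\<dots> = (\<Sum>j\<in>prod_encode ` ({..<n} \<times> {..<n}). f (fst (prod_decode j)) (snd (prod_decode j)))"
    by (subst sum.reindex) (auto simp: inj_on_def prod_encode_eq)
  also have "\<dots> = (\<Sum>j<N. f (fst (prod_decode j)) (snd (prod_decode j)))"
  proof (rule sum.mono_neutral_cong)
    fix j assume "j \<in> {..<N} - prod_encode ` ({..<n} \<times> {..<n})"
    then have "\<not> (fst (prod_decode j) < n \<and> snd (prod_decode j) < n)"
      by (metis DiffD2 SigmaI imageI lessThan_iff prod.collapse prod_decode_inverse)
    then show "f (fst (prod_decode j)) (snd (prod_decode j)) = 0" using assms by blast
  next
    fix j assume "j \<in> prod_encode ` ({..<n} \<times> {..<n}) - {..<N}"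
    then show "f (fst (prod_decode j)) (snd (prod_decode j)) = 0"
      using assms by (metis DiffD2 lessThan_iff prod.collapse prod_decode_inverse)
  qed auto
  finally show ?thesis by simp
qed

lemma kron_bound_less:
  assumes "fmat_bound (twisted_kron A B) N" "entry A a a' \<noteq> 0" "entry B b' b \<noteq> 0"
  shows "prod_encode (a, b) < N" "prod_encode (a', b') < N"
proof -
  have "entry (twisted_kron A B) (prod_encode (a, b)) (prod_encode (a', b')) \<noteq> 0"
    using assms by (simp add: entry_twisted_kron)
  then show "prod_encode (a, b) < N" "prod_encode (a', b') < N"
    using fmat_bound_less[OF assms(1)] by blast+
qed

text \<open>Applying \<open>T \<mapsto> C T D\<close> and then \<open>T \<mapsto> A T B\<close>
  gives \<open>T \<mapsto> (A C) T (D B)\<close>, which reverses the order on the right.\<close>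

lemma twisted_kron_mult: "twisted_kron A B * twisted_kron C D = twisted_kron (A * C) (D * B)"
proof (rule fmat_eqI)
  fix i k
  obtain N where N: "fmat_bound (twisted_kron A B) N" using fmat_bound_exists by blast
  obtain n where n: "fmat_bound A n" "fmat_bound B n" "fmat_bound D n" by (rule fmat_bound_three)
  define i1 i2 k1 k2 where "i1 = fst (prod_decode i)" "i2 = snd (prod_decode i)"
    "k1 = fst (prod_decode k)" "k2 = snd (prod_decode k)"
  note ik = this
  have "entry (twisted_kron A B * twisted_kron C D) i k =
      (\<Sum>j<N. entry A i1 (fst (prod_decode j)) * entry B (snd (prod_decode j)) i2 *
        (entry C (fst (prod_decode j)) k1 * entry D k2 (snd (prod_decode j))))"
    by (simp add: entry_times_bound[OF N] entry_twisted_kron ik)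
  also have "\<dots> = (\<Sum>a<n. \<Sum>b<n. entry A i1 a * entry B b i2 * (entry C a k1 * entry D k2 b))"
  proof (rule sum_prod_decode)
    fix a b assume *: "entry A i1 a * entry B b i2 * (entry C a k1 * entry D k2 b) \<noteq> 0"
    then show "prod_encode (a, b) < N \<and> a < n \<and> b < n"
      using kron_bound_less(2)[OF N, of i1 a b i2] fmat_bound_less[OF n(1), of i1 a] fmat_bound_less[OF n(2), of b i2]
      by auto
  qed
  also have "\<dots> = entry (twisted_kron (A * C) (D * B)) i k"
    by (simp add: entry_twisted_kron entry_times_bound[of _ n] n ik[symmetric] sum_product mult_ac)
  finally show "entry (twisted_kron A B * twisted_kron C D) i k = entry (twisted_kron (A * C) (D * B)) i k" .
qed

lemma trace_twisted_kron: "trace_fmat (twisted_kron A B) = trace_fmat A * trace_fmat B"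
proof -
  obtain N where N: "fmat_bound (twisted_kron A B) N" using fmat_bound_exists by blast
  obtain n where n: "fmat_bound A n" "fmat_bound B n" by (rule fmat_bound_two)
  have "trace_fmat (twisted_kron A B) =
      (\<Sum>j<N. entry A (fst (prod_decode j)) (fst (prod_decode j)) * entry B (snd (prod_decode j)) (snd (prod_decode j)))"
    by (simp add: trace_bound[OF N] entry_twisted_kron)
  also have "\<dots> = (\<Sum>a<n. \<Sum>b<n. entry A a a * entry B b b)"
  proof (rule sum_prod_decode)
    fix a b assume "entry A a a * entry B b b \<noteq> 0"
    then show "prod_encode (a, b) < N \<and> a < n \<and> b < n"
      using kron_bound_less(1)[OF N, of a a b b] fmat_bound_less[OF n(1), of a a] fmat_bound_less[OF n(2), of b b]
      by auto
  qed
  also have "\<dots> = trace_fmat A * trace_fmat B"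
    by (simp add: trace_bound[of _ n] n sum_product)
  finally show ?thesis .
qed

section \<open>Representations, intertwiners and exact sequences as matrices\<close>

definition mat_rep :: "('a, 'c) monoid_scheme \<Rightarrow> ('a \<Rightarrow> 'k::field fmat) \<Rightarrow> bool" where
  "mat_rep H \<rho> \<longleftrightarrow> (\<forall>x\<in>carrier H. \<forall>y\<in>carrier H. \<rho> (x \<otimes>\<^bsub>H\<^esub> y) = \<rho> x * \<rho> y)"

text \<open>The first condition places the image of \<open>T\<close> inside the image of
  \<open>\<rho> \<one>\<close>; the second at \<open>h = \<one>\<close> then gives
  \<open>T * \<sigma> \<one> = T\<close>, so that \<open>T\<close> is determined by its effect on
  the space of \<sigma>.\<close>

definition intertwines ::
    "('a, 'c) monoid_scheme \<Rightarrow> ('a \<Rightarrow> 'k::field fmat) \<Rightarrow> ('a \<Rightarrow> 'k fmat) \<Rightarrow> 'k fmat \<Rightarrow> bool" where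
  "intertwines H \<sigma> \<rho> T \<longleftrightarrow> \<rho> \<one>\<^bsub>H\<^esub> * T = T \<and> (\<forall>h\<in>carrier H. \<rho> h * T = T * \<sigma> h)"

text \<open>\<open>R\<close> and \<open>S\<close> are a retraction and a section that are linear
  only: the sequence splits as vector spaces, and neither has to commute with the group.\<close>

definition split_exact ::
    "('a, 'c) monoid_scheme \<Rightarrow> ('a \<Rightarrow> 'k::field fmat) \<Rightarrow> ('a \<Rightarrow> 'k fmat) \<Rightarrow> ('a \<Rightarrow> 'k fmat) \<Rightarrow> bool" where
  "split_exact H \<rho>' \<rho> \<rho>'' \<longleftrightarrow>
     (\<exists>F G R S. intertwines H \<rho>' \<rho> F \<and> intertwines H \<rho> \<rho>'' G \<and>
        R * F = \<rho>' \<one>\<^bsub>H\<^esub> \<and> G * S = \<rho>'' \<one>\<^bsub>H\<^esub> \<and> F * R + S * G = \<rho> \<one>\<^bsub>H\<^esub> \<and> G * F = 0)"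

locale finite_group = group H for H :: "('a, 'c) monoid_scheme" (structure) +
  assumes finite_carrier: "finite (carrier H)"
begin

lemma mat_rep_mult: "mat_rep H \<rho> \<Longrightarrow> x \<in> carrier H \<Longrightarrow> y \<in> carrier H \<Longrightarrow> \<rho> x * \<rho> y = \<rho> (x \<otimes> y)"
  by (simp add: mat_rep_def)

lemma mat_rep_one:
  assumes "mat_rep H \<rho>" "x \<in> carrier H"
  shows "\<rho> \<one> * \<rho> x = \<rho> x" "\<rho> x * \<rho> \<one> = \<rho> x" "\<rho> \<one> * (\<rho> x * A) = \<rho> x * A" "\<rho> x * (\<rho> \<one> * A) = \<rho> x * A"
  using assms by (simp_all add: mat_rep_mult flip: mult.assoc)

lemma intertwinesD:
  assumes "intertwines H \<sigma> \<rho> T"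
  shows "\<rho> \<one> * T = T" "T * \<sigma> \<one> = T" "h \<in> carrier H \<Longrightarrow> \<rho> h * T = T * \<sigma> h"
  using assms one_closed unfolding intertwines_def by metis+

lemma trace_one_nat:
  assumes "mat_rep H (\<rho> :: 'a \<Rightarrow> 'k::field_char_0 fmat)"
  obtains n where "trace_fmat (\<rho> \<one>) = of_nat n" "n = 0 \<Longrightarrow> \<rho> \<one> = 0"
  using trace_idempotent[of "\<rho> \<one>"] mat_rep_one(1)[OF assms one_closed] by blast

text \<open>Cyclicity of the trace moves \<open>R\<close> and \<open>S\<close> past the group
  element, so it is enough that \<open>F\<close> and \<open>G\<close> intertwine.\<close>

lemma split_exact_trace:
  assumes "mat_rep H \<rho>'" "mat_rep H \<rho>" "mat_rep H \<rho>''" "split_exact H \<rho>' \<rho> \<rho>''" "h \<in> carrier H"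
  shows "trace_fmat (\<rho> h) = trace_fmat (\<rho>' h) + trace_fmat (\<rho>'' h)"
proof -
  obtain F G R S where *: "intertwines H \<rho>' \<rho> F" "intertwines H \<rho> \<rho>'' G"
    "R * F = \<rho>' \<one>" "G * S = \<rho>'' \<one>" "F * R + S * G = \<rho> \<one>"
    using assms(4) unfolding split_exact_def by blast
  have "\<rho> h = \<rho> h * (F * R + S * G)" using assms by (simp add: * mat_rep_one)
  then have "trace_fmat (\<rho> h) = trace_fmat (\<rho> h * F * R) + trace_fmat (\<rho> h * S * G)"
    by (metis distrib_left mult.assoc trace_add)
  also have "trace_fmat (\<rho> h * F * R) = trace_fmat (\<rho>' h)"
  proof -
    have "trace_fmat (\<rho> h * F * R) = trace_fmat (R * F * \<rho>' h)"
      using intertwinesD(3)[OF *(1) assms(5)] trace_commute[of "\<rho> h * F" R] by (simp add: mult.assoc)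
    then show ?thesis using assms by (simp add: * mat_rep_one)
  qed
  also have "trace_fmat (\<rho> h * S * G) = trace_fmat (\<rho>'' h)"
  proof -
    have "trace_fmat (\<rho> h * S * G) = trace_fmat (\<rho>'' h * G * S)"
      using intertwinesD(3)[OF *(2) assms(5)] trace_commute[of "\<rho> h * S" G] by (simp flip: mult.assoc)
    then show ?thesis using assms by (simp add: * mat_rep_one mult.assoc)
  qed
  finally show ?thesis .
qed

section \<open>Averaging over the group\<close>

lemma sum_translate:
  assumes "g \<in> carrier H"
  shows "(\<Sum>h\<in>carrier H. f (g \<otimes> h)) = (\<Sum>h\<in>carrier H. f h)"
proof (rule sum.reindex_bij_betw)
  show "bij_betw (\<lambda>h. g \<otimes> h) (carrier H) (carrier H)"
    by (rule bij_betwI[where g = "\<lambda>h. inv g \<otimes> h"]) (use assms in \<open>auto simp: m_assoc[symmetric]\<close>)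
qed

lemma card_carrier_pos: "card (carrier H) > 0"
  using finite_carrier one_closed card_gt_0_iff by blast

text \<open>The averaged operator \<open>T \<mapsto> |H|\<^sup>-\<^sup>1 \<Sum> \<rho>(h) T \<sigma>(h\<^sup>-\<^sup>1)\<close> projects onto the intertwiners, so its trace counts them.\<close>

lemma character_pairing:
  fixes \<rho> \<sigma> :: "'a \<Rightarrow> 'k::field_char_0 fmat"
  assumes \<rho>: "mat_rep H \<rho>" and \<sigma>: "mat_rep H \<sigma>"
  obtains n where
    "(\<Sum>h\<in>carrier H. trace_fmat (\<rho> h) * trace_fmat (\<sigma> (inv h))) = of_nat (card (carrier H)) * of_nat n"
    "n = 0 \<longleftrightarrow> (\<forall>T. intertwines H \<sigma> \<rho> T \<longrightarrow> T = 0)"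
proof -
  let ?N = "of_nat (card (carrier H)) :: 'k"
  have N: "?N \<noteq> 0" using card_carrier_pos by simp
  \<comment> \<open>\<open>K\<close> is multiplicative because the inverse in
    \<open>\<sigma> (inv h)\<close> undoes the reversal in \<open>twisted_kron_mult\<close>; hence
    its average \<open>P\<close> is idempotent and the trace of \<open>P\<close> is a natural
    number.\<close>
  define K where "K h = twisted_kron (\<rho> h) (\<sigma> (inv h))" for h
  define P where "P = scale_fmat (1 / ?N) (\<Sum>h\<in>carrier H. K h)"
  have K: "K g * K h = K (g \<otimes> h)" if "g \<in> carrier H" "h \<in> carrier H" for g h
    using that \<rho> \<sigma> by (simp add: K_def twisted_kron_mult mat_rep_mult inv_mult_group)
  have "(\<Sum>g\<in>carrier H. K g) * (\<Sum>h\<in>carrier H. K h) = (\<Sum>g\<in>carrier H. \<Sum>h\<in>carrier H. K (g \<otimes> h))"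
    by (simp add: sum_product K)
  also have "\<dots> = (\<Sum>g\<in>carrier H. \<Sum>h\<in>carrier H. K h)"
    by (rule sum.cong) (auto intro: sum_translate)
  also have "\<dots> = scale_fmat ?N (\<Sum>h\<in>carrier H. K h)"
    by (rule fmat_eqI) simp
  finally have "P * P = P"
    using N by (simp add: P_def scale_times_left scale_times_right)
  then obtain n where n: "trace_fmat P = of_nat n" "n = 0 \<Longrightarrow> P = 0" using trace_idempotent by blast
  have "trace_fmat P = (\<Sum>h\<in>carrier H. trace_fmat (\<rho> h) * trace_fmat (\<sigma> (inv h))) / ?N"
    by (simp add: P_def trace_scale trace_sum K_def trace_twisted_kron)
  then have 1: "(\<Sum>h\<in>carrier H. trace_fmat (\<rho> h) * trace_fmat (\<sigma> (inv h))) = ?N * of_nat n"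
    using n N by (simp add: field_simps)
  \<comment> \<open>An intertwiner is its own average, and trace zero makes the averaging operator
    \<open>P\<close> vanish.\<close>
  have "T = 0" if "n = 0" and T: "intertwines H \<sigma> \<rho> T" for T
  proof (rule fmat_eqI)
    fix i l
    obtain n1 where n1: "\<And>h. h \<in> carrier H \<Longrightarrow> fmat_bound (\<rho> h) n1"
      using fmat_bound_uniform[OF finite_carrier, of \<rho>] by blast
    obtain n2 where n2: "fmat_bound T n2" using fmat_bound_exists by blast
    have T1: "\<rho> h * T * \<sigma> (inv h) = T" if "h \<in> carrier H" for h
      using that intertwinesD[OF T] \<sigma> by (simp add: mult.assoc mat_rep_mult)
    have "?N * entry T i l = (\<Sum>h\<in>carrier H. entry (\<rho> h * T * \<sigma> (inv h)) i l)"
      by (simp add: T1)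
    also have "\<dots> = (\<Sum>h\<in>carrier H. \<Sum>j<n1. \<Sum>k<n2. entry (\<rho> h) i j * entry T j k * entry (\<sigma> (inv h)) k l)"
      by (rule sum.cong) (simp_all add: mult.assoc entry_times_bound[OF n1] entry_times_bound[OF n2] sum_distrib_left)
    also have "\<dots> = (\<Sum>j<n1. \<Sum>k<n2. \<Sum>h\<in>carrier H. entry (\<rho> h) i j * entry T j k * entry (\<sigma> (inv h)) k l)"
      by (subst sum.swap) (intro sum.cong refl sum.swap)
    also have "\<dots> = (\<Sum>j<n1. \<Sum>k<n2. ?N * entry P (prod_encode (i, l)) (prod_encode (j, k)) * entry T j k)"
      using N by (simp add: P_def K_def entry_twisted_kron sum_distrib_left mult_ac)
    also have "\<dots> = 0" using n that by simp
    finally show "entry T i l = entry 0 i l" using N by simp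
  qed
  moreover have "\<exists>T. intertwines H \<sigma> \<rho> T \<and> T \<noteq> 0" if "n \<noteq> 0"
  proof -
    have "P \<noteq> 0" using that n(1) by auto
    then obtain x y where "entry P x y \<noteq> 0" using fmat_eqI[of P 0] by auto
    \<comment> \<open>A nonzero entry of \<open>P\<close> is, up to the factor
      \<open>1 / |H|\<close>, an entry of the sum over the group of the translates of
      \<open>unit_fmat j k 1\<close>; this sum is therefore a nonzero intertwiner.\<close>
    then obtain i j k l where nz: "(\<Sum>h\<in>carrier H. entry (\<rho> h) i j * entry (\<sigma> (inv h)) k l) \<noteq> 0"
      by (auto simp: P_def K_def entry_twisted_kron)
    define T where "T = (\<Sum>h\<in>carrier H. \<rho> h * unit_fmat j k 1 * \<sigma> (inv h))"
    have "entry T i l \<noteq> 0" using nz by (simp add: T_def entry_mult_unit_mult)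
    then have "T \<noteq> 0" by auto
    moreover have "\<rho> g * T = T * \<sigma> g" if g: "g \<in> carrier H" for g
    proof -
      have "\<rho> g * T = (\<Sum>h\<in>carrier H. \<rho> (g \<otimes> h) * unit_fmat j k 1 * \<sigma> (inv (g \<otimes> h) \<otimes> g))"
        unfolding T_def sum_distrib_left
      proof (rule sum.cong)
        fix h assume h: "h \<in> carrier H"
        have "inv (g \<otimes> h) \<otimes> g = inv h" using g h by (simp add: inv_mult_group m_assoc)
        then show "\<rho> g * (\<rho> h * unit_fmat j k 1 * \<sigma> (inv h)) = \<rho> (g \<otimes> h) * unit_fmat j k 1 * \<sigma> (inv (g \<otimes> h) \<otimes> g)"
          using g h \<rho> by (simp flip: mat_rep_mult add: mult.assoc)
      qed simp
      also have "\<dots> = (\<Sum>h\<in>carrier H. \<rho> h * unit_fmat j k 1 * \<sigma> (inv h \<otimes> g))"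
        by (rule sum_translate[OF g, of "\<lambda>h. \<rho> h * unit_fmat j k 1 * \<sigma> (inv h \<otimes> g)"])
      also have "\<dots> = T * \<sigma> g"
        unfolding T_def sum_distrib_right using g \<sigma> by (simp flip: mat_rep_mult add: mult.assoc)
      finally show ?thesis .
    qed
    moreover have "\<rho> \<one> * T = T"
      unfolding T_def sum_distrib_left using \<rho> by (simp add: mat_rep_one mult.assoc)
    ultimately show ?thesis unfolding intertwines_def by blast
  qed
  ultimately have "n = 0 \<longleftrightarrow> (\<forall>T. intertwines H \<sigma> \<rho> T \<longrightarrow> T = 0)" by blast
  with 1 show thesis by (rule that)
qed

text \<open>A nonzero subrepresentation of least dimension is simple, so its nonzero intertwiners are split injective.\<close>

lemma simple_subrep:
  fixes \<rho> :: "'a \<Rightarrow> 'k::field_char_0 fmat"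
  assumes \<rho>: "mat_rep H \<rho>" "\<rho> \<one> \<noteq> 0"
  obtains \<sigma> F R where "mat_rep H \<sigma>" "\<sigma> \<one> \<noteq> 0" "intertwines H \<sigma> \<rho> F" "R * F = \<sigma> \<one>"
    "\<And>\<tau> T. \<lbrakk>mat_rep H \<tau>; intertwines H \<sigma> \<tau> T; T \<noteq> 0\<rbrakk> \<Longrightarrow> \<exists>R. R * T = \<sigma> \<one>"
proof -
  \<comment> \<open>The dimension enters as the trace of the identity element, a natural number by
    \<open>trace_one_nat\<close>, so that a least one exists.\<close>
  define sub where "sub n \<longleftrightarrow> (\<exists>\<sigma> F R. mat_rep H \<sigma> \<and> \<sigma> \<one> \<noteq> 0 \<and> intertwines H \<sigma> \<rho> F \<and> R * F = \<sigma> \<one>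
      \<and> trace_fmat (\<sigma> \<one>) = (of_nat n :: 'k))" for n
  obtain n0 where "trace_fmat (\<rho> \<one>) = of_nat n0" using trace_one_nat[OF \<rho>(1)] by blast
  moreover have "intertwines H \<rho> \<rho> (\<rho> \<one>)" "\<rho> \<one> * \<rho> \<one> = \<rho> \<one>"
    using \<rho> by (simp_all add: intertwines_def mat_rep_one)
  ultimately have "sub n0" unfolding sub_def using \<rho> by blast
  then have "\<exists>n. sub n \<and> (\<forall>m. sub m \<longrightarrow> n \<le> m)" using ex_has_least_nat[of sub n0 "\<lambda>n. n"] by simp
  then obtain n where n: "sub n" and least: "\<And>m. sub m \<Longrightarrow> n \<le> m" by blast
  then obtain \<sigma> F R where \<sigma>: "mat_rep H \<sigma>" "\<sigma> \<one> \<noteq> 0" and F: "intertwines H \<sigma> \<rho> F" and R: "R * F = \<sigma> \<one>"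
    and tr: "trace_fmat (\<sigma> \<one>) = of_nat n" unfolding sub_def by blast
  note \<sigma>1 = mat_rep_one[OF \<sigma>(1)]
  have "\<exists>R. R * T = \<sigma> \<one>" if \<tau>: "mat_rep H \<tau>" and T: "intertwines H \<sigma> \<tau> T" and "T \<noteq> 0" for \<tau> T
  proof -
    obtain Y where Y: "T * Y * T = T" using regular_fmat by blast
    \<comment> \<open>The idempotent onto the kernel of \<open>T\<close>, read off from the inner
      inverse \<open>Y\<close>, with \<open>\<sigma> \<one>\<close> in the place of a unit.\<close>
    define e where "e = \<sigma> \<one> - \<sigma> \<one> * Y * T"
    note T1 = intertwinesD[OF T]
    have T2: "T * (\<sigma> \<one> * A) = T * A" for A by (metis T1(2) mult.assoc)
    have Te: "T * e = 0" using Y by (simp add: e_def right_diff_distrib T1 T2 mult.assoc)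
    have \<sigma>e: "\<sigma> \<one> * e = e" by (simp add: e_def right_diff_distrib \<sigma>1 mult.assoc)
    \<comment> \<open>The kernel is invariant because \<open>T\<close> intertwines.\<close>
    have e\<sigma>e: "e * (\<sigma> h * e) = \<sigma> h * e" if "h \<in> carrier H" for h
    proof -
      have "T * (\<sigma> h * e) = \<tau> h * (T * e)" by (simp add: T1(3)[OF that] flip: mult.assoc)
      then have "T * (\<sigma> h * e) = 0" by (simp add: Te)
      then show ?thesis using that by (simp add: e_def left_diff_distrib \<sigma>1 mult.assoc del: right_diff_distrib)
    qed
    have ee: "e * e = e" using e\<sigma>e[OF one_closed] \<sigma>e by simp
    have "e = 0"
    proof (rule ccontr)
      assume "e \<noteq> 0"
      define \<sigma>' where "\<sigma>' h = \<sigma> h * e" for h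
      have rep: "mat_rep H \<sigma>'"
        unfolding mat_rep_def \<sigma>'_def using \<sigma>(1) by (simp add: mult.assoc e\<sigma>e mat_rep_def)
      obtain m where m: "trace_fmat (\<sigma>' \<one>) = of_nat m" using trace_one_nat[OF rep] by blast
      have "intertwines H \<sigma>' \<rho> (F * e)"
        unfolding intertwines_def \<sigma>'_def
        using intertwinesD[OF F] by (simp add: mult.assoc e\<sigma>e flip: mult.assoc[of "\<rho> _"])
      moreover have "(e * R) * (F * e) = \<sigma>' \<one>"
      proof -
        have "(e * R) * (F * e) = e * ((R * F) * e)" by (simp add: mult.assoc)
        then show ?thesis by (simp add: R \<sigma>'_def \<sigma>e ee)
      qed
      ultimately have "sub m" unfolding sub_def using rep m \<open>e \<noteq> 0\<close> \<sigma>e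
        by (metis \<sigma>'_def)
      then have "n \<le> m" by (rule least)
      \<comment> \<open>The complementary idempotent. It is nonzero because
        \<open>T * f = T\<close>, so the kernel would be a nonzero subrepresentation of dimension
        smaller than \<open>n\<close>.\<close>
      define f where "f = \<sigma> \<one> * Y * T"
      have "T * f = T" using Y by (simp add: f_def mult.assoc T2)
      then have "f \<noteq> 0" using \<open>T \<noteq> 0\<close> by auto
      moreover have "f * f = f" unfolding f_def using Y by (metis T2 mult.assoc)
      ultimately obtain k where k: "trace_fmat f = of_nat k" "k \<noteq> 0" using trace_idempotent by blast
      have "trace_fmat (\<sigma> \<one>) = trace_fmat e + trace_fmat f" by (simp add: e_def f_def flip: trace_add)
      moreover have "trace_fmat e = of_nat m" using m by (simp add: \<sigma>'_def \<sigma>e)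
      ultimately have "of_nat n = (of_nat (m + k) :: 'k)" using tr k by simp
      then have "n = m + k" by (simp only: of_nat_eq_iff)
      with \<open>n \<le> m\<close> k show False by simp
    qed
    then have "(\<sigma> \<one> * Y) * T = \<sigma> \<one>" by (simp add: e_def mult.assoc)
    then show ?thesis by blast
  qed
  then show thesis using that \<sigma> F R by blast
qed

text \<open>The quotient lives on a linear complement of the image of \<open>F\<close>. The
  projection \<open>g\<close> along that image need not commute with the group, but the image is
  invariant, so \<open>g * \<rho> h * g = g * \<rho> h\<close> and the compression stays
  multiplicative.\<close>

lemma quotient_rep:
  assumes \<sigma>: "mat_rep H \<sigma>" and \<rho>: "mat_rep H \<rho>" and F: "intertwines H \<sigma> \<rho> F" and R: "R * F = \<sigma> \<one>"
  obtains \<rho>'' where "mat_rep H \<rho>''" "split_exact H \<sigma> \<rho> \<rho>''"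
proof -
  note \<rho>1 = mat_rep_one[OF \<rho>] and F1 = intertwinesD[OF F]
  define g where "g = \<rho> \<one> - F * R * \<rho> \<one>"
  have gF: "g * F = 0" by (simp add: g_def left_diff_distrib F1 mult.assoc R)
  have g\<rho>: "g * (\<rho> h * g) = g * \<rho> h" if "h \<in> carrier H" for h
  proof -
    have "g * (\<rho> h * F) = 0" by (simp add: F1(3)[OF that] gF flip: mult.assoc)
    then have "g * (\<rho> h * (F * A)) = 0" for A by (metis mult.assoc mult_zero_left)
    moreover have "g * (\<rho> h * g) = g * (\<rho> h * \<rho> \<one>) - g * (\<rho> h * (F * (R * \<rho> \<one>)))"
      by (subst (2) g_def) (simp add: right_diff_distrib mult.assoc)
    ultimately show ?thesis using that by (simp add: \<rho>1)
  qed
  define \<rho>'' where "\<rho>'' h = g * \<rho> h" for h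
  have g1: "g * \<rho> \<one> = g" "\<rho> \<one> * g = g"
    by (simp_all add: g_def left_diff_distrib right_diff_distrib \<rho>1 mult.assoc)
      (simp add: F1(1) flip: mult.assoc)
  have "mat_rep H \<rho>''"
    unfolding mat_rep_def
  proof (intro ballI)
    fix x y assume xy: "x \<in> carrier H" "y \<in> carrier H"
    have "\<rho>'' x * \<rho>'' y = (g * (\<rho> x * g)) * \<rho> y" by (simp add: \<rho>''_def mult.assoc)
    then show "\<rho>'' (x \<otimes> y) = \<rho>'' x * \<rho>'' y"
      using xy \<rho> by (simp add: g\<rho> mult.assoc mat_rep_mult \<rho>''_def)
  qed
  moreover have "split_exact H \<sigma> \<rho> \<rho>''"
    unfolding split_exact_def
  proof (intro exI conjI)
    show "intertwines H \<sigma> \<rho> F" by (rule F)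
    have gg: "g * g = g" using g\<rho>[OF one_closed] g1 by simp
    show "intertwines H \<rho> \<rho>'' g"
      unfolding intertwines_def \<rho>''_def by (simp add: g\<rho> g1 gg mult.assoc)
    show "(R * \<rho> \<one>) * F = \<sigma> \<one>" by (simp add: mult.assoc F1 R)
    show "g * g = \<rho>'' \<one>" by (simp add: \<rho>''_def g1 gg)
    show "F * (R * \<rho> \<one>) + g * g = \<rho> \<one>" by (simp add: gg) (simp add: g_def mult.assoc)
    show "g * F = 0" by (rule gF)
  qed
  ultimately show thesis by (rule that)
qed

text \<open>The two summands are placed on the even and on the odd coordinates.\<close>

lemma direct_sum_rep:
  fixes \<rho> \<sigma> :: "'a \<Rightarrow> 'k::field fmat"
  assumes \<rho>: "mat_rep H \<rho>" and \<sigma>: "mat_rep H \<sigma>"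
  obtains \<tau> where "mat_rep H \<tau>" "split_exact H \<rho> \<tau> \<sigma>"
proof -
  obtain n1 where n1: "\<And>h. h \<in> carrier H \<Longrightarrow> fmat_bound (\<rho> h) n1"
      using fmat_bound_uniform[OF finite_carrier, of \<rho>] by blast
  obtain n2 where n2: "\<And>h. h \<in> carrier H \<Longrightarrow> fmat_bound (\<sigma> h) n2"
      using fmat_bound_uniform[OF finite_carrier, of \<sigma>] by blast
  define n where "n = max n1 n2"
  have n: "fmat_bound (\<rho> h) n" "fmat_bound (\<sigma> h) n" if "h \<in> carrier H" for h
    using n1[OF that] n2[OF that] by (auto simp: n_def intro: fmat_bound_mono)
  \<comment> \<open>A truncated identity, large enough to act as a unit on all matrices
    \<open>\<rho> h\<close> and \<open>\<sigma> h\<close>.\<close>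
  define I :: "'k fmat" where "I = (\<Sum>j<n. unit_fmat j j 1)"
  have I: "I * A = A" if "fmat_bound A n" for A
  proof (rule fmat_eqI)
    fix i j
    have "entry (I * A) i j = (\<Sum>k<n. if i = k then entry A k j else 0)"
      by (simp add: I_def sum_distrib_right entry_unit_mult)
    then show "entry (I * A) i j = entry A i j" using fmat_bound_less[OF that, of i j] by auto
  qed
  \<comment> \<open>\<open>J1\<close> and \<open>J2\<close> insert into the even and odd
    coordinates, \<open>K1\<close> and \<open>K2\<close> extract from them.\<close>
  define J1 K1 J2 K2 :: "'k fmat" where "J1 = (\<Sum>j<n. unit_fmat (2 * j) j 1)" "K1 = (\<Sum>j<n. unit_fmat j (2 * j) 1)"
    "J2 = (\<Sum>j<n. unit_fmat (Suc (2 * j)) j 1)" "K2 = (\<Sum>j<n. unit_fmat j (Suc (2 * j)) 1)"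
  note JK = this
  have KJ: "K1 * J1 = I" "K2 * J2 = I" "K1 * J2 = 0" "K2 * J1 = 0"
  proof -
    show "K1 * J1 = I" "K2 * J2 = I"
      by (simp_all add: JK I_def sum_product unit_times_unit if_distrib cong: if_cong)
    have "2 * i \<noteq> Suc (2 * j)" "Suc (2 * j) \<noteq> 2 * i" for i j :: nat by presburger+
    then show "K1 * J2 = 0" "K2 * J1 = 0"
      by (simp_all add: JK sum_product unit_times_unit)
  qed
  have KJ': "K1 * (J1 * A) = I * A" "K2 * (J2 * A) = I * A" "K1 * (J2 * A) = 0" "K2 * (J1 * A) = 0" for A
    by (simp_all add: KJ flip: mult.assoc)
  have I': "I * (\<rho> h * A) = \<rho> h * A" "I * (\<sigma> h * A) = \<sigma> h * A" if "h \<in> carrier H" for h A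
    using that by (simp_all add: I n flip: mult.assoc)
  define \<tau> where "\<tau> h = J1 * \<rho> h * K1 + J2 * \<sigma> h * K2" for h
  note simps = distrib_left distrib_right mult.assoc KJ KJ' I I' n mat_rep_one[OF \<rho>] mat_rep_one[OF \<sigma>]
  have "mat_rep H \<tau>"
    unfolding mat_rep_def \<tau>_def
  proof (intro ballI)
    fix x y assume xy: "x \<in> carrier H" "y \<in> carrier H"
    have "\<rho> (x \<otimes> y) = \<rho> x * \<rho> y" "\<sigma> (x \<otimes> y) = \<sigma> x * \<sigma> y" using \<rho> \<sigma> xy by (simp_all add: mat_rep_mult)
    then show "J1 * \<rho> (x \<otimes> y) * K1 + J2 * \<sigma> (x \<otimes> y) * K2 =
        (J1 * \<rho> x * K1 + J2 * \<sigma> x * K2) * (J1 * \<rho> y * K1 + J2 * \<sigma> y * K2)"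
      using xy by (simp add: simps)
  qed
  moreover have "split_exact H \<rho> \<tau> \<sigma>"
    unfolding split_exact_def
  proof (intro exI conjI)
    show "intertwines H \<rho> \<tau> (J1 * \<rho> \<one>)" "intertwines H \<tau> \<sigma> (\<sigma> \<one> * K2)"
      by (simp_all add: intertwines_def \<tau>_def simps)
    show "(\<rho> \<one> * K1) * (J1 * \<rho> \<one>) = \<rho> \<one>" "(\<sigma> \<one> * K2) * (J2 * \<sigma> \<one>) = \<sigma> \<one>"
      "(J1 * \<rho> \<one>) * (\<rho> \<one> * K1) + (J2 * \<sigma> \<one>) * (\<sigma> \<one> * K2) = \<tau> \<one>"
      "(\<sigma> \<one> * K2) * (J1 * \<rho> \<one>) = 0"
      by (simp_all add: \<tau>_def simps)
  qed
  ultimately show thesis by (rule that)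
qed

text \<open>
  Two representations with the same character share a simple subrepresentation, which is split off
  from both; \<open>E\<close> plays the role of the subgroup of exact relations.
\<close>

lemma equal_characters_congruent:
  fixes f :: "('a \<Rightarrow> 'k::field_char_0 fmat) \<Rightarrow> 'g::ab_group_add"
  assumes E: "0 \<in> E" "\<And>x y. x \<in> E \<Longrightarrow> y \<in> E \<Longrightarrow> x - y \<in> E"
    and f: "\<And>\<rho>' \<rho> \<rho>''. \<lbrakk>mat_rep H \<rho>'; mat_rep H \<rho>; mat_rep H \<rho>''; split_exact H \<rho>' \<rho> \<rho>''\<rbrakk> \<Longrightarrow> f \<rho> - f \<rho>' - f \<rho>'' \<in> E"
    and "mat_rep H \<rho>" "mat_rep H \<tau>" "\<And>h. h \<in> carrier H \<Longrightarrow> trace_fmat (\<rho> h) = trace_fmat (\<tau> h)"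
  shows "f \<rho> - f \<tau> \<in> E"
proof -
  have "f \<rho> - f \<tau> \<in> E" if "trace_fmat (\<rho> \<one>) = of_nat n" "mat_rep H \<rho>" "mat_rep H \<tau>"
      "\<And>h. h \<in> carrier H \<Longrightarrow> trace_fmat (\<rho> h) = trace_fmat (\<tau> h)" for n \<rho> \<tau>
    using that
  proof (induction n arbitrary: \<rho> \<tau> rule: less_induct)
    case (less n)
    have zero: "f \<upsilon> \<in> E" if \<upsilon>: "mat_rep H \<upsilon>" "\<upsilon> \<one> = 0" for \<upsilon>
    proof -
      have "\<upsilon> h = 0" if "h \<in> carrier H" for h using mat_rep_one(1)[OF \<upsilon>(1) that] \<upsilon>(2) by simp
      \<comment> \<open>A zero representation is the sum of two copies of itself, and this relation
        puts \<open>- f \<upsilon>\<close> into \<open>E\<close>.\<close>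
      then have "split_exact H \<upsilon> \<upsilon> \<upsilon>"
        unfolding split_exact_def intertwines_def by (intro exI[of _ 0]) (auto simp: \<upsilon>)
      then have "0 - (f \<upsilon> - f \<upsilon> - f \<upsilon>) \<in> E" using f E \<upsilon> by blast
      then show ?thesis by simp
    qed
    show ?case
    proof (cases "\<rho> \<one> = 0")
      case True
      then have "trace_fmat (\<tau> \<one>) = 0" using less.prems(4)[OF one_closed] by simp
      then have "\<tau> \<one> = 0" using trace_one_nat[OF less.prems(3)] by (metis of_nat_eq_0_iff)
      with True zero less.prems E show ?thesis by blast
    next
      case False
      from simple_subrep[OF less.prems(2) False] obtain \<sigma> F R where \<sigma>: "mat_rep H \<sigma>" "\<sigma> \<one> \<noteq> 0"
        and F: "intertwines H \<sigma> \<rho> F" "R * F = \<sigma> \<one>"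
        and mono: "\<And>\<tau> T. \<lbrakk>mat_rep H \<tau>; intertwines H \<sigma> \<tau> T; T \<noteq> 0\<rbrakk> \<Longrightarrow> \<exists>R. R * T = \<sigma> \<one>"
        by blast
      \<comment> \<open>The numbers \<open>a\<close> and \<open>b\<close> are computed from the
        characters alone and therefore agree; \<open>F\<close> makes \<open>a\<close> nonzero, so
        \<tau> also receives a nonzero intertwiner from \<sigma>.\<close>
      obtain a where a: "(\<Sum>h\<in>carrier H. trace_fmat (\<rho> h) * trace_fmat (\<sigma> (inv h))) = of_nat (card (carrier H)) * of_nat a"
        "a = 0 \<longleftrightarrow> (\<forall>T. intertwines H \<sigma> \<rho> T \<longrightarrow> T = 0)" using character_pairing[OF less.prems(2) \<sigma>(1)] by metis
      obtain b where b: "(\<Sum>h\<in>carrier H. trace_fmat (\<tau> h) * trace_fmat (\<sigma> (inv h))) = of_nat (card (carrier H)) * of_nat b"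
        "b = 0 \<longleftrightarrow> (\<forall>T. intertwines H \<sigma> \<tau> T \<longrightarrow> T = 0)" using character_pairing[OF less.prems(3) \<sigma>(1)] by metis
      have "of_nat (card (carrier H)) * of_nat a = (of_nat (card (carrier H)) * of_nat b :: 'k)"
        unfolding a(1)[symmetric] b(1)[symmetric] using less.prems(4) by (intro sum.cong) auto
      then have "a = b" using card_carrier_pos by simp
      moreover have "F \<noteq> 0" using F(2) \<sigma>(2) by auto
      ultimately obtain T where T: "intertwines H \<sigma> \<tau> T" "T \<noteq> 0" using a(2) b(2) F(1) by blast
      then obtain R' where R': "R' * T = \<sigma> \<one>" using mono less.prems(3) by blast
      obtain \<rho>'' where \<rho>'': "mat_rep H \<rho>''" "split_exact H \<sigma> \<rho> \<rho>''"
        using quotient_rep[OF \<sigma>(1) less.prems(2) F] by blast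
      obtain \<tau>'' where \<tau>'': "mat_rep H \<tau>''" "split_exact H \<sigma> \<tau> \<tau>''"
        using quotient_rep[OF \<sigma>(1) less.prems(3) T(1) R'] by blast
      obtain k where k: "trace_fmat (\<sigma> \<one>) = of_nat k" "k \<noteq> 0" using trace_one_nat[OF \<sigma>(1)] \<sigma>(2) by blast
      obtain m where m: "trace_fmat (\<rho>'' \<one>) = of_nat m" using trace_one_nat[OF \<rho>''(1)] by blast
      have "of_nat n = (of_nat (k + m) :: 'k)"
        using split_exact_trace[OF \<sigma>(1) less.prems(2) \<rho>'' one_closed] k m less.prems(1) by simp
      then have "m < n" using k by (simp only: of_nat_eq_iff)
      moreover have "trace_fmat (\<rho>'' h) = trace_fmat (\<tau>'' h)" if "h \<in> carrier H" for h
        using split_exact_trace[OF \<sigma>(1) less.prems(2) \<rho>'' that]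
          split_exact_trace[OF \<sigma>(1) less.prems(3) \<tau>'' that] less.prems(4)[OF that] by simp
      ultimately have 1: "f \<rho>'' - f \<tau>'' \<in> E" using less.IH m \<rho>''(1) \<tau>''(1) by blast
      have 2: "f \<rho> - f \<sigma> - f \<rho>'' \<in> E" "f \<tau> - f \<sigma> - f \<tau>'' \<in> E"
        using f \<sigma>(1) less.prems \<rho>'' \<tau>'' by blast+
      have "(f \<rho> - f \<sigma> - f \<rho>'') - ((f \<tau> - f \<sigma> - f \<tau>'') - (f \<rho>'' - f \<tau>'')) \<in> E" using E 1 2 by blast
      then show ?thesis by (simp add: algebra_simps)
    qed
  qed
  moreover obtain n where "trace_fmat (\<rho> \<one>) = of_nat n" using trace_one_nat[OF assms(4)] by blast
  ultimately show ?thesis using assms by blast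
qed

end

section \<open>Galois invariance of rational characters\<close>

text \<open>Orbits of a map whose \<open>p\<close>-th iterate is the identity have 1 or
  \<open>p\<close> elements, and an orbit with \<open>p\<close> elements contributes
  \<open>p\<close> times one value of \<open>f\<close>.\<close>

lemma prime_orbit_sum:
  fixes f :: "'b \<Rightarrow> int"
  assumes p: "Factorial_Ring.prime p" and "finite S" and r: "\<And>x. x \<in> S \<Longrightarrow> r x \<in> S" "\<And>x. x \<in> S \<Longrightarrow> (r ^^ p) x = x"
    and f: "\<And>x. x \<in> S \<Longrightarrow> f (r x) = f x"
  shows "int p dvd (\<Sum>x\<in>S. f x) - (\<Sum>x\<in>{x\<in>S. r x = x}. f x)"
proof -
  have "p > 0" using p prime_gt_0_nat by blast
  have "int p dvd (\<Sum>x\<in>T. f x)" if "T \<subseteq> S" "\<And>x. x \<in> T \<Longrightarrow> r x \<in> T \<and> r x \<noteq> x" for T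
    using that
  proof (induction "card T" arbitrary: T rule: less_induct)
    case (less T)
    have T: "finite T" using less.prems(1) \<open>finite S\<close> finite_subset by blast
    show ?case
    proof (cases "T = {}")
      case False
      then obtain x where x: "x \<in> T" by blast
      have iter_T: "(r ^^ i) x \<in> T" for i by (induction i) (use x less.prems in auto)
      have period: "(r ^^ (p * k)) x = x" for k
        by (induction k) (use r(2) x less.prems(1) in \<open>auto simp: funpow_add\<close>)
      have mod: "(r ^^ i) x = (r ^^ (i mod p)) x" for i
        using funpow_add[of "i mod p" "p * (i div p)" r] period by (metis add.commute comp_apply mult_div_mod_eq)
      \<comment> \<open>An orbit shorter than \<open>p\<close> would, by Bezout, make
        \<open>x\<close> a fixed point of \<open>r\<close>.\<close>
      have inj: "(r ^^ d) x \<noteq> x" if "0 < d" "d < p" for d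
      proof
        assume d: "(r ^^ d) x = x"
        have "gcd d p = 1" using that p by (metis coprime_iff_gcd_eq_1 gcd.commute nat_dvd_not_less prime_imp_coprime)
        moreover have "\<exists>a b. d * a = p * b + gcd d p" using that by (intro bezout_nat) simp
        ultimately obtain a b where ab: "d * a = p * b + 1" by auto
        have "(r ^^ (d * a)) x = x" by (induction a) (auto simp: funpow_add d)
        moreover have "(r ^^ (d * a)) x = r x" using period unfolding ab by simp
        ultimately show False using less.prems(2) x by simp
      qed
      define orb where "orb = (\<lambda>i. (r ^^ i) x) ` {..<p}"
      have "inj_on (\<lambda>i. (r ^^ i) x) {..<p}"
      proof (rule linorder_inj_onI)
        fix i j assume ij: "i < j" "i \<in> {..<p}" "j \<in> {..<p}"
        show "(r ^^ i) x \<noteq> (r ^^ j) x"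
        proof
          assume eq: "(r ^^ i) x = (r ^^ j) x"
          have "(r ^^ (j - i)) x = (r ^^ (j + (p - i))) x"
          proof -
            have "(j + (p - i)) mod p = ((j - i) + p) mod p" by (rule arg_cong[of _ _ "\<lambda>a. a mod p"]) (use ij in auto)
            also have "\<dots> = (j - i) mod p" by (rule mod_add_self2)
            also have "\<dots> = j - i" using ij by (intro mod_less) auto
            finally show ?thesis using mod[of "j + (p - i)"] by simp
          qed
          also have "\<dots> = (r ^^ (p - i)) ((r ^^ j) x)" by (simp add: funpow_add add.commute[of j])
          also have "\<dots> = (r ^^ (p - i + i)) x" by (simp add: funpow_add eq)
          also have "\<dots> = x" using ij period[of 1] by simp
          finally show False using inj[of "j - i"] ij by (simp add: less_imp_diff_less)
        qed
      qed auto
      then have card_orb: "(\<Sum>y\<in>orb. f y) = (\<Sum>i<p. f ((r ^^ i) x))" unfolding orb_def by (simp add: sum.reindex)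
      have "f ((r ^^ i) x) = f x" for i
        by (induction i) (use iter_T less.prems(1) f in \<open>auto simp: subset_iff\<close>)
      then have "int p dvd (\<Sum>y\<in>orb. f y)" by (simp add: card_orb)
      moreover have "int p dvd (\<Sum>y\<in>T - orb. f y)"
      proof (rule less.hyps)
        have "x \<in> orb" unfolding orb_def using \<open>p > 0\<close> by (auto intro!: image_eqI[of _ _ 0])
        then show "card (T - orb) < card T" using T x by (intro psubset_card_mono) auto
        show "T - orb \<subseteq> S" using less.prems by blast
        fix y assume y: "y \<in> T - orb"
        \<comment> \<open>\<open>r ^^ (p - 1)\<close> inverts \<open>r\<close>, so the orbit can be
          traced backwards from \<open>r y\<close> to \<open>y\<close>.\<close>
        have "r y \<notin> orb"
        proof
          assume "r y \<in> orb"
          then obtain i where i: "r y = (r ^^ i) x" unfolding orb_def by blast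
          have "y = (r ^^ (p - 1 + 1)) y" using r(2)[of y] y less.prems(1) \<open>p > 0\<close> by auto
          also have "\<dots> = (r ^^ (p - 1 + i)) x" by (simp only: funpow_add comp_apply funpow.simps i funpow_0 One_nat_def id_apply)
          also have "\<dots> = (r ^^ ((p - 1 + i) mod p)) x" by (rule mod)
          finally have "y \<in> orb" unfolding orb_def using \<open>p > 0\<close> by auto
          with y show False by blast
        qed
        then show "r y \<in> T - orb \<and> r y \<noteq> y" using y less.prems(2) by blast
      qed
      moreover have "(\<Sum>x\<in>T. f x) = (\<Sum>y\<in>orb. f y) + (\<Sum>y\<in>T - orb. f y)"
        using sum.subset_diff[of orb T f] iter_T T by (auto simp: orb_def add.commute)
      ultimately show ?thesis by simp
    qed simp
  qed
  then have "int p dvd (\<Sum>x\<in>{x\<in>S. r x \<noteq> x}. f x)"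
  proof (rule)
    fix x assume x: "x \<in> {x \<in> S. r x \<noteq> x}"
    \<comment> \<open>If \<open>r x\<close> were fixed, then
      \<open>x = (r ^^ (p - 1)) (r x) = r x\<close>.\<close>
    have "r (r x) \<noteq> r x"
    proof
      assume eq: "r (r x) = r x"
      have "(r ^^ i) (r x) = r x" for i by (induction i) (simp_all add: eq)
      then have "(r ^^ (p - 1 + 1)) x = r x" by (simp only: funpow_add comp_apply funpow.simps funpow_0 One_nat_def id_apply)
      then show False using r(2)[of x] x \<open>p > 0\<close> by auto
    qed
    then show "r x \<in> {x \<in> S. r x \<noteq> x} \<and> r x \<noteq> x" using x r(1) by auto
  qed auto
  moreover have "(\<Sum>x\<in>S. f x) = (\<Sum>x\<in>{x\<in>S. r x = x}. f x) + (\<Sum>x\<in>{x\<in>S. r x \<noteq> x}. f x)"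
    using \<open>finite S\<close> by (subst sum.union_disjoint[symmetric]) (auto intro: sum.cong)
  ultimately show ?thesis by simp
qed

section \<open>Closed walks and traces of prime powers\<close>

definition words :: "nat \<Rightarrow> nat \<Rightarrow> nat list set" where
  "words n k = {xs. set xs \<subseteq> {..<n} \<and> length xs = k}"

text \<open>The weight of a path with the listed interior vertices; a list of length
  \<open>k\<close> gives \<open>k + 1\<close> factors. Sums of these weights over words expand the
  entries of matrix powers.\<close>

fun walk :: "(nat \<Rightarrow> nat \<Rightarrow> 'r::comm_ring_1) \<Rightarrow> nat \<Rightarrow> nat list \<Rightarrow> nat \<Rightarrow> 'r" where
  "walk A x [] y = A x y"
| "walk A x (z # zs) y = A x z * walk A z zs y"

text \<open>The head serves as both end points, so a word of length \<open>p\<close> gives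
  \<open>p\<close> factors, and the words of length \<open>p\<close> together give the trace of the
  \<open>p\<close>-th power.\<close>

definition closed_walk :: "(nat \<Rightarrow> nat \<Rightarrow> 'r::comm_ring_1) \<Rightarrow> nat list \<Rightarrow> 'r" where
  "closed_walk A xs = walk A (hd xs) (tl xs) (hd xs)"

lemma finite_words: "finite (words n k)"
  unfolding words_def by (rule finite_lists_length_eq) simp

lemma words_Suc: "words n (Suc k) = (\<lambda>(z, zs). z # zs) ` ({..<n} \<times> words n k)"
  by (auto simp: words_def length_Suc_conv image_iff)

lemma sum_words_Suc: "(\<Sum>xs\<in>words n (Suc k). f xs) = (\<Sum>z<n. \<Sum>zs\<in>words n k. f (z # zs))"
proof -
  have "(\<Sum>xs\<in>words n (Suc k). f xs) = (\<Sum>x\<in>{..<n} \<times> words n k. f (fst x # snd x))"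
    unfolding words_Suc by (subst sum.reindex) (auto simp: inj_on_def case_prod_beta)
  also have "\<dots> = (\<Sum>z<n. \<Sum>zs\<in>words n k. f (z # zs))"
    by (simp add: sum.cartesian_product case_prod_beta)
  finally show ?thesis .
qed

lemma walk_snoc: "walk A x (zs @ [w]) y = walk A x zs w * A w y"
  by (induction zs arbitrary: x) (auto simp: mult_ac)

text \<open>Rotation only changes the vertex at which the same cycle is entered.\<close>

lemma closed_walk_rotate1: "closed_walk A (rotate1 xs) = closed_walk A xs"
proof (cases xs)
  case (Cons x ys)
  then show ?thesis by (cases ys) (auto simp: closed_walk_def walk_snoc mult_ac)
qed simp

lemma rotate1_fixed:
  assumes "rotate1 xs = xs" "xs \<noteq> []"
  shows "xs = replicate (length xs) (hd xs)"
proof -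
  have "x = hd xs" if x: "x \<in> set xs" for x
  proof -
    obtain i where i: "i < length xs" "xs ! i = x" using x by (auto simp: in_set_conv_nth)
    have "rotate i xs = xs" by (induction i) (simp_all add: assms)
    then have "hd xs = xs ! (i mod length xs)" using hd_rotate_conv_nth[OF assms(2), of i] by simp
    with i show ?thesis by simp
  qed
  then show ?thesis by (intro replicate_length_same[symmetric]) blast
qed

lemma closed_walk_replicate: "closed_walk A (replicate (Suc k) x) = A x x ^ Suc k"
  unfolding closed_walk_def by (induction k) auto

text \<open>Rotation acts on the words of length \<open>p\<close> with order dividing
  \<open>p\<close> and fixes exactly the constant ones, whose weights are the \<open>p\<close>-th
  powers of the diagonal entries. In matrix terms, tr(A^p) is congruent to the sum of the
  \<open>A i i ^ p\<close>.\<close>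

lemma prime_closed_walk_sum:
  fixes A :: "nat \<Rightarrow> nat \<Rightarrow> int"
  assumes p: "Factorial_Ring.prime p"
  shows "int p dvd (\<Sum>xs\<in>words n p. closed_walk A xs) - (\<Sum>i<n. A i i ^ p)"
proof -
  obtain k where k: "p = Suc k" using p by (metis not0_implies_Suc not_prime_0)
  have "{xs \<in> words n p. rotate1 xs = xs} = replicate p ` {..<n}"
  proof
    show "{xs \<in> words n p. rotate1 xs = xs} \<subseteq> replicate p ` {..<n}"
    proof
      fix xs assume "xs \<in> {xs \<in> words n p. rotate1 xs = xs}"
      then have xs: "set xs \<subseteq> {..<n}" "length xs = p" "rotate1 xs = xs" by (auto simp: words_def)
      then have "xs \<noteq> []" using k by auto
      then have "xs = replicate p (hd xs)" "hd xs < n"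
        using xs rotate1_fixed[of xs] subsetD[OF xs(1) hd_in_set] by auto
      then show "xs \<in> replicate p ` {..<n}" by blast
    qed
    show "replicate p ` {..<n} \<subseteq> {xs \<in> words n p. rotate1 xs = xs}"
      by (auto simp: words_def k replicate_append_same)
  qed
  then have "(\<Sum>xs\<in>{xs\<in>words n p. rotate1 xs = xs}. closed_walk A xs) = (\<Sum>i<n. A i i ^ p)"
    by (simp add: sum.reindex inj_on_def k closed_walk_replicate del: replicate_Suc power_Suc)
  moreover have "int p dvd (\<Sum>xs\<in>words n p. closed_walk A xs) - (\<Sum>xs\<in>{xs\<in>words n p. rotate1 xs = xs}. closed_walk A xs)"
  proof (rule prime_orbit_sum[OF p finite_words])
    fix xs assume xs: "xs \<in> words n p"
    then show "rotate1 xs \<in> words n p" by (simp add: words_def)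
    have "rotate (length xs) xs = xs" by simp
    then show "(rotate1 ^^ p) xs = xs" using xs by (simp add: words_def rotate_def)
  qed (rule closed_walk_rotate1)
  ultimately show ?thesis by simp
qed

text \<open>Fermat's little theorem is the case of the all-one matrix.\<close>

lemma prime_dvd_power_self_diff:
  fixes b :: int
  assumes p: "Factorial_Ring.prime p"
  shows "int p dvd b ^ p - b"
proof -
  \<comment> \<open>The residue of \<open>b\<close> is used as the size of the all-one matrix: there
    are \<open>n ^ p\<close> words and \<open>n\<close> diagonal entries.\<close>
  define n where "n = nat (b mod int p)"
  have "p > 0" using p prime_gt_0_nat by blast
  then have n: "int n = b mod int p" by (simp add: n_def)
  have walk1: "walk (\<lambda>_ _. 1 :: int) x zs y = 1" for x y zs by (induction zs arbitrary: x) auto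
  have "int p dvd (\<Sum>xs\<in>words n p. closed_walk (\<lambda>_ _. 1) xs) - (\<Sum>i<n. 1 ^ p)"
    by (rule prime_closed_walk_sum[OF p])
  moreover have "card (words n p) = n ^ p" unfolding words_def by (subst card_lists_length_eq) auto
  ultimately have "int p dvd int n ^ p - int n" by (simp add: closed_walk_def walk1)
  moreover have "(b ^ p - b) mod int p = (int n ^ p - int n) mod int p"
    unfolding n by (rule mod_diff_cong) (simp_all add: power_mod)
  ultimately show ?thesis by (simp add: dvd_eq_mod_eq_0)
qed

section \<open>Rational characters at powers of an element\<close>

lemma common_denominator:
  assumes "finite (Q :: rat set)"
  shows "\<exists>D>0. \<forall>q\<in>Q. of_int D * q \<in> \<int>"
  using assms
proof (induction Q)
  case (insert q Q)
  then obtain D where D: "D > 0" "\<And>q. q \<in> Q \<Longrightarrow> of_int D * q \<in> \<int>" by blast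
  obtain a b where ab: "quotient_of q = (a, b)" by fastforce
  then have q: "b > 0" "q = of_int a / of_int b" by (auto simp: quotient_of_denom_pos quotient_of_div)
  have "of_int (D * b) * q = of_int (D * a)" using q by simp
  then have "of_int (D * b) * q \<in> \<int>" by (metis Ints_of_int)
  moreover have "of_int (D * b) * q' \<in> \<int>" if "q' \<in> Q" for q'
    using Ints_mult[OF Ints_of_int[of b] D(2)[OF that]] by (simp add: mult_ac)
  ultimately show ?case using D(1) q(1) by (intro exI[of _ "D * b"]) auto
qed (auto intro: exI[of _ 1])

context finite_group begin

text \<open>The exponent starts at 1: a path with \<open>k\<close> interior vertices has
  \<open>k + 1\<close> steps, and at exponent 0 the matrix \<open>\<rho> \<one>\<close> can be any
  idempotent.\<close>

lemma entry_rep_power: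
  assumes \<rho>: "mat_rep H \<rho>" and x: "x \<in> carrier H" and n: "fmat_bound (\<rho> x) n"
  shows "entry (\<rho> (x [^] Suc k)) i j = (\<Sum>zs\<in>words n k. walk (entry (\<rho> x)) i zs j)"
proof (induction k arbitrary: i)
  case 0
  have "words n 0 = {[]}" by (auto simp: words_def)
  then show ?case using x by simp
next
  case (Suc k)
  have "\<rho> (x [^] Suc (Suc k)) = \<rho> x * \<rho> (x [^] Suc k)"
    using \<rho> x nat_pow_Suc2[OF x, of "Suc k"] by (simp only: mat_rep_mult nat_pow_closed)
  then show ?case by (simp only: entry_times_bound[OF n] Suc sum_words_Suc walk.simps sum_distrib_left)
qed

lemma trace_rep_power:
  assumes \<rho>: "mat_rep H \<rho>" and x: "x \<in> carrier H"
    and n: "\<And>x. x \<in> carrier H \<Longrightarrow> fmat_bound (\<rho> x) n" and "p > 0"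
  shows "trace_fmat (\<rho> (x [^] p)) = (\<Sum>xs\<in>words n p. closed_walk (entry (\<rho> x)) xs)"
proof -
  obtain k where k: "p = Suc k" using \<open>p > 0\<close> by (metis gr0_implies_Suc)
  have "fmat_bound (\<rho> (x [^] Suc k)) n" using n x nat_pow_closed by blast
  then show ?thesis
    using entry_rep_power[OF \<rho> x n[OF x]]
    by (simp only: k trace_bound sum_words_Suc closed_walk_def list.sel)
qed

text \<open>Let \<open>D\<close> be a common denominator and \<open>v x\<close> the integer
  \<open>D * trace_fmat (\<rho> x)\<close>. Expanding the \<open>p\<close>-th power of the integer
  matrix \<open>D * \<rho> x\<close> gives \<open>D ^ p * v (x [^] p) \<equiv> D * v x\<close>
  modulo \<open>p\<close>. As \<open>D ^ p \<equiv> D\<close>, the prime \<open>p\<close> divides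
  \<open>D * (v (x [^] p) - v x)\<close>, and for large \<open>p\<close> this forces
  equality.\<close>

lemma trace_large_prime_power:
  fixes \<rho> :: "'a \<Rightarrow> rat fmat"
  assumes \<rho>: "mat_rep H \<rho>"
  obtains B where "\<And>p x. \<lbrakk>Factorial_Ring.prime (p :: nat); B < p; x \<in> carrier H\<rbrakk> \<Longrightarrow> trace_fmat (\<rho> (x [^] p)) = trace_fmat (\<rho> x)"
proof -
  obtain n where n: "\<And>x. x \<in> carrier H \<Longrightarrow> fmat_bound (\<rho> x) n"
    using fmat_bound_uniform[OF finite_carrier, of \<rho>] by blast
  let ?Q = "(\<lambda>(x, i, j). entry (\<rho> x) i j) ` (carrier H \<times> {..<n} \<times> {..<n})"
  have "finite ?Q" using finite_carrier by blast
  then obtain D :: int where D: "D > 0" and DQ: "\<And>q. q \<in> ?Q \<Longrightarrow> of_int D * q \<in> \<int>"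
    using common_denominator by meson
  have D2: "of_int D * entry (\<rho> x) i j \<in> \<int>" if "x \<in> carrier H" "i < n" "j < n" for x i j
    by (rule DQ) (use that in \<open>auto intro!: image_eqI[of _ _ "(x, i, j)"]\<close>)
  \<comment> \<open>The floor changes nothing but the type: all these entries are integers after
    multiplication by \<open>D\<close>.\<close>
  define A where "A x i j = (if i < n \<and> j < n then \<lfloor>of_int D * entry (\<rho> x) i j\<rfloor> else 0)" for x i j
  have A: "of_int (A x i j) = of_int D * entry (\<rho> x) i j" if "x \<in> carrier H" for x i j
  proof (cases "i < n \<and> j < n")
    case True
    then show ?thesis using D2[OF that] by (simp add: A_def)
  next
    case False
    then show ?thesis using fmat_bound_less[OF n[OF that], of i j] by (auto simp: A_def)
  qed
  have walk: "of_int (walk (A x) i zs j) = of_int D ^ Suc (length zs) * walk (entry (\<rho> x)) i zs j"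
    if "x \<in> carrier H" for x i zs j
    by (induction zs arbitrary: i) (simp_all add: A[OF that] mult_ac)
  have closed: "of_int (closed_walk (A x) xs) = of_int D ^ p * closed_walk (entry (\<rho> x)) xs"
    if "x \<in> carrier H" "xs \<in> words n p" "p > 0" for x xs p
  proof -
    have "Suc (length (tl xs)) = p" using that(2,3) by (simp add: words_def)
    then show ?thesis using walk[OF that(1), of "hd xs" "tl xs" "hd xs"] by (simp only: closed_walk_def)
  qed
  define v where "v x = (\<Sum>i<n. A x i i)" for x
  have v: "of_int (v x) = of_int D * trace_fmat (\<rho> x)" if "x \<in> carrier H" for x
    by (simp add: v_def A[OF that] trace_bound[OF n[OF that]] sum_distrib_left)
  \<comment> \<open>A bound for all values of \<open>v\<close>, so that a prime above
    \<open>D + 2 * M\<close> divides neither \<open>D\<close> nor a nonzero difference of two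
    values.\<close>
  define M where "M = (\<Sum>x\<in>carrier H. \<bar>v x\<bar>)"
  have M: "\<bar>v x\<bar> \<le> M" if "x \<in> carrier H" for x
    unfolding M_def using that finite_carrier by (intro member_le_sum) auto
  have "trace_fmat (\<rho> (x [^] p)) = trace_fmat (\<rho> x)"
    if p: "Factorial_Ring.prime (p :: nat)" "nat (D + 2 * M) < p" and x: "x \<in> carrier H" for p x
  proof -
    let ?y = "x [^] p"
    have y: "?y \<in> carrier H" using x by simp
    have "p > 0" using p prime_gt_0_nat by blast
    have "of_int (\<Sum>xs\<in>words n p. closed_walk (A x) xs) = of_int D ^ p * trace_fmat (\<rho> ?y)"
    proof -
      have "trace_fmat (\<rho> ?y) = (\<Sum>xs\<in>words n p. closed_walk (entry (\<rho> x)) xs)"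
        using \<rho> x n \<open>p > 0\<close> by (rule trace_rep_power)
      then show ?thesis using closed[OF x _ \<open>p > 0\<close>] by (simp add: sum_distrib_left)
    qed
    then have "of_int (D * (\<Sum>xs\<in>words n p. closed_walk (A x) xs)) = (of_int (D ^ p * v ?y) :: rat)"
      using v[OF y] by simp
    then have 1: "D * (\<Sum>xs\<in>words n p. closed_walk (A x) xs) = D ^ p * v ?y" by (simp only: of_int_eq_iff)
    have "int p dvd (\<Sum>xs\<in>words n p. closed_walk (A x) xs) - (\<Sum>i<n. A x i i ^ p)"
      by (rule prime_closed_walk_sum[OF p(1)])
    moreover have "int p dvd (\<Sum>i<n. A x i i ^ p) - v x"
      unfolding v_def sum_subtractf[symmetric] by (intro dvd_sum prime_dvd_power_self_diff p(1))
    ultimately have "int p dvd ((\<Sum>xs\<in>words n p. closed_walk (A x) xs) - (\<Sum>i<n. A x i i ^ p)) + ((\<Sum>i<n. A x i i ^ p) - v x)"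
      by (rule dvd_add)
    then have "int p dvd D * ((\<Sum>xs\<in>words n p. closed_walk (A x) xs) - v x)" by simp
    then have "int p dvd D ^ p * v ?y - D * v x" by (simp add: right_diff_distrib 1)
    moreover have "int p dvd (D ^ p - D) * v ?y" using prime_dvd_power_self_diff[OF p(1)] by (rule dvd_mult2)
    ultimately have "int p dvd (D ^ p * v ?y - D * v x) - (D ^ p - D) * v ?y" by (rule dvd_diff)
    moreover have "(D ^ p * v ?y - D * v x) - (D ^ p - D) * v ?y = D * (v ?y - v x)" by (simp add: algebra_simps)
    ultimately have "int p dvd D \<or> int p dvd v ?y - v x" using p(1) by (simp add: prime_dvd_mult_iff)
    moreover have "D < int p" "\<bar>v ?y - v x\<bar> < int p" using p(2) D M[OF x] M[OF y] by linarith+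
    ultimately have "v ?y = v x" using D using zdvd_not_zless[OF D] dvd_imp_le_int[of "v ?y - v x" "int p"] by force
    then show ?thesis using v[OF x] v[OF y] D by simp
  qed
  then show thesis by (rule that)
qed

text \<open>
  Every residue class prime to the order of \<open>x\<close> contains an exponent all of whose prime factors are large;
  this replaces the irreducibility of cyclotomic polynomials.
\<close>

lemma trace_coprime_power:
  fixes \<rho> :: "'a \<Rightarrow> rat fmat"
  assumes \<rho>: "mat_rep H \<rho>" and x: "x \<in> carrier H" and k: "coprime k (ord x)"
  shows "trace_fmat (\<rho> (x [^] k)) = trace_fmat (\<rho> x)"
proof -
  obtain B where B: "\<And>p x. \<lbrakk>Factorial_Ring.prime (p :: nat); B < p; x \<in> carrier H\<rbrakk> \<Longrightarrow> trace_fmat (\<rho> (x [^] p)) = trace_fmat (\<rho> x)"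
    using trace_large_prime_power[OF \<rho>] by blast
  define m where "m = ord x"
  have "m > 0" using ord_ge_1[OF finite_carrier x] by (simp add: m_def)
  \<comment> \<open>The exponent \<open>k' = k + m * (\<Prod>p\<in>S. p)\<close> avoids every prime
    up to \<open>B\<close>: those dividing \<open>m\<close> do not divide \<open>k\<close> by
    coprimality; those dividing \<open>k\<close> divide neither \<open>m\<close> nor the product;
    the remaining ones lie in \<open>S\<close> and divide the second summand but not
    \<open>k\<close>.\<close>
  define S where "S = {p. Factorial_Ring.prime p \<and> p \<le> B \<and> \<not> p dvd m \<and> \<not> p dvd k}"
  have S: "finite S" by (rule finite_subset[of _ "{..B}"]) (auto simp: S_def)
  define k' where "k' = k + m * (\<Prod>p\<in>S. p)"
  have "(\<Prod>p\<in>S. p) > 0" by (rule prod_pos) (auto simp: S_def prime_gt_0_nat)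
  then have "k' > 0" using \<open>m > 0\<close> by (simp add: k'_def)
  have large: "B < q" if q: "Factorial_Ring.prime q" "q dvd k'" for q
  proof (rule ccontr)
    assume "\<not> B < q"
    show False
    proof (cases "q dvd m")
      case True
      then have "q dvd k" using q(2) by (simp add: k'_def dvd_add_left_iff)
      then show False using True k q(1) by (metis coprime_common_divisor m_def not_prime_unit)
    next
      case False
      show False
      proof (cases "q dvd k")
        case True
        then have "q dvd m * (\<Prod>p\<in>S. p)" using q(2) by (simp add: k'_def dvd_add_right_iff)
        then have "q dvd (\<Prod>p\<in>S. p)" using False q(1) by (simp add: prime_dvd_mult_iff)
        then obtain p where "p \<in> S" "q dvd p" using S q(1) by (auto simp: prime_dvd_prod_iff)
        then have "p = q" using q(1) by (auto simp: S_def intro: primes_dvd_imp_eq[symmetric])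
        then show False using \<open>p \<in> S\<close> True by (simp add: S_def)
      next
        case False
        with \<open>\<not> q dvd m\<close> \<open>\<not> B < q\<close> q have "q \<in> S" by (simp add: S_def)
        then have "q dvd (\<Prod>p\<in>S. p)" using S by (rule dvd_prodI[rotated])
        then show False using False q(2) by (simp add: k'_def dvd_add_left_iff)
      qed
    qed
  qed
  \<comment> \<open>The exponent is worked off one prime factor at a time; each factor exceeds
    \<open>B\<close>.\<close>
  have "trace_fmat (\<rho> (y [^] l)) = trace_fmat (\<rho> y)"
    if "l > 0" "\<And>q. Factorial_Ring.prime q \<Longrightarrow> q dvd l \<Longrightarrow> B < q" "y \<in> carrier H" for l y
    using that
  proof (induction l arbitrary: y rule: less_induct)
    case (less l)
    show ?case
    proof (cases "l = 1")
      case False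
      then obtain p where p: "Factorial_Ring.prime p" "p dvd l" using prime_factor_nat by blast
      then obtain l' where l': "l = p * l'" by blast
      have "l' < l" "l' > 0" using less.prems(1) l' prime_gt_1_nat[OF p(1)] by auto
      have "y [^] l = (y [^] p) [^] l'" using less.prems(3) by (simp add: l' nat_pow_pow)
      also have "trace_fmat (\<rho> \<dots>) = trace_fmat (\<rho> (y [^] p))"
        using less.prems \<open>l' < l\<close> \<open>l' > 0\<close> l' by (intro less.IH) auto
      also have "\<dots> = trace_fmat (\<rho> y)" using B p less.prems by blast
      finally show ?thesis .
    qed (use less.prems in simp)
  qed
  then have "trace_fmat (\<rho> (x [^] k')) = trace_fmat (\<rho> x)" using \<open>k' > 0\<close> large x by blast
  moreover have "x [^] k' = x [^] k"
  proof -
    have "x [^] k' = x [^] k \<otimes> (x [^] m) [^] (\<Prod>p\<in>S. p)"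
      using x by (simp add: k'_def nat_pow_mult nat_pow_pow)
    then show ?thesis using x by (simp add: m_def pow_ord_eq_1)
  qed
  ultimately show ?thesis by simp
qed

text \<open>From \<open>x = x [^] (k * l)\<close> the product \<open>k * l\<close> is 1 modulo the
  order of \<open>x\<close>, so \<open>k\<close> is coprime to that order.\<close>

lemma trace_same_cyclic:
  fixes \<rho> :: "'a \<Rightarrow> rat fmat"
  assumes \<rho>: "mat_rep H \<rho>" and x: "x \<in> carrier H" and y: "y = x [^] (k::nat)" "x = y [^] (l::nat)"
  shows "trace_fmat (\<rho> y) = trace_fmat (\<rho> x)"
proof -
  let ?m = "ord x"
  have "?m > 0" using ord_ge_1[OF finite_carrier x] by simp
  \<comment> \<open>The congruence \<open>k * l \<equiv> 1\<close> modulo \<open>?m\<close> is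
    stated as \<open>?m dvd k * l + (?m - 1)\<close>, which avoids truncated subtraction when
    \<open>k * l = 0\<close>.\<close>
  have "x [^] (k * l + (?m - 1)) = x \<otimes> x [^] (?m - 1)"
  proof -
    have "x [^] (k * l) = (x [^] k) [^] l" using x by (simp add: nat_pow_pow)
    also have "\<dots> = x" by (simp only: y(1)[symmetric] y(2)[symmetric])
    finally show ?thesis using nat_pow_mult[OF x, of "k * l" "?m - 1"] by simp
  qed
  also have "\<dots> = x [^] Suc (?m - 1)" using nat_pow_Suc2[OF x] by simp
  also have "\<dots> = \<one>" using x \<open>?m > 0\<close> pow_ord_eq_1[OF x] by simp
  finally have "?m dvd k * l + (?m - 1)" using x by (simp add: pow_eq_id)
  have "coprime k ?m"
  proof (rule coprimeI)
    fix d assume d: "d dvd k" "d dvd ?m"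
    then have "d dvd k * l + (?m - 1)" using \<open>?m dvd _\<close> dvd_trans by blast
    then have "d dvd ?m - 1" using d(1) by (simp add: dvd_add_right_iff)
    then have "d dvd ?m - (?m - 1)" using d(2) dvd_diff_nat by blast
    then show "is_unit d" using \<open>?m > 0\<close> by simp
  qed
  from trace_coprime_power[OF \<rho> x this] show ?thesis by (simp only: y(1))
qed

end

section \<open>Modules over a group ring\<close>

text \<open>Reduces additive statements on the group ring to multiples of single group elements. The
  support is tracked because the group laws hold on the carrier only.\<close>

lemma additive_support_induct [consumes 1, case_names zero add single]:
  fixes a :: "'b \<Rightarrow>\<^sub>0 'k::field"
  assumes "Poly_Mapping.keys a \<subseteq> S" "P 0"
    "\<And>a b. \<lbrakk>Poly_Mapping.keys a \<subseteq> S; Poly_Mapping.keys b \<subseteq> S; P a; P b\<rbrakk> \<Longrightarrow> P (a + b)"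
    "\<And>x c. x \<in> S \<Longrightarrow> P (Poly_Mapping.single x c)"
  shows "P a"
proof -
  have "a = (\<Sum>x\<in>Poly_Mapping.keys a. Poly_Mapping.single x (Poly_Mapping.lookup a x))"
    by (rule poly_mapping_eqI) (simp add: lookup_sum lookup_single when_def in_keys_iff)
  moreover have "Poly_Mapping.keys (\<Sum>x\<in>F. Poly_Mapping.single x (Poly_Mapping.lookup a x)) \<subseteq> S
      \<and> P (\<Sum>x\<in>F. Poly_Mapping.single x (Poly_Mapping.lookup a x))" if "finite F" "F \<subseteq> S" for F
    using that
  proof (induction F)
    case (insert x F)
    let ?s = "Poly_Mapping.single x (Poly_Mapping.lookup a x)"
    let ?r = "\<Sum>x\<in>F. Poly_Mapping.single x (Poly_Mapping.lookup a x)"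
    have "Poly_Mapping.keys ?s \<subseteq> S" "Poly_Mapping.keys ?r \<subseteq> S" "P ?s" "P ?r"
      using insert assms(4) by auto
    then have "P (?s + ?r)" "Poly_Mapping.keys (?s + ?r) \<subseteq> S"
      using assms(3) keys_add[of ?s ?r] by blast+
    then show ?case by (simp only: sum.insert[OF insert.hyps])
  qed (use assms(2) in simp)
  ultimately show ?thesis using assms(1) finite_keys by metis
qed

section \<open>The group ring, its functoriality and restriction of scalars\<close>

lemma group_ring_simps [simp]:
  "a \<in> carrier (group_ring H) \<longleftrightarrow> Poly_Mapping.keys a \<subseteq> carrier H"
  "\<zero>\<^bsub>group_ring H\<^esub> = 0" "\<one>\<^bsub>group_ring H\<^esub> = Poly_Mapping.single \<one>\<^bsub>H\<^esub> 1"
  "a \<oplus>\<^bsub>group_ring H\<^esub> b = a + b"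
  by (simp_all add: group_ring_def)

lemma group_ring_mult_def:
  "a \<otimes>\<^bsub>group_ring H\<^esub> b =
     (\<Sum>x\<in>Poly_Mapping.keys a. \<Sum>y\<in>Poly_Mapping.keys b.
       Poly_Mapping.single (x \<otimes>\<^bsub>H\<^esub> y) (Poly_Mapping.lookup a x * Poly_Mapping.lookup b y))"
  by (simp add: group_ring_def)

lemma group_ring_mult_add_left:
  "(a + b) \<otimes>\<^bsub>group_ring H\<^esub> c = a \<otimes>\<^bsub>group_ring H\<^esub> c + b \<otimes>\<^bsub>group_ring H\<^esub> c"
  unfolding group_ring_mult_def
  by (rule setsum_keys_plus_distrib) (simp_all add: distrib_right single_add sum.distrib)

lemma group_ring_mult_add_right:
  "c \<otimes>\<^bsub>group_ring H\<^esub> (a + b) = c \<otimes>\<^bsub>group_ring H\<^esub> a + c \<otimes>\<^bsub>group_ring H\<^esub> b"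
  unfolding group_ring_mult_def sum.distrib[symmetric]
  by (rule sum.cong[OF refl], rule setsum_keys_plus_distrib) (simp_all add: distrib_left single_add)

lemma group_ring_mult_single [simp]:
  "Poly_Mapping.single x c \<otimes>\<^bsub>group_ring H\<^esub> Poly_Mapping.single y d = Poly_Mapping.single (x \<otimes>\<^bsub>H\<^esub> y) (c * d)"
  by (simp add: group_ring_mult_def)

lemma group_ring_mult_zero [simp]: "0 \<otimes>\<^bsub>group_ring H\<^esub> a = 0" "a \<otimes>\<^bsub>group_ring H\<^esub> 0 = 0"
  by (simp_all add: group_ring_mult_def)

lemma group_ring_map_add: "group_ring_map \<phi> (a + b) = group_ring_map \<phi> a + group_ring_map \<phi> b"
  unfolding group_ring_map_def by (rule setsum_keys_plus_distrib) (simp_all add: single_add)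

lemma group_ring_map_single [simp]: "group_ring_map \<phi> (Poly_Mapping.single x c) = Poly_Mapping.single (\<phi> x) c"
  by (simp add: group_ring_map_def)

lemma group_ring_map_zero [simp]: "group_ring_map \<phi> 0 = 0"
  by (simp add: group_ring_map_def)

lemma keys_group_ring_map: "Poly_Mapping.keys (group_ring_map \<phi> a) \<subseteq> \<phi> ` Poly_Mapping.keys a"
  unfolding group_ring_map_def by (rule order_trans[OF keys_sum]) auto

lemma restrict_scalars_simps [simp]:
  "carrier (restrict_scalars \<phi> M) = carrier M" "\<zero>\<^bsub>restrict_scalars \<phi> M\<^esub> = \<zero>\<^bsub>M\<^esub>"
  "x \<oplus>\<^bsub>restrict_scalars \<phi> M\<^esub> y = x \<oplus>\<^bsub>M\<^esub> y" "a \<odot>\<^bsub>restrict_scalars \<phi> M\<^esub> x = \<phi> a \<odot>\<^bsub>M\<^esub> x"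
  by (simp_all add: restrict_scalars_def)

lemma abelian_group_restrict_scalars:
  assumes "abelian_group M"
  shows "abelian_group (restrict_scalars \<phi> M)"
proof (rule abelian_groupI)
  interpret abelian_group M by (rule assms)
  show "x \<oplus>\<^bsub>restrict_scalars \<phi> M\<^esub> y \<oplus>\<^bsub>restrict_scalars \<phi> M\<^esub> z
      = x \<oplus>\<^bsub>restrict_scalars \<phi> M\<^esub> (y \<oplus>\<^bsub>restrict_scalars \<phi> M\<^esub> z)"
    if "x \<in> carrier (restrict_scalars \<phi> M)" "y \<in> carrier (restrict_scalars \<phi> M)" "z \<in> carrier (restrict_scalars \<phi> M)"
    for x y z using that by (simp add: a_assoc)
  show "x \<oplus>\<^bsub>restrict_scalars \<phi> M\<^esub> y = y \<oplus>\<^bsub>restrict_scalars \<phi> M\<^esub> x"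
    if "x \<in> carrier (restrict_scalars \<phi> M)" "y \<in> carrier (restrict_scalars \<phi> M)" for x y
    using that by (simp add: a_comm)
  show "\<exists>y\<in>carrier (restrict_scalars \<phi> M). y \<oplus>\<^bsub>restrict_scalars \<phi> M\<^esub> x = \<zero>\<^bsub>restrict_scalars \<phi> M\<^esub>"
    if "x \<in> carrier (restrict_scalars \<phi> M)" for x
    using that l_neg[of x] a_inv_closed[of x] by auto
  show "\<zero>\<^bsub>restrict_scalars \<phi> M\<^esub> \<oplus>\<^bsub>restrict_scalars \<phi> M\<^esub> x = x" if "x \<in> carrier (restrict_scalars \<phi> M)" for x
    using that by simp
qed (use assms in \<open>simp_all add: abelian_groupE\<close>)

text \<open>Indexing by natural numbers makes coordinate vectors functions
  \<open>nat \<Rightarrow> 'k\<close>, on which the matrices act.\<close>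

primrec lincomb ::
    "('a, 'c) monoid_scheme \<Rightarrow> ('a \<Rightarrow>\<^sub>0 'k::field, 'm) module \<Rightarrow> (nat \<Rightarrow> 'm) \<Rightarrow> (nat \<Rightarrow> 'k) \<Rightarrow> nat \<Rightarrow> 'm"
  where
  "lincomb H M b c 0 = \<zero>\<^bsub>M\<^esub>"
| "lincomb H M b c (Suc n) = lincomb H M b c n \<oplus>\<^bsub>M\<^esub> Poly_Mapping.single \<one>\<^bsub>H\<^esub> (c n) \<odot>\<^bsub>M\<^esub> b n"

lemma lincomb_cong:
  "(\<And>i. i < n \<Longrightarrow> c i = d i) \<Longrightarrow> (\<And>i. i < n \<Longrightarrow> b i = b' i) \<Longrightarrow> lincomb H M b c n = lincomb H M b' d n"
  by (induction n) auto

context finite_group begin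

lemmas group_one_closed = one_closed

lemma group_ring_mult_closed:
  assumes "Poly_Mapping.keys a \<subseteq> carrier H" "Poly_Mapping.keys b \<subseteq> carrier H"
  shows "Poly_Mapping.keys (a \<otimes>\<^bsub>group_ring H\<^esub> b) \<subseteq> carrier H"
proof -
  have "Poly_Mapping.keys (\<Sum>y\<in>Poly_Mapping.keys b.
       Poly_Mapping.single (x \<otimes> y) (Poly_Mapping.lookup a x * Poly_Mapping.lookup b y)) \<subseteq> carrier H"
    if "x \<in> Poly_Mapping.keys a" for x
    by (rule order_trans[OF keys_sum]) (use assms that in auto)
  then show ?thesis
    unfolding group_ring_mult_def by (intro order_trans[OF keys_sum]) auto
qed

lemma keys_plus_subset:
  "Poly_Mapping.keys a \<subseteq> S \<Longrightarrow> Poly_Mapping.keys b \<subseteq> S \<Longrightarrow> Poly_Mapping.keys (a + b) \<subseteq> S"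
  using keys_add[of a b] by auto

text \<open>Both sides are additive in each argument, which leaves three group elements.\<close>

lemma group_ring_mult_assoc:
  assumes "Poly_Mapping.keys a \<subseteq> carrier H" "Poly_Mapping.keys b \<subseteq> carrier H" "Poly_Mapping.keys c \<subseteq> carrier H"
  shows "(a \<otimes>\<^bsub>group_ring H\<^esub> b) \<otimes>\<^bsub>group_ring H\<^esub> c = a \<otimes>\<^bsub>group_ring H\<^esub> (b \<otimes>\<^bsub>group_ring H\<^esub> c)"
  using assms(1)
proof (induction rule: additive_support_induct)
  case (single x r)
  note x = single
  show ?case
    using assms(2)
  proof (induction rule: additive_support_induct)
    case (single y s)
    note y = single
    show ?case
      using assms(3)
    proof (induction rule: additive_support_induct)
      case (single z t)
      then show ?case using x y by (simp add: m_assoc mult.assoc)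
    qed (simp_all add: group_ring_mult_add_right)
  qed (simp_all add: group_ring_mult_add_right group_ring_mult_add_left)
qed (simp_all add: group_ring_mult_add_left)

lemma group_ring_one:
  assumes "Poly_Mapping.keys a \<subseteq> carrier H"
  shows "Poly_Mapping.single \<one> 1 \<otimes>\<^bsub>group_ring H\<^esub> a = a" "a \<otimes>\<^bsub>group_ring H\<^esub> Poly_Mapping.single \<one> 1 = a"
  using assms
  by (induction rule: additive_support_induct; simp add: group_ring_mult_add_right group_ring_mult_add_left)+

lemma ring_group_ring: "ring (group_ring H)"
proof (rule ringI)
  show "abelian_group (group_ring H)"
  proof (rule abelian_groupI)
    fix x assume "x \<in> carrier (group_ring H)"
    then show "\<exists>y\<in>carrier (group_ring H). y \<oplus>\<^bsub>group_ring H\<^esub> x = \<zero>\<^bsub>group_ring H\<^esub>"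
      by (intro bexI[of _ "- x"]) auto
  qed (auto simp: keys_plus_subset algebra_simps)
  show "monoid (group_ring H)"
    by (rule monoidI) (auto simp: group_ring_mult_closed group_ring_mult_assoc group_ring_one)
qed (auto simp: group_ring_mult_add_right group_ring_mult_add_left)

lemma group_ring_map_mult:
  assumes K: "finite_group K" and \<phi>: "\<phi> \<in> hom H K"
    and a: "Poly_Mapping.keys a \<subseteq> carrier H" "Poly_Mapping.keys b \<subseteq> carrier H"
  shows "group_ring_map \<phi> (a \<otimes>\<^bsub>group_ring H\<^esub> b) = group_ring_map \<phi> a \<otimes>\<^bsub>group_ring K\<^esub> group_ring_map \<phi> b"
  using a(1)
proof (induction rule: additive_support_induct)
  case (single x r)
  note x = single
  show ?case
    using a(2)
  proof (induction rule: additive_support_induct)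
    case (single y s)
    then show ?case using x \<phi> by (simp add: hom_mult)
  qed (simp_all add: group_ring_mult_add_right group_ring_map_add)
qed (simp_all add: group_ring_mult_add_left group_ring_map_add)

lemma group_ring_map_closed:
  "\<phi> \<in> hom H K \<Longrightarrow> Poly_Mapping.keys a \<subseteq> carrier H \<Longrightarrow> Poly_Mapping.keys (group_ring_map \<phi> a) \<subseteq> carrier K"
  using keys_group_ring_map[of \<phi> a] hom_in_carrier[of \<phi> H K] by blast

lemma left_module_restrict_scalars:
  assumes K: "finite_group K" and \<phi>: "\<phi> \<in> hom H K" and M: "left_module (group_ring K) M"
  shows "left_module (group_ring H) (restrict_scalars (group_ring_map \<phi>) M)"
proof -
  interpret M: left_module "group_ring K" M by (rule M)
  have "abelian_group M" by unfold_locales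
  moreover have "\<phi> \<one> = \<one>\<^bsub>K\<^esub>" using \<phi> K group_axioms hom_one unfolding finite_group_def by blast
  ultimately show ?thesis
    using ring_group_ring M.smult_one
    by (intro left_module.intro left_module_axioms.intro)
      (simp_all add: abelian_group_restrict_scalars group_ring_map_add group_ring_map_mult[OF K \<phi>]
        M.smult_closed[simplified] M.smult_r_distr[simplified] M.smult_l_distr[simplified]
        M.smult_assoc[simplified] group_ring_map_closed[OF \<phi>])
qed

end

section \<open>Linear algebra inside a module over the group ring\<close>

locale group_ring_module = grp?: finite_group H + left_module "group_ring H" M
  for H :: "('a, 'c) monoid_scheme" (structure) and M :: "('a \<Rightarrow>\<^sub>0 'k::field, 'm) module"
begin

abbreviation scal :: "'k \<Rightarrow> 'm \<Rightarrow> 'm" where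
  "scal c x \<equiv> Poly_Mapping.single \<one> c \<odot>\<^bsub>M\<^esub> x"

lemma smult_plus:
  "\<lbrakk>Poly_Mapping.keys a \<subseteq> carrier H; Poly_Mapping.keys b \<subseteq> carrier H; x \<in> carrier M\<rbrakk> \<Longrightarrow>
   (a + b) \<odot>\<^bsub>M\<^esub> x = a \<odot>\<^bsub>M\<^esub> x \<oplus>\<^bsub>M\<^esub> b \<odot>\<^bsub>M\<^esub> x"
  using smult_l_distr[of a b x] by simp

lemma single_closed [simp]: "h \<in> carrier H \<Longrightarrow> x \<in> carrier M \<Longrightarrow> Poly_Mapping.single h c \<odot>\<^bsub>M\<^esub> x \<in> carrier M"
  by (rule smult_closed) auto

lemma single_smult_assoc:
  "\<lbrakk>g \<in> carrier H; h \<in> carrier H; x \<in> carrier M\<rbrakk> \<Longrightarrow>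
   Poly_Mapping.single g c \<odot>\<^bsub>M\<^esub> (Poly_Mapping.single h d \<odot>\<^bsub>M\<^esub> x) = Poly_Mapping.single (g \<otimes> h) (c * d) \<odot>\<^bsub>M\<^esub> x"
  by (subst smult_assoc[symmetric]) auto

lemma single_one [simp]: "x \<in> carrier M \<Longrightarrow> Poly_Mapping.single \<one> 1 \<odot>\<^bsub>M\<^esub> x = x"
  using smult_one by simp

lemma zero_smult [simp]: "x \<in> carrier M \<Longrightarrow> 0 \<odot>\<^bsub>M\<^esub> x = \<zero>\<^bsub>M\<^esub>"
  using smult_plus[of 0 0 x] smult_closed[of 0 x] M.add.l_cancel_one[of "0 \<odot>\<^bsub>M\<^esub> x" "0 \<odot>\<^bsub>M\<^esub> x"] by simp

lemma smult_zero [simp]: "Poly_Mapping.keys a \<subseteq> carrier H \<Longrightarrow> a \<odot>\<^bsub>M\<^esub> \<zero>\<^bsub>M\<^esub> = \<zero>\<^bsub>M\<^esub>"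
  using smult_r_distr[of a "\<zero>\<^bsub>M\<^esub>" "\<zero>\<^bsub>M\<^esub>"] smult_closed[of a "\<zero>\<^bsub>M\<^esub>"]
    M.add.l_cancel_one[of "a \<odot>\<^bsub>M\<^esub> \<zero>\<^bsub>M\<^esub>" "a \<odot>\<^bsub>M\<^esub> \<zero>\<^bsub>M\<^esub>"] by simp

lemma smult_add_right:
  "\<lbrakk>Poly_Mapping.keys a \<subseteq> carrier H; x \<in> carrier M; y \<in> carrier M\<rbrakk> \<Longrightarrow>
   a \<odot>\<^bsub>M\<^esub> (x \<oplus>\<^bsub>M\<^esub> y) = a \<odot>\<^bsub>M\<^esub> x \<oplus>\<^bsub>M\<^esub> a \<odot>\<^bsub>M\<^esub> y"
  using smult_r_distr[of a x y] by simp

lemma scal_plus: "x \<in> carrier M \<Longrightarrow> scal (c + d) x = scal c x \<oplus>\<^bsub>M\<^esub> scal d x"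
  by (simp add: single_add smult_plus)

lemma lincomb_closed [simp]: "(\<And>i. b i \<in> carrier M) \<Longrightarrow> lincomb H M b c n \<in> carrier M"
  by (induction n) auto

lemma lincomb_add:
  assumes "\<And>i. b i \<in> carrier M"
  shows "lincomb H M b (\<lambda>i. c i + d i) n = lincomb H M b c n \<oplus>\<^bsub>M\<^esub> lincomb H M b d n"
proof (induction n)
  case (Suc n)
  then show ?case using assms by (simp add: scal_plus M.add.m_ac)
qed simp

lemma lincomb_smult:
  assumes "\<And>i. b i \<in> carrier M" "h \<in> carrier H"
  shows "Poly_Mapping.single h r \<odot>\<^bsub>M\<^esub> lincomb H M b c n
    = lincomb H M (\<lambda>i. Poly_Mapping.single h 1 \<odot>\<^bsub>M\<^esub> b i) (\<lambda>i. r * c i) n"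
proof (induction n)
  case (Suc n)
  then show ?case using assms by (simp add: smult_add_right single_smult_assoc)
qed (use assms in simp)

lemma lincomb_scal:
  assumes "\<And>i. b i \<in> carrier M"
  shows "scal r (lincomb H M b c n) = lincomb H M b (\<lambda>i. r * c i) n"
  using lincomb_smult[of b \<one> r c n] assms by simp

lemma lincomb_zero: "(\<And>i. b i \<in> carrier M) \<Longrightarrow> lincomb H M b (\<lambda>_. 0) n = \<zero>\<^bsub>M\<^esub>"
  by (induction n) auto

text \<open>Generators are added one at a time and skipped if already in the span. Independence
  refers to scalars from the field, embedded as multiples of \<open>\<one>\<close>.\<close>

lemma independent_list:
  assumes "finite S" "S \<subseteq> carrier M"
  shows "\<exists>b n. (\<forall>i. b i \<in> carrier M) \<and> (\<forall>c. lincomb H M b c n = \<zero>\<^bsub>M\<^esub> \<longrightarrow> (\<forall>i<n. c i = 0)) \<and>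
    S \<subseteq> range (\<lambda>c. lincomb H M b c n)"
  using assms
proof (induction S)
  case empty
  show ?case by (intro exI[of _ "\<lambda>_. \<zero>\<^bsub>M\<^esub>"] exI[of _ 0]) auto
next
  case (insert s S)
  then have "S \<subseteq> carrier M" by simp
  from insert.IH[OF this] obtain b n where b': "\<forall>i. b i \<in> carrier M"
    and indep: "\<forall>c. lincomb H M b c n = \<zero>\<^bsub>M\<^esub> \<longrightarrow> (\<forall>i<n. c i = 0)"
    and span: "S \<subseteq> range (\<lambda>c. lincomb H M b c n)" by blast
  have b: "b i \<in> carrier M" for i using b' by blast
  have s: "s \<in> carrier M" using insert.prems by simp
  show ?case
  proof (cases "s \<in> range (\<lambda>c. lincomb H M b c n)")
    case True
    with b' indep span show ?thesis by blast
  next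
    case False
    let ?b = "b(n := s)"
    have comb: "lincomb H M ?b c n = lincomb H M b c n" for c by (rule lincomb_cong) auto
    have "c i = 0" if zero: "lincomb H M ?b c (Suc n) = \<zero>\<^bsub>M\<^esub>" and "i < Suc n" for c i
    proof -
      \<comment> \<open>A relation with nonzero coefficient at \<open>s\<close> could be divided by
        it and would put \<open>s\<close> into the span.\<close>
      have "c n = 0"
      proof (rule ccontr)
        assume c: "c n \<noteq> 0"
        define y where "y = lincomb H M b c n"
        have y: "y \<in> carrier M" using b by (simp add: y_def)
        have "scal (1 / c n) (y \<oplus>\<^bsub>M\<^esub> scal (c n) s) = \<zero>\<^bsub>M\<^esub>" using zero by (simp add: comb y_def)
        then have eq: "scal (1 / c n) y \<oplus>\<^bsub>M\<^esub> s = \<zero>\<^bsub>M\<^esub>"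
          using c s y by (simp add: smult_add_right single_smult_assoc)
        have "scal (- 1 / c n) y \<oplus>\<^bsub>M\<^esub> scal (1 / c n) y = \<zero>\<^bsub>M\<^esub>"
          using scal_plus[OF y, of "- 1 / c n" "1 / c n"] y by simp
        then have "scal (- 1 / c n) y = s"
          using eq s y M.add.inv_unique[of "scal (- 1 / c n) y" "scal (1 / c n) y" s] by simp
        then have "s = lincomb H M b (\<lambda>i. (- 1 / c n) * c i) n" using b by (simp add: y_def lincomb_scal)
        with False show False by blast
      qed
      then have "lincomb H M b c n = \<zero>\<^bsub>M\<^esub>" using zero b s by (simp add: comb)
      with indep \<open>c n = 0\<close> \<open>i < Suc n\<close> show ?thesis by (auto simp: less_Suc_eq)
    qed
    moreover have "?b i \<in> carrier M" for i using b s by simp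
    moreover have "insert s S \<subseteq> range (\<lambda>c. lincomb H M ?b c (Suc n))"
    proof
      fix x assume "x \<in> insert s S"
      then consider "x = s" | c where "x = lincomb H M b c n" using span by blast
      then show "x \<in> range (\<lambda>c. lincomb H M ?b c (Suc n))"
      proof cases
        case 1
        have "lincomb H M ?b (\<lambda>i. if i = n then 1 else 0) n = lincomb H M b (\<lambda>_. 0) n"
          by (rule lincomb_cong) auto
        then have "x = lincomb H M ?b (\<lambda>i. if i = n then 1 else 0) (Suc n)" using 1 b s by (simp add: lincomb_zero)
        then show ?thesis by blast
      next
        case 2
        have "lincomb H M ?b (c(n := 0)) n = lincomb H M b c n" by (rule lincomb_cong) auto
        then have "x = lincomb H M ?b (c(n := 0)) (Suc n)" using 2 b s by simp
        then show ?thesis by blast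
      qed
    qed
    ultimately show ?thesis by blast
  qed
qed

text \<open>Since the group is finite, the translates of finitely many generators form a finite
  spanning set over the field.\<close>

lemma finitely_generated_basis:
  assumes "M \<in> fg_modules (group_ring H)"
  shows "\<exists>b n. (\<forall>i. b i \<in> carrier M) \<and> (\<forall>c. lincomb H M b c n = \<zero>\<^bsub>M\<^esub> \<longrightarrow> (\<forall>i<n. c i = 0)) \<and>
    carrier M = range (\<lambda>c. lincomb H M b c n)"
proof -
  obtain S where S: "finite S" "S \<subseteq> carrier M"
    and gen: "\<And>x. x \<in> carrier M \<Longrightarrow> \<exists>c\<in>S \<rightarrow> carrier (group_ring H). x = (\<Oplus>\<^bsub>M\<^esub>s\<in>S. c s \<odot>\<^bsub>M\<^esub> s)"
    using assms unfolding fg_modules_def by blast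
  let ?S = "(\<lambda>(h, s). Poly_Mapping.single h 1 \<odot>\<^bsub>M\<^esub> s) ` (carrier H \<times> S)"
  have "finite ?S" "?S \<subseteq> carrier M" using S finite_carrier by auto
  then obtain b n where b: "\<forall>i. b i \<in> carrier M"
    and indep: "\<forall>c. lincomb H M b c n = \<zero>\<^bsub>M\<^esub> \<longrightarrow> (\<forall>i<n. c i = 0)"
    and span: "?S \<subseteq> range (\<lambda>c. lincomb H M b c n)" using independent_list[of ?S] by blast
  let ?V = "range (\<lambda>c. lincomb H M b c n)"
  have V0: "\<zero>\<^bsub>M\<^esub> \<in> ?V" using b by (intro image_eqI[of _ _ "\<lambda>_. 0"]) (simp_all add: lincomb_zero)
  have Vadd: "x \<oplus>\<^bsub>M\<^esub> y \<in> ?V" if xy: "x \<in> ?V" "y \<in> ?V" for x y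
  proof -
    obtain c d where "x = lincomb H M b c n" "y = lincomb H M b d n" using xy by blast
    then have "x \<oplus>\<^bsub>M\<^esub> y = lincomb H M b (\<lambda>i. c i + d i) n" using b by (simp add: lincomb_add)
    then show ?thesis by blast
  qed
  have Vsmult: "a \<odot>\<^bsub>M\<^esub> s \<in> ?V" if "Poly_Mapping.keys a \<subseteq> carrier H" "s \<in> S" for a s
    using that(1)
  proof (induction rule: additive_support_induct)
    case zero
    then show ?case using V0 that S by auto
  next
    case (add a a')
    then show ?case using Vadd that S by (subst smult_plus) auto
  next
    case (single x r)
    have "Poly_Mapping.single x 1 \<odot>\<^bsub>M\<^esub> s \<in> ?V" using span single that by blast
    then obtain c where c: "Poly_Mapping.single x 1 \<odot>\<^bsub>M\<^esub> s = lincomb H M b c n" by blast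
    have "Poly_Mapping.single x r \<odot>\<^bsub>M\<^esub> s = scal r (Poly_Mapping.single x 1 \<odot>\<^bsub>M\<^esub> s)"
      using single that S by (subst single_smult_assoc) auto
    then show ?case using c b by (auto simp: lincomb_scal)
  qed
  have sums: "(\<Oplus>\<^bsub>M\<^esub>s\<in>T. c s \<odot>\<^bsub>M\<^esub> s) \<in> ?V" if "finite T" "T \<subseteq> S" "c \<in> S \<rightarrow> carrier (group_ring H)" for T c
    using that
  proof (induction T)
    case (insert t T)
    have cl: "(\<lambda>s. c s \<odot>\<^bsub>M\<^esub> s) \<in> T \<rightarrow> carrier M" "c t \<odot>\<^bsub>M\<^esub> t \<in> carrier M"
      using insert.prems S by (auto intro!: smult_closed)
    have "c t \<in> carrier (group_ring H)" using insert.prems by (blast dest: Pi_mem)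
    then have "c t \<odot>\<^bsub>M\<^esub> t \<in> ?V" using insert.prems by (intro Vsmult) auto
    with insert Vadd show ?case by (simp add: M.finsum_insert[OF insert.hyps cl])
  qed (use V0 in simp)
  have "carrier M \<subseteq> ?V"
  proof
    fix x assume "x \<in> carrier M"
    from gen[OF this] obtain c where "c \<in> S \<rightarrow> carrier (group_ring H)" "x = (\<Oplus>\<^bsub>M\<^esub>s\<in>S. c s \<odot>\<^bsub>M\<^esub> s)" ..
    with sums[OF S(1) subset_refl] show "x \<in> ?V" by simp
  qed
  then have "carrier M = ?V" using b by auto
  with b indep show ?thesis by blast
qed

text \<open>Finite generation is defined by sums over a set of generators, while \<open>b\<close>
  may repeat vectors; coefficients at equal vectors have to be collected.\<close>

lemma spanned_finitely_generated:
  assumes b: "\<And>i. b i \<in> carrier M" and span: "carrier M \<subseteq> range (\<lambda>c. lincomb H M b c n)"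
  shows "M \<in> fg_modules (group_ring H)"
proof -
  let ?S = "b ` {..<n}"
  have S: "finite ?S" "?S \<subseteq> carrier M" using b by auto
  have "\<exists>c\<in>?S \<rightarrow> carrier (group_ring H). lincomb H M b d m = (\<Oplus>\<^bsub>M\<^esub>s\<in>?S. c s \<odot>\<^bsub>M\<^esub> s)" if "m \<le> n" for d m
    using that
  proof (induction m)
    case 0
    have "(\<Oplus>\<^bsub>M\<^esub>s\<in>?S. 0 \<odot>\<^bsub>M\<^esub> s) = (\<Oplus>\<^bsub>M\<^esub>s\<in>?S. \<zero>\<^bsub>M\<^esub>)" using S by (intro M.finsum_cong) (auto simp: simp_implies_def)
    then show ?case by (intro bexI[of _ "\<lambda>_. 0"]) (auto simp: M.finsum_zero)
  next
    case (Suc m)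
    then obtain c where c: "c \<in> ?S \<rightarrow> carrier (group_ring H)" "lincomb H M b d m = (\<Oplus>\<^bsub>M\<^esub>s\<in>?S. c s \<odot>\<^bsub>M\<^esub> s)" by auto
    \<comment> \<open>\<open>b m\<close> may coincide with an earlier vector, so its coefficient is
      increased and not overwritten.\<close>
    define c' where "c' = c(b m := c (b m) + Poly_Mapping.single \<one> (d m))"
    have c': "c' \<in> ?S \<rightarrow> carrier (group_ring H)" 
    proof -
      have "Poly_Mapping.keys (c (b m)) \<subseteq> carrier H" using c(1) Suc.prems by (auto simp: Pi_iff)
      then have "Poly_Mapping.keys (c (b m) + Poly_Mapping.single \<one> (d m)) \<subseteq> carrier H"
        by (rule keys_plus_subset) simp
      then show ?thesis using c(1) by (simp add: c'_def Pi_iff)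
    qed
    have bm: "b m \<in> ?S" using Suc.prems by auto
    have split: "(\<Oplus>\<^bsub>M\<^esub>s\<in>?S. e s \<odot>\<^bsub>M\<^esub> s) = e (b m) \<odot>\<^bsub>M\<^esub> b m \<oplus>\<^bsub>M\<^esub> (\<Oplus>\<^bsub>M\<^esub>s\<in>?S - {b m}. e s \<odot>\<^bsub>M\<^esub> s)"
      and cl: "(\<Oplus>\<^bsub>M\<^esub>s\<in>?S - {b m}. e s \<odot>\<^bsub>M\<^esub> s) \<in> carrier M" "e (b m) \<odot>\<^bsub>M\<^esub> b m \<in> carrier M"
      if "e \<in> ?S \<rightarrow> carrier (group_ring H)" for e
    proof -
      have 1: "(\<lambda>s. e s \<odot>\<^bsub>M\<^esub> s) \<in> ?S - {b m} \<rightarrow> carrier M" using that S by (auto intro!: smult_closed)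
      show 2: "e (b m) \<odot>\<^bsub>M\<^esub> b m \<in> carrier M" using Pi_mem[OF that bm] b by (rule smult_closed)
      show "(\<Oplus>\<^bsub>M\<^esub>s\<in>?S - {b m}. e s \<odot>\<^bsub>M\<^esub> s) \<in> carrier M" using 1 by (rule M.finsum_closed)
      have "(\<Oplus>\<^bsub>M\<^esub>s\<in>insert (b m) (?S - {b m}). e s \<odot>\<^bsub>M\<^esub> s)
          = e (b m) \<odot>\<^bsub>M\<^esub> b m \<oplus>\<^bsub>M\<^esub> (\<Oplus>\<^bsub>M\<^esub>s\<in>?S - {b m}. e s \<odot>\<^bsub>M\<^esub> s)"
        using S 1 2 by (intro M.finsum_insert) auto
      then show "(\<Oplus>\<^bsub>M\<^esub>s\<in>?S. e s \<odot>\<^bsub>M\<^esub> s) = e (b m) \<odot>\<^bsub>M\<^esub> b m \<oplus>\<^bsub>M\<^esub> (\<Oplus>\<^bsub>M\<^esub>s\<in>?S - {b m}. e s \<odot>\<^bsub>M\<^esub> s)"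
        using bm by (simp add: insert_absorb)
    qed
    have eq: "(\<Oplus>\<^bsub>M\<^esub>s\<in>?S - {b m}. c' s \<odot>\<^bsub>M\<^esub> s) = (\<Oplus>\<^bsub>M\<^esub>s\<in>?S - {b m}. c s \<odot>\<^bsub>M\<^esub> s)"
      using S c(1) by (intro M.finsum_cong) (auto simp: c'_def simp_implies_def intro!: smult_closed)
    have "c' (b m) \<odot>\<^bsub>M\<^esub> b m = c (b m) \<odot>\<^bsub>M\<^esub> b m \<oplus>\<^bsub>M\<^esub> scal (d m) (b m)"
      unfolding c'_def fun_upd_same using Pi_mem[OF c(1) bm] b by (subst smult_plus) auto
    then have "(\<Oplus>\<^bsub>M\<^esub>s\<in>?S. c' s \<odot>\<^bsub>M\<^esub> s) = lincomb H M b d (Suc m)"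
      using b cl[OF c(1)] by (simp add: split[OF c'] split[OF c(1)] c(2) eq M.add.m_ac)
    from this[symmetric] c' show ?case ..
  qed
  note sums = this[OF order_refl]
  have "\<forall>x\<in>carrier M. \<exists>c\<in>?S \<rightarrow> carrier (group_ring H). x = (\<Oplus>\<^bsub>M\<^esub>s\<in>?S. c s \<odot>\<^bsub>M\<^esub> s)"
  proof
    fix x assume "x \<in> carrier M"
    then obtain d where "x = lincomb H M b d n" using span by blast
    with sums[of d] show "\<exists>c\<in>?S \<rightarrow> carrier (group_ring H). x = (\<Oplus>\<^bsub>M\<^esub>s\<in>?S. c s \<odot>\<^bsub>M\<^esub> s)"
      by simp
  qed
  then have "finite ?S \<and> ?S \<subseteq> carrier M \<and> (\<forall>x\<in>carrier M. \<exists>c\<in>?S \<rightarrow> carrier (group_ring H). x = (\<Oplus>\<^bsub>M\<^esub>s\<in>?S. c s \<odot>\<^bsub>M\<^esub> s))"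
    using S by simp
  then show ?thesis unfolding fg_modules_def using left_module_axioms
    by - (rule CollectI, rule conjI, assumption, rule exI, assumption)
qed

end

section \<open>Modules and matrix representations\<close>

text \<open>For a representation, the fixed vectors of \<open>\<rho> \<one>\<close> are the image of
  this idempotent. They have finite support, so every finite dimension occurs inside the one type
  \<open>nat \<Rightarrow> 'k\<close>.\<close>

definition rep_module :: "('a, 'c) monoid_scheme \<Rightarrow> ('a \<Rightarrow> 'k::field fmat) \<Rightarrow> ('a, 'k) gmodule" where
  "rep_module H \<rho> = \<lparr>carrier = {v. apply_fmat (\<rho> \<one>\<^bsub>H\<^esub>) v = v}, monoid.mult = undefined, monoid.one = undefined,
     ring.zero = (\<lambda>_. 0), ring.add = (\<lambda>v w i. v i + w i),
     module.smult = (\<lambda>a v i. \<Sum>x\<in>Poly_Mapping.keys a. Poly_Mapping.lookup a x * apply_fmat (\<rho> x) v i)\<rparr>"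

lemma rep_module_simps [simp]:
  "v \<in> carrier (rep_module H \<rho>) \<longleftrightarrow> apply_fmat (\<rho> \<one>\<^bsub>H\<^esub>) v = v"
  "\<zero>\<^bsub>rep_module H \<rho>\<^esub> = (\<lambda>_. 0)"
  "v \<oplus>\<^bsub>rep_module H \<rho>\<^esub> w = (\<lambda>i. v i + w i)"
  by (simp_all add: rep_module_def)

lemma rep_module_smult:
  "a \<odot>\<^bsub>rep_module H \<rho>\<^esub> v = (\<lambda>i. \<Sum>x\<in>Poly_Mapping.keys a. Poly_Mapping.lookup a x * apply_fmat (\<rho> x) v i)"
  by (simp add: rep_module_def)

lemma rep_module_smult_single [simp]:
  "Poly_Mapping.single x c \<odot>\<^bsub>rep_module H \<rho>\<^esub> v = (\<lambda>i. c * apply_fmat (\<rho> x) v i)"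
  by (auto simp: rep_module_smult)

lemma rep_module_smult_zero [simp]: "0 \<odot>\<^bsub>rep_module H \<rho>\<^esub> v = (\<lambda>_. 0)"
  by (simp add: rep_module_smult)

lemma rep_module_smult_plus:
  "(a + b) \<odot>\<^bsub>rep_module H \<rho>\<^esub> v = (\<lambda>i. (a \<odot>\<^bsub>rep_module H \<rho>\<^esub> v) i + (b \<odot>\<^bsub>rep_module H \<rho>\<^esub> v) i)"
  unfolding rep_module_smult by (rule ext, rule setsum_keys_plus_distrib) (simp_all add: distrib_right)

lemma column_apply_sum:
  assumes "fmat_bound A n"
  shows "apply_fmat A v = (\<lambda>i. \<Sum>j<n. v j * entry A i j)"
  by (rule ext) (simp add: apply_fmat_bound[OF assms] mult.commute)

lemma apply_fmat_finite_support: "\<exists>m. \<forall>i\<ge>m. apply_fmat A v i = 0"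
proof -
  obtain n where n: "fmat_bound A n" using fmat_bound_exists by blast
  have "apply_fmat A v i = 0" if "n \<le> i" for i
    using n that by (simp add: apply_fmat_bound[OF n] fmat_bound_def)
  then show ?thesis by blast
qed

text \<open>The matrices depend on a choice of coordinates; their traces do not, by
  \<open>module_char_eq\<close>.\<close>

definition affords ::
    "('a, 'c) monoid_scheme \<Rightarrow> ('a \<Rightarrow>\<^sub>0 'k::field, 'm) module \<Rightarrow> ('a \<Rightarrow> 'k fmat) \<Rightarrow> bool" where
  "affords H M \<rho> \<longleftrightarrow> mat_rep H \<rho> \<and>
     (\<exists>\<psi>\<in>linear_maps (group_ring H) M (rep_module H \<rho>). bij_betw \<psi> (carrier M) (carrier (rep_module H \<rho>)))"

lemma fg_left_module: "M \<in> fg_modules R \<Longrightarrow> left_module R M"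
  by (simp add: fg_modules_def)

lemma linear_maps_compose:
  "f \<in> linear_maps R M N \<Longrightarrow> g \<in> linear_maps R N P \<Longrightarrow> (\<lambda>x. g (f x)) \<in> linear_maps R M P"
  by (simp add: linear_maps_def Pi_iff)

lemma linear_maps_inverse:
  assumes f: "f \<in> linear_maps R M N" "bij_betw f (carrier M) (carrier N)" and M: "left_module R M"
  shows "inv_into (carrier M) f \<in> linear_maps R N M"
proof -
  interpret M: left_module R M by (rule M)
  let ?g = "inv_into (carrier M) f"
  have g: "?g y \<in> carrier M" "f (?g y) = y" if "y \<in> carrier N" for y
    using that f(2) by (auto simp: bij_betw_def inv_into_into f_inv_into_f)
  have gf: "?g (f x) = x" if "x \<in> carrier M" for x
    using that f(2) by (simp add: bij_betw_inv_into_left)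
  show ?thesis
    unfolding linear_maps_def
  proof (intro CollectI conjI ballI)
    show "?g \<in> carrier N \<rightarrow> carrier M" using g by blast
  next
    fix x y assume xy: "x \<in> carrier N" "y \<in> carrier N"
    then have "f (?g x \<oplus>\<^bsub>M\<^esub> ?g y) = x \<oplus>\<^bsub>N\<^esub> y" using f(1) g by (simp add: linear_maps_def)
    then show "?g (x \<oplus>\<^bsub>N\<^esub> y) = ?g x \<oplus>\<^bsub>M\<^esub> ?g y" using gf[of "?g x \<oplus>\<^bsub>M\<^esub> ?g y"] g xy by simp
  next
    fix a x assume ax: "a \<in> carrier R" "x \<in> carrier N"
    then have "f (a \<odot>\<^bsub>M\<^esub> ?g x) = a \<odot>\<^bsub>N\<^esub> x" using f(1) g by (simp add: linear_maps_def)
    then show "?g (a \<odot>\<^bsub>N\<^esub> x) = a \<odot>\<^bsub>M\<^esub> ?g x" using gf[of "a \<odot>\<^bsub>M\<^esub> ?g x"] g ax M.smult_closed by simp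
  qed
qed

lemma linear_maps_zero:
  assumes f: "f \<in> linear_maps R M N" and M: "left_module R M" and N: "left_module R N"
  shows "f \<zero>\<^bsub>M\<^esub> = \<zero>\<^bsub>N\<^esub>"
proof -
  interpret M: left_module R M by (rule M)
  interpret N: left_module R N by (rule N)
  have "f \<zero>\<^bsub>M\<^esub> \<in> carrier N" using f by (auto simp: linear_maps_def)
  moreover have "f (\<zero>\<^bsub>M\<^esub> \<oplus>\<^bsub>M\<^esub> \<zero>\<^bsub>M\<^esub>) = f \<zero>\<^bsub>M\<^esub> \<oplus>\<^bsub>N\<^esub> f \<zero>\<^bsub>M\<^esub>"
    using f unfolding linear_maps_def by blast
  ultimately show ?thesis using N.M.add.l_cancel_one[of "f \<zero>\<^bsub>M\<^esub>" "f \<zero>\<^bsub>M\<^esub>"] by simp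
qed

text \<open>Conjugating both maps with the isomorphisms moves an exact sequence of arbitrary modules
  to modules of matrix form, where it can be split.\<close>

lemma short_exact_transport:
  assumes ex: "short_exact R M' M M''"
    and M: "left_module R M'" "left_module R M" "left_module R M''" "left_module R N''"
    and a: "a \<in> linear_maps R M' N'" "bij_betw a (carrier M') (carrier N')"
    and b: "b \<in> linear_maps R M N" "bij_betw b (carrier M) (carrier N)"
    and c: "c \<in> linear_maps R M'' N''" "bij_betw c (carrier M'') (carrier N'')"
  shows "short_exact R N' N N''"
proof -
  obtain f g where f: "f \<in> linear_maps R M' M" "inj_on f (carrier M')"
    and g: "g \<in> linear_maps R M M''" "g ` carrier M = carrier M''"
    and fg: "f ` carrier M' = {x \<in> carrier M. g x = \<zero>\<^bsub>M''\<^esub>}"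
    using ex unfolding short_exact_def by blast
  let ?a = "inv_into (carrier M') a" and ?b = "inv_into (carrier M) b"
  have a': "?a \<in> linear_maps R N' M'" using linear_maps_inverse a M by blast
  have b': "?b \<in> linear_maps R N M" using linear_maps_inverse b M by blast
  have ab: "bij_betw ?a (carrier N') (carrier M')" "bij_betw ?b (carrier N) (carrier M)"
    using a b bij_betw_inv_into by blast+
  have f_in: "f x \<in> carrier M" if "x \<in> carrier M'" for x using f that by (auto simp: linear_maps_def)
  have g_in: "g x \<in> carrier M''" if "x \<in> carrier M" for x using g that by (auto simp: linear_maps_def)
  have b_in: "b x \<in> carrier N" "?b (b x) = x" if "x \<in> carrier M" for x
    using b that by (auto simp: linear_maps_def bij_betw_inv_into_left)
  have b_inv: "?b x \<in> carrier M" "b (?b x) = x" if "x \<in> carrier N" for x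
    using b(2) that by (auto simp: bij_betw_def inv_into_into f_inv_into_f)
  have zero: "c y = \<zero>\<^bsub>N''\<^esub> \<longleftrightarrow> y = \<zero>\<^bsub>M''\<^esub>" if "y \<in> carrier M''" for y
  proof -
    interpret M'': left_module R M'' by (rule M(3))
    have "c \<zero>\<^bsub>M''\<^esub> = \<zero>\<^bsub>N''\<^esub>" using linear_maps_zero c M by blast
    then show ?thesis using c(2) that by (metis M''.M.zero_closed bij_betw_inv_into_left)
  qed
  show ?thesis
    unfolding short_exact_def
  proof (intro bexI conjI)
    show "(\<lambda>x. b (f (?a x))) \<in> linear_maps R N' N"
      by (rule linear_maps_compose[OF linear_maps_compose[OF a' f(1)] b(1)])
    show "(\<lambda>x. c (g (?b x))) \<in> linear_maps R N N''"
      by (rule linear_maps_compose[OF linear_maps_compose[OF b' g(1)] c(1)])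
    have aN: "?a ` carrier N' = carrier M'" using ab(1) by (simp add: bij_betw_def)
    show "inj_on (\<lambda>x. b (f (?a x))) (carrier N')"
    proof (rule inj_onI)
      fix x y assume xy: "x \<in> carrier N'" "y \<in> carrier N'" "b (f (?a x)) = b (f (?a y))"
      then have "?a x \<in> carrier M'" "?a y \<in> carrier M'" using aN by blast+
      with xy have "?a x = ?a y" using f_in b(2) f(2) by (meson bij_betw_imp_inj_on inj_onD)
      with xy show "x = y" using ab(1) by (meson bij_betw_imp_inj_on inj_onD)
    qed
    have "(\<lambda>x. b (f (?a x))) ` carrier N' = b ` f ` ?a ` carrier N'" by (simp only: image_image)
    also have "\<dots> = b ` f ` carrier M'" by (simp only: aN)
    also have "\<dots> = {x \<in> carrier N. c (g (?b x)) = \<zero>\<^bsub>N''\<^esub>}"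
    proof (intro equalityI subsetI)
      fix y assume "y \<in> b ` f ` carrier M'"
      then obtain x where x: "x \<in> carrier M" "g x = \<zero>\<^bsub>M''\<^esub>" "y = b x" unfolding fg by blast
      then have "c (g x) = \<zero>\<^bsub>N''\<^esub>" using zero[OF g_in] by blast
      then show "y \<in> {x \<in> carrier N. c (g (?b x)) = \<zero>\<^bsub>N''\<^esub>}" using b_in[OF x(1)] x(3) by simp
    next
      fix y assume y: "y \<in> {x \<in> carrier N. c (g (?b x)) = \<zero>\<^bsub>N''\<^esub>}"
      then have y': "y \<in> carrier N" "c (g (?b y)) = \<zero>\<^bsub>N''\<^esub>" by auto
      then have "?b y \<in> carrier M \<and> g (?b y) = \<zero>\<^bsub>M''\<^esub>" using b_inv(1) zero[OF g_in] by blast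
      then have "?b y \<in> f ` carrier M'" unfolding fg by simp
      then show "y \<in> b ` f ` carrier M'" using b_inv(2)[of y] y by (intro image_eqI[of y b "?b y"]) auto
    qed
    finally show "(\<lambda>x. b (f (?a x))) ` carrier N' = {x \<in> carrier N. c (g (?b x)) = \<zero>\<^bsub>N''\<^esub>}" .
    have "(\<lambda>x. c (g (?b x))) ` carrier N = c ` g ` ?b ` carrier N" by (simp add: image_image)
    also have "\<dots> = carrier N''" using ab(2) g(2) c(2) by (simp add: bij_betw_def)
    finally show "(\<lambda>x. c (g (?b x))) ` carrier N = carrier N''" .
  qed
qed

section \<open>Modules of fixed vectors\<close>

context finite_group begin

lemma apply_rep_one: "mat_rep H \<rho> \<Longrightarrow> x \<in> carrier H \<Longrightarrow> apply_fmat (\<rho> \<one>) (apply_fmat (\<rho> x) v) = apply_fmat (\<rho> x) v"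
  by (simp add: mat_rep_one flip: apply_times)

lemma rep_smult_closed:
  assumes \<rho>: "mat_rep H \<rho>" and "Poly_Mapping.keys a \<subseteq> carrier H"
  shows "apply_fmat (\<rho> \<one>) (a \<odot>\<^bsub>rep_module H \<rho>\<^esub> v) = a \<odot>\<^bsub>rep_module H \<rho>\<^esub> v"
  using assms(2)
  by (induction rule: additive_support_induct)
    (simp_all add: apply_zero apply_add rep_module_smult_plus apply_smult apply_rep_one[OF \<rho>])

lemma rep_smult_mult:
  assumes \<rho>: "mat_rep H \<rho>" and "Poly_Mapping.keys a \<subseteq> carrier H" and b: "Poly_Mapping.keys b \<subseteq> carrier H"
  shows "(a \<otimes>\<^bsub>group_ring H\<^esub> b) \<odot>\<^bsub>rep_module H \<rho>\<^esub> v = a \<odot>\<^bsub>rep_module H \<rho>\<^esub> (b \<odot>\<^bsub>rep_module H \<rho>\<^esub> v)"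
  using assms(2)
proof (induction rule: additive_support_induct)
  case (single x c)
  note x = single
  show ?case
    using b
  proof (induction rule: additive_support_induct)
    case (single y d)
    then show ?case using x \<rho> by (simp add: apply_smult mat_rep_mult[symmetric] apply_times mult.assoc)
  qed (simp_all add: group_ring_mult_add_right rep_module_smult_plus apply_add apply_zero distrib_left)
qed (simp_all add: group_ring_mult_add_left rep_module_smult_plus)

lemma rep_smult_add:
  "a \<odot>\<^bsub>rep_module H \<rho>\<^esub> (\<lambda>i. v i + w i) = (\<lambda>i. (a \<odot>\<^bsub>rep_module H \<rho>\<^esub> v) i + (a \<odot>\<^bsub>rep_module H \<rho>\<^esub> w) i)"
  by (simp add: rep_module_smult apply_add distrib_left sum.distrib)

lemma left_module_rep_module:
  assumes \<rho>: "mat_rep H \<rho>"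
  shows "left_module (group_ring H) (rep_module H \<rho>)"
proof (intro left_module.intro left_module_axioms.intro)
  show "ring (group_ring H)" by (rule ring_group_ring)
  show "abelian_group (rep_module H \<rho>)"
  proof (rule abelian_groupI)
    fix v assume "v \<in> carrier (rep_module H \<rho>)"
    then have "apply_fmat (\<rho> \<one>) (\<lambda>i. - v i) = (\<lambda>i. - v i)"
      using apply_smult[of "\<rho> \<one>" "- 1" v] by simp
    then show "\<exists>w\<in>carrier (rep_module H \<rho>). w \<oplus>\<^bsub>rep_module H \<rho>\<^esub> v = \<zero>\<^bsub>rep_module H \<rho>\<^esub>"
      by (intro bexI[of _ "\<lambda>i. - v i"]) auto
  qed (simp_all add: apply_add apply_zero ac_simps)
qed (simp_all add: rep_smult_closed[OF \<rho>] rep_module_smult_plus rep_smult_add rep_smult_mult[OF \<rho>])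

lemma group_ring_module_rep_module: "mat_rep H \<rho> \<Longrightarrow> group_ring_module H (rep_module H \<rho>)"
  using finite_group_axioms left_module_rep_module by (simp add: group_ring_module_def)

lemma column_in_rep_module:
  assumes "mat_rep H \<rho>" "x \<in> carrier H"
  shows "apply_fmat (\<rho> \<one>) (\<lambda>i. entry (\<rho> x) i j) = (\<lambda>i. entry (\<rho> x) i j)"
  using mat_rep_one(1)[OF assms] by (simp flip: entry_times_col)

lemma lincomb_columns:
  assumes "mat_rep H \<rho>"
  shows "lincomb H (rep_module H \<rho>) (\<lambda>j i. entry (\<rho> \<one>) i j) c n = (\<lambda>i. \<Sum>j<n. c j * entry (\<rho> \<one>) i j)"
  by (induction n) (auto simp: column_in_rep_module[OF assms one_closed])

text \<open>A fixed vector \<open>v\<close> is the combination of the columns of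
  \<open>\<rho> \<one>\<close> with the entries of \<open>v\<close> as coefficients.\<close>

lemma rep_module_fg:
  assumes \<rho>: "mat_rep H \<rho>"
  shows "rep_module H \<rho> \<in> fg_modules (group_ring H)"
proof -
  interpret group_ring_module H "rep_module H \<rho>" by (rule group_ring_module_rep_module[OF \<rho>])
  obtain n where n: "fmat_bound (\<rho> \<one>) n" using fmat_bound_exists by blast
  show ?thesis
  proof (rule spanned_finitely_generated)
    show "(\<lambda>i. entry (\<rho> \<one>) i j) \<in> carrier (rep_module H \<rho>)" for j
      using column_in_rep_module[OF \<rho> group_one_closed] by simp
    show "carrier (rep_module H \<rho>) \<subseteq> range (\<lambda>c. lincomb H (rep_module H \<rho>) (\<lambda>j i. entry (\<rho> \<one>) i j) c n)"
    proof
      fix v assume "v \<in> carrier (rep_module H \<rho>)"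
      then have "v = lincomb H (rep_module H \<rho>) (\<lambda>j i. entry (\<rho> \<one>) i j) v n"
        by (simp add: lincomb_columns[OF \<rho>] flip: column_apply_sum[OF n])
      then show "v \<in> range (\<lambda>c. lincomb H (rep_module H \<rho>) (\<lambda>j i. entry (\<rho> \<one>) i j) c n)" by blast
    qed
  qed
qed

section \<open>Matrices and linear maps between modules of fixed vectors\<close>

lemma intertwiner_linear:
  assumes \<sigma>: "mat_rep H \<sigma>" and T: "intertwines H \<sigma> \<rho> T"
  shows "apply_fmat T \<in> linear_maps (group_ring H) (rep_module H \<sigma>) (rep_module H \<rho>)"
proof -
  have "apply_fmat T (a \<odot>\<^bsub>rep_module H \<sigma>\<^esub> v) = a \<odot>\<^bsub>rep_module H \<rho>\<^esub> apply_fmat T v"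
    if "Poly_Mapping.keys a \<subseteq> carrier H" for a v
    using that
  proof (induction rule: additive_support_induct)
    case (single x c)
    then show ?case using intertwinesD(3)[OF T] by (simp add: apply_smult flip: apply_times)
  qed (simp_all add: apply_zero rep_module_smult_plus apply_add)
  then show ?thesis
    unfolding linear_maps_def using intertwinesD(1)[OF T] by (auto simp: apply_add simp flip: apply_times)
qed

text \<open>The retraction gives injectivity and the section surjectivity; on the kernel of
  \<open>G\<close> the identity \<open>F * R + S * G\<close> reduces to
  \<open>F * R\<close>.\<close>

lemma split_exact_short_exact:
  assumes \<rho>: "mat_rep H \<rho>'" "mat_rep H \<rho>" "mat_rep H \<rho>''" and ex: "split_exact H \<rho>' \<rho> \<rho>''"
  shows "short_exact (group_ring H) (rep_module H \<rho>') (rep_module H \<rho>) (rep_module H \<rho>'')"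
proof -
  obtain F G R S where F: "intertwines H \<rho>' \<rho> F" and G: "intertwines H \<rho> \<rho>'' G"
    and RF: "R * F = \<rho>' \<one>" and GS: "G * S = \<rho>'' \<one>" and FRSG: "F * R + S * G = \<rho> \<one>" and GF: "G * F = 0"
    using ex unfolding split_exact_def by blast
  note F1 = intertwinesD[OF F] and G1 = intertwinesD[OF G]
  have \<rho>'1: "apply_fmat (\<rho>' \<one>) (apply_fmat (\<rho>' \<one>) v) = apply_fmat (\<rho>' \<one>) v" for v
    using \<rho>(1) by (simp add: apply_rep_one)
  show ?thesis
    unfolding short_exact_def
  proof (intro bexI conjI)
    show "apply_fmat F \<in> linear_maps (group_ring H) (rep_module H \<rho>') (rep_module H \<rho>)"
      "apply_fmat G \<in> linear_maps (group_ring H) (rep_module H \<rho>) (rep_module H \<rho>'')"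
      using intertwiner_linear \<rho> F G by blast+
    show "inj_on (apply_fmat F) (carrier (rep_module H \<rho>'))"
      by (rule inj_on_inverseI[of _ "apply_fmat R"]) (simp add: RF flip: apply_times)
    show "apply_fmat F ` carrier (rep_module H \<rho>') = {x \<in> carrier (rep_module H \<rho>). apply_fmat G x = \<zero>\<^bsub>rep_module H \<rho>''\<^esub>}"
    proof
      show "apply_fmat F ` carrier (rep_module H \<rho>') \<subseteq> {x \<in> carrier (rep_module H \<rho>). apply_fmat G x = \<zero>\<^bsub>rep_module H \<rho>''\<^esub>}"
        by (auto simp: F1 GF simp flip: apply_times)
      show "{x \<in> carrier (rep_module H \<rho>). apply_fmat G x = \<zero>\<^bsub>rep_module H \<rho>''\<^esub>} \<subseteq> apply_fmat F ` carrier (rep_module H \<rho>')"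
      proof
        fix v assume v: "v \<in> {x \<in> carrier (rep_module H \<rho>). apply_fmat G x = \<zero>\<^bsub>rep_module H \<rho>''\<^esub>}"
        then have "v = apply_fmat (F * R + S * G) v" by (simp add: FRSG)
        also have "\<dots> = apply_fmat F (apply_fmat R v)" using v by (simp add: apply_plus_left apply_times apply_zero)
        \<comment> \<open>The vector obtained from \<open>R\<close> need not be fixed by
          \<open>\<rho>' \<one>\<close>; projecting it first does not change its image under
          \<open>F\<close>.\<close>
        also have "\<dots> = apply_fmat F (apply_fmat (\<rho>' \<one>) (apply_fmat R v))"
          using F1(2) by (metis apply_times)
        finally have eq: "v = apply_fmat F (apply_fmat (\<rho>' \<one>) (apply_fmat R v))" .
        show "v \<in> apply_fmat F ` carrier (rep_module H \<rho>')"
          by (rule image_eqI, rule eq) (simp add: \<rho>'1)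
      qed
    qed
    show "apply_fmat G ` carrier (rep_module H \<rho>) = carrier (rep_module H \<rho>'')"
    proof
      show "apply_fmat G ` carrier (rep_module H \<rho>) \<subseteq> carrier (rep_module H \<rho>'')"
        by (auto simp: G1 simp flip: apply_times)
      show "carrier (rep_module H \<rho>'') \<subseteq> apply_fmat G ` carrier (rep_module H \<rho>)"
      proof
        fix w assume w: "w \<in> carrier (rep_module H \<rho>'')"
        have eq: "w = apply_fmat G (apply_fmat (\<rho> \<one>) (apply_fmat S w))"
          using w G1(2) GS by (simp flip: apply_times mult.assoc)
        show "w \<in> apply_fmat G ` carrier (rep_module H \<rho>)"
          by (rule image_eqI, rule eq) (simp add: apply_rep_one \<rho>)
      qed
    qed
  qed
qed

text \<open>The columns of \<open>F\<close> are the images of the columns of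
  \<open>\<sigma> \<one>\<close>, which span the module. A fixed vector has its own entries as
  coefficients, so linearity gives \<open>f v = apply_fmat F v\<close>.\<close>

lemma linear_map_intertwiner:
  assumes \<sigma>: "mat_rep H \<sigma>" and \<rho>: "mat_rep H \<rho>"
    and f: "f \<in> linear_maps (group_ring H) (rep_module H \<sigma>) (rep_module H \<rho>)"
  obtains F where "intertwines H \<sigma> \<rho> F" "\<And>v. v \<in> carrier (rep_module H \<sigma>) \<Longrightarrow> f v = apply_fmat F v"
proof -
  interpret S: group_ring_module H "rep_module H \<sigma>" by (rule group_ring_module_rep_module[OF \<sigma>])
  let ?S = "rep_module H \<sigma>"
  have f_in: "apply_fmat (\<rho> \<one>) (f v) = f v" if "v \<in> carrier ?S" for v
    using f that by (auto simp: linear_maps_def)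
  have f_add: "f (\<lambda>i. v i + w i) = (\<lambda>i. f v i + f w i)" if "v \<in> carrier ?S" "w \<in> carrier ?S" for v w
    using f that by (simp add: linear_maps_def)
  have f_smult: "f (\<lambda>i. c * apply_fmat (\<sigma> x) v i) = (\<lambda>i. c * apply_fmat (\<rho> x) (f v) i)"
    if "v \<in> carrier ?S" "x \<in> carrier H" for c x v
  proof -
    have "f (Poly_Mapping.single x c \<odot>\<^bsub>?S\<^esub> v) = Poly_Mapping.single x c \<odot>\<^bsub>rep_module H \<rho>\<^esub> f v"
      using f that unfolding linear_maps_def by (simp del: rep_module_simps(1) rep_module_smult_single)
    then show ?thesis by simp
  qed
  have f0: "f (\<lambda>_. 0) = (\<lambda>_. 0)"
    using linear_maps_zero[OF f left_module_rep_module[OF \<sigma>] left_module_rep_module[OF \<rho>]] by simp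
  define col where "col j = (\<lambda>i. entry (\<sigma> \<one>) i j)" for j
  have col: "apply_fmat (\<sigma> \<one>) (col j) = col j" for j
    unfolding col_def by (rule column_in_rep_module[OF \<sigma> one_closed])
  obtain n where n: "fmat_bound (\<sigma> \<one>) n" using fmat_bound_exists by blast
  have "\<exists>m. \<forall>i\<ge>m. f (col j) i = 0" for j
    using apply_fmat_finite_support[of "\<rho> \<one>" "f (col j)"] f_in[of "col j"] col by simp
  then obtain F where F: "\<And>i j. entry F i j = (if j < n then f (col j) i else 0)"
    using fmat_of_columns[of n "\<lambda>j. f (col j)"] by metis
  \<comment> \<open>Beyond the bound \<open>n\<close> the columns of \<open>\<sigma> \<one>\<close>
    vanish, which agrees with the zero columns of \<open>F\<close>.\<close>
  have F_col: "(\<lambda>i. entry F i j) = f (col j)" for j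
  proof (cases "j < n")
    case False
    then have "col j = (\<lambda>_. 0)" using n by (simp add: col_def fmat_bound_def)
    then show ?thesis using False f0 by (simp add: F)
  qed (simp add: F)
  have "f v = apply_fmat F v" if v: "v \<in> carrier ?S" for v
  proof -
    have part: "(\<lambda>i. \<Sum>j<m. v j * col j i) \<in> carrier ?S \<and>
        f (\<lambda>i. \<Sum>j<m. v j * col j i) = (\<lambda>i. \<Sum>j<m. v j * f (col j) i)" for m
    proof (induction m)
      case (Suc m)
      have "f (\<lambda>i. v m * apply_fmat (\<sigma> \<one>) (col m) i) = (\<lambda>i. v m * apply_fmat (\<rho> \<one>) (f (col m)) i)"
        by (rule f_smult) (simp_all add: col)
      then have "f (\<lambda>i. v m * col m i) = (\<lambda>i. v m * f (col m) i)" using f_in col by simp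
      moreover have "(\<lambda>i. v m * col m i) \<in> carrier ?S" by (simp add: apply_smult col)
      ultimately show ?case using Suc f_add[of "\<lambda>i. \<Sum>j<m. v j * col j i" "\<lambda>i. v m * col m i"]
        by (simp add: apply_add)
    qed (simp add: f0 apply_zero)
    have "v = (\<lambda>i. \<Sum>j<n. v j * col j i)" using v column_apply_sum[OF n, of v] by (simp add: col_def)
    then have "f v = (\<lambda>i. \<Sum>j<n. v j * f (col j) i)" using part[of n] by metis
    also have "\<dots> = apply_fmat F v"
    proof -
      obtain m where "fmat_bound F m" using fmat_bound_exists by blast
      then have m: "fmat_bound F (max m n)" by (rule fmat_bound_mono) simp
      have "(\<Sum>j<n. v j * f (col j) i) = (\<Sum>j<max m n. v j * entry F i j)" for i
        by (rule sum.mono_neutral_cong_left) (auto simp: F)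
      then show ?thesis by (simp add: column_apply_sum[OF m])
    qed
    finally show ?thesis .
  qed
  note fF = this
  have "intertwines H \<sigma> \<rho> F"
    unfolding intertwines_def
  proof (intro conjI ballI)
    show "\<rho> \<one> * F = F"
    proof (rule fmat_eqI)
      fix i j
      have "(\<lambda>i. entry (\<rho> \<one> * F) i j) = (\<lambda>i. entry F i j)"
        using f_in[of "col j"] col by (simp add: entry_times_col F_col)
      then show "entry (\<rho> \<one> * F) i j = entry F i j" by metis
    qed
  next
    fix h assume h: "h \<in> carrier H"
    show "\<rho> h * F = F * \<sigma> h"
    proof (rule fmat_eqI)
      fix i j
      have *: "(\<lambda>i. entry (\<sigma> h) i j) = apply_fmat (\<sigma> h) (col j)"
        unfolding col_def entry_times_col[symmetric] using mat_rep_one(2)[OF \<sigma> h] by simp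
      have "(\<lambda>i. entry (F * \<sigma> h) i j) = apply_fmat F (\<lambda>i. entry (\<sigma> h) i j)" by (rule entry_times_col)
      also have "\<dots> = f (\<lambda>i. entry (\<sigma> h) i j)"
        by (rule fF[symmetric]) (simp add: column_in_rep_module[OF \<sigma> h])
      also have "\<dots> = apply_fmat (\<rho> h) (f (col j))" unfolding * using f_smult[of "col j" h 1] h col by simp
      also have "\<dots> = (\<lambda>i. entry (\<rho> h * F) i j)" by (simp add: entry_times_col F_col)
      finally show "entry (\<rho> h * F) i j = entry (F * \<sigma> h) i j" by metis
    qed
  qed
  then show thesis using fF by (rule that)
qed

text \<open>Linear splittings are built column by column. Surjectivity of \<open>g\<close> lifts the
  columns of \<open>\<rho>'' \<one>\<close> to a section \<open>S\<close>; the columns of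
  \<open>\<rho> \<one> - S * G\<close> then lie in the kernel of \<open>g\<close>, hence in the
  image of \<open>f\<close>, and lifting them gives \<open>R\<close>.\<close>

lemma short_exact_split_exact:
  assumes \<rho>: "mat_rep H \<rho>'" "mat_rep H \<rho>" "mat_rep H \<rho>''"
    and ex: "short_exact (group_ring H) (rep_module H \<rho>') (rep_module H \<rho>) (rep_module H \<rho>'')"
  shows "split_exact H \<rho>' \<rho> \<rho>''"
proof -
  let ?M' = "rep_module H \<rho>'" and ?M = "rep_module H \<rho>" and ?M'' = "rep_module H \<rho>''"
  obtain f g where f: "f \<in> linear_maps (group_ring H) ?M' ?M" and g: "g \<in> linear_maps (group_ring H) ?M ?M''"
    and inj: "inj_on f (carrier ?M')" and ker: "f ` carrier ?M' = {x \<in> carrier ?M. g x = \<zero>\<^bsub>?M''\<^esub>}"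
    and surj: "g ` carrier ?M = carrier ?M''"
    using ex unfolding short_exact_def by blast
  obtain F where F: "intertwines H \<rho>' \<rho> F" and fF: "\<And>v. v \<in> carrier ?M' \<Longrightarrow> f v = apply_fmat F v"
    using linear_map_intertwiner[OF \<rho>(1,2) f] by blast
  obtain G where G: "intertwines H \<rho> \<rho>'' G" and gG: "\<And>v. v \<in> carrier ?M \<Longrightarrow> g v = apply_fmat G v"
    using linear_map_intertwiner[OF \<rho>(2,3) g] by blast
  note F1 = intertwinesD[OF F] and G1 = intertwinesD[OF G]
  \<comment> \<open>The chosen preimages are used only for columns below a bound of \<open>B\<close>
    and replaced by 0 beyond it, which keeps the array finitely supported.\<close>
  have lift: "\<exists>A. \<rho> \<one> * A = A \<and> P * A = B" if "\<And>j. \<exists>v. apply_fmat (\<rho> \<one>) v = v \<and> apply_fmat P v = (\<lambda>i. entry B i j)"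
    for \<rho> :: "'a \<Rightarrow> 'b fmat" and P B
  proof -
    from that obtain c where c: "\<And>j. apply_fmat (\<rho> \<one>) (c j) = c j" "\<And>j. apply_fmat P (c j) = (\<lambda>i. entry B i j)" by metis
    obtain n where n: "fmat_bound B n" using fmat_bound_exists by blast
    have "\<exists>m. \<forall>i\<ge>m. c j i = 0" for j using apply_fmat_finite_support[of "\<rho> \<one>" "c j"] c by simp
    then obtain A where A: "\<And>i j. entry A i j = (if j < n then c j i else 0)"
      using fmat_of_columns[of n c] by metis
    have A_col: "(\<lambda>i. entry A i j) = (if j < n then c j else (\<lambda>_. 0))" for j by (auto simp: A)
    have "(\<lambda>i. entry (\<rho> \<one> * A) i j) = (\<lambda>i. entry A i j)" for j
      by (simp add: entry_times_col A_col c apply_zero)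
    moreover have "(\<lambda>i. entry (P * A) i j) = (\<lambda>i. entry B i j)" for j
      using n by (auto simp: entry_times_col A_col c apply_zero fmat_bound_def)
    ultimately show ?thesis by (metis fmat_eqI)
  qed
  have "\<exists>v. apply_fmat (\<rho> \<one>) v = v \<and> apply_fmat G v = (\<lambda>i. entry (\<rho>'' \<one>) i j)" for j
  proof -
    have "(\<lambda>i. entry (\<rho>'' \<one>) i j) \<in> g ` carrier ?M"
      unfolding surj using column_in_rep_module[OF \<rho>(3) one_closed] by simp
    then show ?thesis using gG by auto
  qed
  then obtain S where S: "\<rho> \<one> * S = S" "G * S = \<rho>'' \<one>" using lift by blast
  have GF: "G * F = 0"
  proof (rule fmat_apply_eqI)
    fix v
    have *: "apply_fmat (\<rho>' \<one>) v \<in> carrier ?M'" using \<rho>(1) by (simp add: apply_rep_one)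
    then have "f (apply_fmat (\<rho>' \<one>) v) \<in> {x \<in> carrier ?M. g x = \<zero>\<^bsub>?M''\<^esub>}" using ker by blast
    then have "apply_fmat G (apply_fmat F (apply_fmat (\<rho>' \<one>) v)) = (\<lambda>_. 0)" using fF[OF *] gG by auto
    moreover have "apply_fmat (F * \<rho>' \<one>) v = apply_fmat F v" by (simp add: F1(2))
    ultimately show "apply_fmat (G * F) v = apply_fmat 0 v" by (simp add: apply_times)
  qed
  have "\<exists>v. apply_fmat (\<rho>' \<one>) v = v \<and> apply_fmat F v = (\<lambda>i. entry (\<rho> \<one> - S * G) i j)" for j
  proof -
    let ?A = "\<rho> \<one> - S * G"
    have "\<rho> \<one> * ?A = ?A" using mat_rep_one(1)[OF \<rho>(2) one_closed] S(1) by (simp add: right_diff_distrib flip: mult.assoc)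
    then have 1: "apply_fmat (\<rho> \<one>) (\<lambda>i. entry ?A i j) = (\<lambda>i. entry ?A i j)" by (metis entry_times_col)
    have "G * ?A = 0" using G1 S(2) by (simp add: right_diff_distrib flip: mult.assoc)
    then have "apply_fmat G (\<lambda>i. entry ?A i j) = (\<lambda>i. 0)" by (metis entry_times_col entry_simps(4))
    then have "(\<lambda>i. entry ?A i j) \<in> f ` carrier ?M'" unfolding ker using 1 gG by simp
    then show ?thesis using fF by auto
  qed
  then obtain R where R: "\<rho>' \<one> * R = R" "F * R = \<rho> \<one> - S * G" using lift by blast
  \<comment> \<open>\<open>F * (R * F) = F\<close> because \<open>G * F = 0\<close>, and
    \<open>F\<close> can be cancelled since it is injective on fixed vectors.\<close>
  have "R * F = \<rho>' \<one>"
  proof (rule fmat_apply_eqI)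
    fix v
    have "F * (R * F) = F" using F1 GF by (simp add: R left_diff_distrib mult.assoc flip: mult.assoc[of F])
    then have "apply_fmat F (apply_fmat (R * F) v) = apply_fmat F (apply_fmat (\<rho>' \<one>) v)"
      by (simp add: F1(2) flip: apply_times)
    moreover have "apply_fmat (\<rho>' \<one>) (apply_fmat (R * F) v) = apply_fmat (R * F) v"
      using R(1) by (simp flip: apply_times mult.assoc)
    moreover have "apply_fmat (\<rho>' \<one>) (apply_fmat (\<rho>' \<one>) v) = apply_fmat (\<rho>' \<one>) v" using \<rho>(1) by (simp add: apply_rep_one)
    ultimately show "apply_fmat (R * F) v = apply_fmat (\<rho>' \<one>) v" using inj fF by (simp add: inj_on_def)
  qed
  then show ?thesis unfolding split_exact_def using F G S R GF by (metis diff_add_cancel)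
qed

text \<open>Coordinates with respect to a basis over the field identify \<open>M\<close> with
  vectors of length \<open>n\<close>; the columns of \<open>\<rho> h\<close> are the coordinates of
  the translated basis vectors.\<close>

lemma fg_module_affords:
  assumes "M \<in> fg_modules (group_ring H)"
  shows "\<exists>\<rho>. affords H M \<rho>"
proof -
  interpret group_ring_module H M
    using assms finite_group_axioms by (simp add: group_ring_module_def fg_modules_def)
  obtain b n where b': "\<forall>i. b i \<in> carrier M"
    and indep: "\<forall>c. lincomb H M b c n = \<zero>\<^bsub>M\<^esub> \<longrightarrow> (\<forall>i<n. c i = 0)"
    and span: "carrier M = range (\<lambda>c. lincomb H M b c n)" using finitely_generated_basis[OF assms] by blast
  have b: "b i \<in> carrier M" for i using b' by blast
  have ex: "\<exists>c. lincomb H M b c n = x \<and> (\<forall>i\<ge>n. c i = 0)" if "x \<in> carrier M" for x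
  proof -
    obtain c where "x = lincomb H M b c n" using span \<open>x \<in> carrier M\<close> by blast
    then have "lincomb H M b (\<lambda>i. if i < n then c i else 0) n = x" by (auto intro: lincomb_cong)
    then show ?thesis by (intro exI[of _ "\<lambda>i. if i < n then c i else 0"]) auto
  qed
  \<comment> \<open>Requiring zeros from \<open>n\<close> on makes the coordinate vector
    unique.\<close>
  define cf where "cf x = (SOME c. lincomb H M b c n = x \<and> (\<forall>i\<ge>n. c i = 0))" for x
  have cf: "lincomb H M b (cf x) n = x" "n \<le> i \<Longrightarrow> cf x i = 0" if "x \<in> carrier M" for x i
    using someI_ex[OF ex[OF that]] unfolding cf_def by blast+
  have cf_eq: "cf x = c" if "x \<in> carrier M" "lincomb H M b c n = x" "\<And>i. n \<le> i \<Longrightarrow> c i = 0" for x c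
  proof
    fix i
    have "lincomb H M b (\<lambda>i. cf x i + - 1 * c i) n = x \<oplus>\<^bsub>M\<^esub> scal (- 1) x"
      using b cf(1)[OF that(1)] that(2) by (simp only: lincomb_add lincomb_scal[symmetric])
    also have "\<dots> = \<zero>\<^bsub>M\<^esub>" using scal_plus[OF that(1), of 1 "- 1"] that(1) by simp
    finally have "i < n \<Longrightarrow> cf x i + - 1 * c i = 0" using indep by (metis (no_types, lifting))
    then show "cf x i = c i" using cf(2)[OF that(1)] that(3) by (cases "i < n") auto
  qed
  have cf_add: "cf (x \<oplus>\<^bsub>M\<^esub> y) = (\<lambda>i. cf x i + cf y i)" if "x \<in> carrier M" "y \<in> carrier M" for x y
    by (rule cf_eq) (use that b cf in \<open>simp_all add: lincomb_add\<close>)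
  have cf_scal: "cf (scal r x) = (\<lambda>i. r * cf x i)" if "x \<in> carrier M" for r x
    by (rule cf_eq) (use that b cf in \<open>simp_all add: lincomb_scal[symmetric]\<close>)
  have cf_zero: "cf \<zero>\<^bsub>M\<^esub> = (\<lambda>_. 0)"
    by (rule cf_eq) (use b in \<open>simp_all add: lincomb_zero\<close>)
  have cf_lincomb: "cf (lincomb H M b' c m) = (\<lambda>i. \<Sum>j<m. c j * cf (b' j) i)" if "\<And>i. b' i \<in> carrier M" for b' c m
    using that by (induction m) (simp_all add: cf_zero cf_add cf_scal)
  define act where "act h x = Poly_Mapping.single h 1 \<odot>\<^bsub>M\<^esub> x" for h x
  have act_in: "act h x \<in> carrier M" if "h \<in> carrier H" "x \<in> carrier M" for h x using that by (simp add: act_def)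
  have "\<exists>A. fmat_bound A n \<and> (\<forall>j<n. (\<lambda>i. entry A i j) = cf (act h (b j)))" if h: "h \<in> carrier H" for h
  proof -
    have *: "cf (act h (b j)) i = 0" if "n \<le> i" for i j using cf(2) act_in[OF h b] that by blast
    have "\<exists>m. \<forall>i\<ge>m. cf (act h (b j)) i = 0" for j using * by blast
    then obtain A where A: "\<And>i j. entry A i j = (if j < n then cf (act h (b j)) i else 0)"
      using fmat_of_columns[of n "\<lambda>j. cf (act h (b j))"] by metis
    then have "fmat_bound A n" using * by (simp add: fmat_bound_def)
    then show ?thesis using A by (intro exI[of _ A]) auto
  qed
  then obtain \<rho> where \<rho>: "\<And>h. h \<in> carrier H \<Longrightarrow> fmat_bound (\<rho> h) n"
    "\<And>h j. h \<in> carrier H \<Longrightarrow> j < n \<Longrightarrow> (\<lambda>i. entry (\<rho> h) i j) = cf (act h (b j))" by metis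
  have \<rho>_cf: "apply_fmat (\<rho> h) (cf x) = cf (act h x)" if h: "h \<in> carrier H" and x: "x \<in> carrier M" for h x
  proof -
    have "act h x = lincomb H M (\<lambda>j. act h (b j)) (cf x) n"
      using lincomb_smult[of b h 1 "cf x" n] b h cf(1)[OF x] by (simp add: act_def)
    then have "cf (act h x) = (\<lambda>i. \<Sum>j<n. cf x j * cf (act h (b j)) i)"
      using cf_lincomb[of "\<lambda>j. act h (b j)" "cf x" n] act_in[OF h b] by simp
    also have "\<dots> = apply_fmat (\<rho> h) (cf x)"
      by (simp add: column_apply_sum[OF \<rho>(1)[OF h]] \<rho>(2)[OF h, symmetric])
    finally show ?thesis by simp
  qed
  have act_mult: "act (x \<otimes> y) m = act x (act y m)" if "x \<in> carrier H" "y \<in> carrier H" "m \<in> carrier M" for x y m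
    using that by (simp add: act_def single_smult_assoc)
  have rep: "mat_rep H \<rho>"
    unfolding mat_rep_def
  proof (intro ballI fmat_eqI)
    fix x y i j assume xy: "x \<in> carrier H" "y \<in> carrier H"
    have xy': "x \<otimes> y \<in> carrier H" using xy by simp
    show "entry (\<rho> (x \<otimes> y)) i j = entry (\<rho> x * \<rho> y) i j"
    proof (cases "j < n")
      case True
      have "(\<lambda>i. entry (\<rho> x * \<rho> y) i j) = apply_fmat (\<rho> x) (cf (act y (b j)))"
        using \<rho>(2)[OF xy(2) True] by (simp add: entry_times_col)
      also have "\<dots> = cf (act (x \<otimes> y) (b j))" using xy b act_in by (simp add: \<rho>_cf act_mult)
      also have "\<dots> = (\<lambda>i. entry (\<rho> (x \<otimes> y)) i j)" using \<rho>(2)[OF xy' True] by simp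
      finally show ?thesis by metis
    next
      case False
      have "entry (\<rho> (x \<otimes> y)) i j = 0" using fmat_bound_less[OF \<rho>(1)[OF xy']] False by blast
      moreover have "entry (\<rho> x * \<rho> y) i j = 0"
        using fmat_bound_less[OF fmat_bound_times[OF \<rho>(1)[OF xy(1)] \<rho>(1)[OF xy(2)]]] False by blast
      ultimately show ?thesis by simp
    qed
  qed
  have act_one: "act \<one> x = x" if "x \<in> carrier M" for x using that by (simp add: act_def)
  have cf_in: "cf x \<in> carrier (rep_module H \<rho>)" if "x \<in> carrier M" for x
    using \<rho>_cf[OF group_one_closed that] act_one[OF that] by simp
  have cf_smult: "cf (a \<odot>\<^bsub>M\<^esub> x) = a \<odot>\<^bsub>rep_module H \<rho>\<^esub> cf x" if "Poly_Mapping.keys a \<subseteq> carrier H" "x \<in> carrier M" for a x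
    using that(1)
  proof (induction rule: additive_support_induct)
    case (single h r)
    have "Poly_Mapping.single h r \<odot>\<^bsub>M\<^esub> x = scal r (act h x)"
      using single that(2) by (simp add: act_def single_smult_assoc)
    then show ?case using \<rho>_cf[OF single that(2)] cf_scal[OF act_in[OF single that(2)]] by simp
  next
    case (add a b)
    have "a \<odot>\<^bsub>M\<^esub> x \<in> carrier M" "b \<odot>\<^bsub>M\<^esub> x \<in> carrier M" using add.hyps that(2) by (auto intro!: smult_closed)
    then show ?case using add that(2) by (simp add: smult_plus cf_add rep_module_smult_plus)
  qed (use that(2) in \<open>simp add: cf_zero\<close>)
  have "cf \<in> linear_maps (group_ring H) M (rep_module H \<rho>)"
    unfolding linear_maps_def using cf_in cf_add cf_smult by simp
  moreover have "bij_betw cf (carrier M) (carrier (rep_module H \<rho>))"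
  proof (rule bij_betwI[where g = "\<lambda>v. lincomb H M b v n"])
    show "cf \<in> carrier M \<rightarrow> carrier (rep_module H \<rho>)" using cf_in by blast
    show "(\<lambda>v. lincomb H M b v n) \<in> carrier (rep_module H \<rho>) \<rightarrow> carrier M" using b by simp
    show "lincomb H M b (cf x) n = x" if "x \<in> carrier M" for x using that by (rule cf)
    fix v assume v: "v \<in> carrier (rep_module H \<rho>)"
    have "v i = 0" if "n \<le> i" for i
    proof -
      have "v i = apply_fmat (\<rho> \<one>) v i" using v by simp
      then show ?thesis using that \<rho>(1)[OF group_one_closed] by (simp add: apply_fmat_bound fmat_bound_def)
    qed
    then show "cf (lincomb H M b v n) = v" using b by (intro cf_eq) auto
  qed
  ultimately show ?thesis unfolding affords_def using rep by blast
qed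

text \<open>A homomorphism preserves \<open>\<one>\<close>, so the field acts as before and a basis
  over the field still spans.\<close>

lemma restrict_scalars_fg:
  assumes K: "finite_group K" and \<phi>: "\<phi> \<in> hom H K" and M: "M \<in> fg_modules (group_ring K)"
  shows "restrict_scalars (group_ring_map \<phi>) M \<in> fg_modules (group_ring H)"
proof -
  interpret KM: group_ring_module K M
    using M K by (simp add: group_ring_module_def fg_modules_def)
  interpret HM: group_ring_module H "restrict_scalars (group_ring_map \<phi>) M"
    using left_module_restrict_scalars[OF K \<phi> fg_left_module[OF M]] finite_group_axioms
    by (simp add: group_ring_module_def)
  obtain b n where b: "\<forall>i. b i \<in> carrier M" and span: "carrier M = range (\<lambda>c. lincomb K M b c n)"
    using KM.finitely_generated_basis[OF M] by blast
  have "\<phi> \<one> = \<one>\<^bsub>K\<^esub>" using \<phi> K group_axioms hom_one unfolding finite_group_def by blast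
  then have "lincomb H (restrict_scalars (group_ring_map \<phi>) M) b c m = lincomb K M b c m" for c m
    by (induction m) simp_all
  then show ?thesis using b span by (intro HM.spanned_finitely_generated[of b n]) simp_all
qed

lemma restrict_scalars_affords:
  fixes M :: "('b \<Rightarrow>\<^sub>0 'k::field, 'm) module"
  assumes K: "finite_group K" and \<phi>: "\<phi> \<in> hom H K" and M: "affords K M \<rho>"
  shows "affords H (restrict_scalars (group_ring_map \<phi>) M) (\<lambda>h. \<rho> (\<phi> h))"
proof -
  obtain \<psi> where \<psi>: "\<psi> \<in> linear_maps (group_ring K) M (rep_module K \<rho>)"
    "bij_betw \<psi> (carrier M) (carrier (rep_module K \<rho>))" and \<rho>: "mat_rep K \<rho>"
    using M unfolding affords_def by blast
  have one: "\<phi> \<one> = \<one>\<^bsub>K\<^esub>" using \<phi> K group_axioms hom_one unfolding finite_group_def by blast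
  have carrier: "carrier (rep_module H (\<lambda>h. \<rho> (\<phi> h))) = carrier (rep_module K \<rho>)"
    by (auto simp: one)
  have smult: "group_ring_map \<phi> a \<odot>\<^bsub>rep_module K \<rho>\<^esub> v = a \<odot>\<^bsub>rep_module H (\<lambda>h. \<rho> (\<phi> h))\<^esub> v"
    if "Poly_Mapping.keys a \<subseteq> carrier H" for a v
    using that by (induction rule: additive_support_induct) (simp_all add: group_ring_map_add rep_module_smult_plus)
  have "mat_rep H (\<lambda>h. \<rho> (\<phi> h))"
    using \<rho> \<phi> unfolding mat_rep_def by (simp add: hom_mult hom_in_carrier)
  moreover have "\<psi> \<in> linear_maps (group_ring H) (restrict_scalars (group_ring_map \<phi>) M) (rep_module H (\<lambda>h. \<rho> (\<phi> h)))"
    unfolding linear_maps_def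
  proof (intro CollectI conjI ballI)
    show "\<psi> \<in> carrier (restrict_scalars (group_ring_map \<phi>) M) \<rightarrow> carrier (rep_module H (\<lambda>h. \<rho> (\<phi> h)))"
      using \<psi>(1) by (simp only: linear_maps_def carrier restrict_scalars_simps mem_Collect_eq)
  next
    fix x y assume "x \<in> carrier (restrict_scalars (group_ring_map \<phi>) M)" "y \<in> carrier (restrict_scalars (group_ring_map \<phi>) M)"
    then show "\<psi> (x \<oplus>\<^bsub>restrict_scalars (group_ring_map \<phi>) M\<^esub> y) = \<psi> x \<oplus>\<^bsub>rep_module H (\<lambda>h. \<rho> (\<phi> h))\<^esub> \<psi> y"
      using \<psi>(1) by (simp add: linear_maps_def)
  next
    fix a :: "'a \<Rightarrow>\<^sub>0 'k" and x
    assume a: "a \<in> carrier (group_ring H)" and x: "x \<in> carrier (restrict_scalars (group_ring_map \<phi>) M)"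
    then have "group_ring_map \<phi> a \<in> carrier (group_ring K)" using group_ring_map_closed[OF \<phi>, of a] by simp
    then have "\<psi> (group_ring_map \<phi> a \<odot>\<^bsub>M\<^esub> x) = group_ring_map \<phi> a \<odot>\<^bsub>rep_module K \<rho>\<^esub> \<psi> x"
      using \<psi>(1) x unfolding linear_maps_def by simp
    then show "\<psi> (a \<odot>\<^bsub>restrict_scalars (group_ring_map \<phi>) M\<^esub> x) = a \<odot>\<^bsub>rep_module H (\<lambda>h. \<rho> (\<phi> h))\<^esub> \<psi> x"
      using smult[of a "\<psi> x"] a by simp
  qed
  moreover have "bij_betw \<psi> (carrier (restrict_scalars (group_ring_map \<phi>) M)) (carrier (rep_module H (\<lambda>h. \<rho> (\<phi> h))))"
    using \<psi>(2) by (simp only: carrier restrict_scalars_simps)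
  ultimately show ?thesis unfolding affords_def by blast
qed

section \<open>Additivity of the trace for modules\<close>

lemma rep_module_affords: "mat_rep H \<rho> \<Longrightarrow> affords H (rep_module H \<rho>) \<rho>"
  unfolding affords_def linear_maps_def by (auto intro!: bexI[of _ "\<lambda>x. x"] bij_betw_id[unfolded id_def])

text \<open>After transport to modules of fixed vectors the sequence splits linearly, and the matrix
  version of additivity applies.\<close>

lemma short_exact_trace:
  assumes M: "M' \<in> fg_modules (group_ring H)" "M \<in> fg_modules (group_ring H)" "M'' \<in> fg_modules (group_ring H)"
    and ex: "short_exact (group_ring H) M' M M''"
    and \<rho>: "affords H M' \<rho>'" "affords H M \<rho>" "affords H M'' \<rho>''" and h: "h \<in> carrier H"
  shows "trace_fmat (\<rho> h) = trace_fmat (\<rho>' h) + trace_fmat (\<rho>'' h)"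
proof -
  have rep: "mat_rep H \<rho>'" "mat_rep H \<rho>" "mat_rep H \<rho>''" using \<rho> by (auto simp: affords_def)
  obtain a b c where "a \<in> linear_maps (group_ring H) M' (rep_module H \<rho>')" "bij_betw a (carrier M') (carrier (rep_module H \<rho>'))"
    "b \<in> linear_maps (group_ring H) M (rep_module H \<rho>)" "bij_betw b (carrier M) (carrier (rep_module H \<rho>))"
    "c \<in> linear_maps (group_ring H) M'' (rep_module H \<rho>'')" "bij_betw c (carrier M'') (carrier (rep_module H \<rho>''))"
    using \<rho> unfolding affords_def by blast
  then have "short_exact (group_ring H) (rep_module H \<rho>') (rep_module H \<rho>) (rep_module H \<rho>'')"
    using short_exact_transport[OF ex M[THEN fg_left_module] left_module_rep_module[OF rep(3)]] by blast
  then show ?thesis using split_exact_trace rep short_exact_split_exact h by blast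
qed

lemma zero_rep: "mat_rep H (\<lambda>_. 0)"
  by (simp add: mat_rep_def)

text \<open>The zero representation models the zero module, so that an isomorphism becomes a
  relation in the Grothendieck group.\<close>

lemma isomorphism_short_exact:
  assumes M: "left_module (group_ring H) M" and N: "left_module (group_ring H) N" and f: "f \<in> linear_maps (group_ring H) M N" "bij_betw f (carrier M) (carrier N)"
  shows "short_exact (group_ring H) M N (rep_module H (\<lambda>_. 0))"
proof -
  interpret N: left_module "group_ring H" N by (rule N)
  have "(\<lambda>_ _. 0) \<in> linear_maps (group_ring H) N (rep_module H (\<lambda>_. 0))"
    by (simp add: linear_maps_def rep_module_smult)
  moreover have "carrier N \<noteq> {}" using N.M.zero_closed by blast
  ultimately show ?thesis
    unfolding short_exact_def using f
    by (intro bexI[of _ f] bexI[of _ "\<lambda>_ _. 0"]) (auto simp: bij_betw_def)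
qed

end

section \<open>Characters on the Grothendieck group\<close>

text \<open>The choice among matrix forms is harmless by \<open>module_char_eq\<close>.\<close>

definition module_char :: "('a, 'c) monoid_scheme \<Rightarrow> ('a, 'k::field) gmodule \<Rightarrow> 'a \<Rightarrow> 'k" where
  "module_char H M h = trace_fmat ((SOME \<rho>. affords H M \<rho>) h)"

definition frag_char :: "('a, 'c) monoid_scheme \<Rightarrow> (('a, 'k::field) gmodule \<Rightarrow>\<^sub>0 int) \<Rightarrow> 'a \<Rightarrow> 'k" where
  "frag_char H c h = (\<Sum>M\<in>Poly_Mapping.keys c. of_int (Poly_Mapping.lookup c M) * module_char H M h)"

text \<open>On the group the value does not depend on the representative of a coset, by
  \<open>frag_char_exact\<close>.\<close>

definition groth_char :: "('a, 'c) monoid_scheme \<Rightarrow> ('a, 'k::field) groth \<Rightarrow> 'a \<Rightarrow> 'k" where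
  "groth_char H A = frag_char H (SOME c. c \<in> A)"

section \<open>Virtual characters\<close>

lemma frag_char_add: "frag_char H (c + d) h = frag_char H c h + frag_char H d h"
  unfolding frag_char_def by (rule setsum_keys_plus_distrib) (simp_all add: distrib_right)

lemma frag_char_diff: "frag_char H (c - d) h = frag_char H c h - frag_char H d h"
  using frag_char_add[of H "c - d" d h] by simp

lemma frag_char_zero [simp]: "frag_char H 0 h = 0"
  by (simp add: frag_char_def)

lemma frag_char_of [simp]: "frag_char H (frag_of M) h = module_char H M h"
  by (simp add: frag_char_def)

lemma carrier_module_frags [simp]:
  "c \<in> carrier (module_frags H) \<longleftrightarrow> Poly_Mapping.keys c \<subseteq> fg_modules (group_ring H)"
  by (simp add: module_frags_def)

text \<open>Values outside the carrier are ignored, so that one function on the whole type can be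
  tested on many subgroups.\<close>

definition virtual_char :: "('a, 'c) monoid_scheme \<Rightarrow> ('a \<Rightarrow> 'k::field) \<Rightarrow> bool" where
  "virtual_char H f \<longleftrightarrow> (\<exists>c\<in>carrier (module_frags H). \<forall>h\<in>carrier H. f h = frag_char H c h)"

lemma virtual_char_zero: "virtual_char H (\<lambda>_. 0)"
  unfolding virtual_char_def by (intro bexI[of _ 0]) auto

lemma virtual_char_diff:
  assumes "virtual_char H f" "virtual_char H g"
  shows "virtual_char H (\<lambda>h. f h - g h)"
proof -
  obtain c d where cd: "c \<in> carrier (module_frags H)" "d \<in> carrier (module_frags H)"
    "\<And>h. h \<in> carrier H \<Longrightarrow> f h = frag_char H c h" "\<And>h. h \<in> carrier H \<Longrightarrow> g h = frag_char H d h"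
    using assms unfolding virtual_char_def by blast
  have "c - d \<in> carrier (module_frags H)" using cd keys_diff[of c d] by auto
  with cd show ?thesis unfolding virtual_char_def by (intro bexI[of _ "c - d"]) (auto simp: frag_char_diff)
qed

lemma virtual_char_add:
  assumes "virtual_char H f" "virtual_char H g"
  shows "virtual_char H (\<lambda>h. f h + g h)"
  using virtual_char_diff[OF assms(1) virtual_char_diff[OF virtual_char_zero assms(2)]] by simp

lemma virtual_char_cong:
  "virtual_char H f \<Longrightarrow> (\<And>h. h \<in> carrier H \<Longrightarrow> f h = g h) \<Longrightarrow> virtual_char H g"
  unfolding virtual_char_def by metis

lemma virtual_char_of_nat: "virtual_char H f \<Longrightarrow> virtual_char H (\<lambda>h. of_nat n * f h)"
  by (induction n) (simp_all add: virtual_char_zero virtual_char_add distrib_right)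

lemma virtual_char_of_int:
  assumes "virtual_char H f"
  shows "virtual_char H (\<lambda>h. of_int n * f h)"
proof (cases n)
  case (nonneg m)
  then show ?thesis using virtual_char_of_nat[OF assms, of m] by simp
next
  case (neg m)
  then show ?thesis
    using virtual_char_diff[OF virtual_char_zero virtual_char_of_nat[OF assms, of "Suc m"]]
    by (simp only: diff_0 of_int_minus of_int_of_nat_eq mult_minus_left)
qed

lemma virtual_char_sum:
  "(\<And>x. x \<in> S \<Longrightarrow> virtual_char H (f x)) \<Longrightarrow> virtual_char H (\<lambda>h. \<Sum>x\<in>S. f x h)"
  by (induction S rule: infinite_finite_induct) (auto simp: virtual_char_zero virtual_char_add)

context finite_group begin

text \<open>In the identity sequence \<open>M \<rightarrow> M \<rightarrow> 0\<close> the two copies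
  of \<open>M\<close> may be given different matrix forms; additivity then compares their
  traces.\<close>

lemma module_char_eq:
  assumes M: "M \<in> fg_modules (group_ring H)" and \<rho>: "affords H M \<rho>" and h: "h \<in> carrier H"
  shows "module_char H M h = trace_fmat (\<rho> h)"
proof -
  have "affords H M (SOME \<rho>. affords H M \<rho>)" by (rule someI[of "affords H M", OF \<rho>])
  moreover have "short_exact (group_ring H) M M (rep_module H (\<lambda>_. 0))"
    by (rule isomorphism_short_exact[where f = "\<lambda>x. x"])
      (use M fg_left_module in \<open>auto simp: linear_maps_def bij_betw_def\<close>)
  ultimately have "trace_fmat (\<rho> h) = trace_fmat ((SOME \<rho>. affords H M \<rho>) h) + trace_fmat ((0 :: 'b fmat))"
    using short_exact_trace[OF M M rep_module_fg[OF zero_rep] _ _ \<rho> rep_module_affords[OF zero_rep] h] by blast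
  then show ?thesis by (simp add: module_char_def)
qed

lemma rep_module_char:
  "mat_rep H \<rho> \<Longrightarrow> h \<in> carrier H \<Longrightarrow> module_char H (rep_module H \<rho>) h = trace_fmat (\<rho> h)"
  using module_char_eq rep_module_fg rep_module_affords by blast

lemma virtual_char_trace: "mat_rep H \<rho> \<Longrightarrow> virtual_char H (\<lambda>h. trace_fmat (\<rho> h))"
  unfolding virtual_char_def by (intro bexI[of _ "frag_of (rep_module H \<rho>)"]) (auto simp: rep_module_char rep_module_fg)

lemma exact_relations_subgroup: "subgroup (exact_relations H) (module_frags H :: (('a, 'k::field) gmodule \<Rightarrow>\<^sub>0 int) monoid)"
proof -
  have "Poly_Mapping.keys (frag_of M - frag_of M' - frag_of M'') \<subseteq> {M, M', M''}" for M M' M'' :: "('a, 'k) gmodule"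
    using keys_diff[of "frag_of M - frag_of M'" "frag_of M''"] keys_diff[of "frag_of M" "frag_of M'"] by auto
  then show ?thesis
    unfolding exact_relations_def
    by (intro group.generate_is_subgroup) (auto simp: module_frags_def, blast)
qed

lemma exact_relations_closed:
  fixes c d :: "('a, 'k::field) gmodule \<Rightarrow>\<^sub>0 int"
  shows "(0 :: ('a, 'k) gmodule \<Rightarrow>\<^sub>0 int) \<in> exact_relations H"
    "c \<in> exact_relations H \<Longrightarrow> c \<in> carrier (module_frags H)"
    "c \<in> exact_relations H \<Longrightarrow> d \<in> exact_relations H \<Longrightarrow> c - d \<in> exact_relations H"
    "c \<in> exact_relations H \<Longrightarrow> d \<in> exact_relations H \<Longrightarrow> c + d \<in> exact_relations H"
proof -
  interpret E: subgroup "exact_relations H" "module_frags H :: (('a, 'k) gmodule \<Rightarrow>\<^sub>0 int) monoid"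
    by (rule exact_relations_subgroup)
  show "(0 :: ('a, 'k) gmodule \<Rightarrow>\<^sub>0 int) \<in> exact_relations H" using E.one_closed by (simp add: module_frags_def)
  show *: "c \<in> exact_relations H \<Longrightarrow> c \<in> carrier (module_frags H)" for c :: "('a, 'k) gmodule \<Rightarrow>\<^sub>0 int"
    using E.subset by blast
  show **: "c \<in> exact_relations H \<Longrightarrow> d \<in> exact_relations H \<Longrightarrow> c + d \<in> exact_relations H"
    for c d :: "('a, 'k) gmodule \<Rightarrow>\<^sub>0 int"
    using E.m_closed by (simp add: module_frags_def)
  have "d \<in> exact_relations H \<Longrightarrow> - d \<in> exact_relations H"
    using E.m_inv_closed[of d] *[of d] by (simp add: module_frags_def)
  then show "c \<in> exact_relations H \<Longrightarrow> d \<in> exact_relations H \<Longrightarrow> c - d \<in> exact_relations H"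
    using **[of c "- d"] by simp
qed

lemma short_exact_relation:
  "\<lbrakk>M' \<in> fg_modules (group_ring H); M \<in> fg_modules (group_ring H); M'' \<in> fg_modules (group_ring H);
    short_exact (group_ring H) M' M M''\<rbrakk> \<Longrightarrow> frag_of M - frag_of M' - frag_of M'' \<in> exact_relations H"
  unfolding exact_relations_def by (rule generate.incl) blast

lemma frag_char_exact:
  assumes "c \<in> exact_relations H" "h \<in> carrier H"
  shows "frag_char H c h = 0"
proof -
  have gen: "frag_char H (frag_of M - frag_of M' - frag_of M'') h = 0"
    if M: "M' \<in> fg_modules (group_ring H)" "M \<in> fg_modules (group_ring H)" "M'' \<in> fg_modules (group_ring H)"
      and ex: "short_exact (group_ring H) M' M M''" for M' M M'' :: "('a, 'b) gmodule"
  proof -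
    obtain \<rho>' \<rho> \<rho>'' where "affords H M' \<rho>'" "affords H M \<rho>" "affords H M'' \<rho>''"
      using M fg_module_affords by meson
    then show ?thesis
      using short_exact_trace[OF M ex _ _ _ assms(2)] M assms(2) by (simp add: frag_char_diff module_char_eq)
  qed
  have "Poly_Mapping.keys c \<subseteq> fg_modules (group_ring H) \<and> frag_char H c h = 0"
    using assms(1) unfolding exact_relations_def
  proof (induction rule: generate.induct)
    case one
    then show ?case by (simp add: module_frags_def)
  next
    case (incl c)
    then have "c \<in> exact_relations H" unfolding exact_relations_def by (rule generate.incl)
    with incl gen exact_relations_closed(2)[of c] show ?case by auto
  next
    case (inv c)
    then have "c \<in> exact_relations H" unfolding exact_relations_def by (rule generate.incl)
    then have "Poly_Mapping.keys c \<subseteq> fg_modules (group_ring H)" using exact_relations_closed(2) by simp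
    moreover have "frag_char H c h = 0" using inv gen by auto
    ultimately show ?case using frag_char_diff[of H 0 c h] by (simp add: module_frags_def keys_minus)
  next
    case (eng c d)
    then show ?case using keys_add[of c d] by (auto simp: module_frags_def frag_char_add)
  qed
  then show ?thesis by blast
qed

text \<open>Direct sums collect the positive and the negative part of a formal sum into one
  representation each.\<close>

lemma frag_as_difference:
  fixes c :: "('a, 'k::field) gmodule \<Rightarrow>\<^sub>0 int"
  assumes "c \<in> carrier (module_frags H)"
  shows "\<exists>\<rho> \<sigma>. mat_rep H \<rho> \<and> mat_rep H \<sigma> \<and>
    c - (frag_of (rep_module H \<rho>) - frag_of (rep_module H \<sigma>)) \<in> exact_relations H"
proof -
  have keys: "Poly_Mapping.keys c \<subseteq> fg_modules (group_ring H)" using assms by simp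
  let ?P = "\<lambda>c :: ('a, 'k) gmodule \<Rightarrow>\<^sub>0 int. \<exists>\<rho> \<sigma>. mat_rep H \<rho> \<and> mat_rep H \<sigma> \<and>
    c - (frag_of (rep_module H \<rho>) - frag_of (rep_module H \<sigma>)) \<in> exact_relations H"
  show "?P c"
  proof (rule free_Abelian_group_induct[OF keys, of ?P])
    show "?P 0"
      by (intro exI[of _ "\<lambda>_. 0"]) (simp add: zero_rep exact_relations_closed(1))
  next
    fix M :: "('a, 'k) gmodule"
    assume M: "M \<in> fg_modules (group_ring H)"
    obtain \<rho> where \<rho>: "affords H M \<rho>" using fg_module_affords[OF M] by blast
    then have rep: "mat_rep H \<rho>" by (simp add: affords_def)
    obtain \<psi> where "\<psi> \<in> linear_maps (group_ring H) M (rep_module H \<rho>)" "bij_betw \<psi> (carrier M) (carrier (rep_module H \<rho>))"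
      using \<rho> by (auto simp: affords_def)
    then have "short_exact (group_ring H) M (rep_module H \<rho>) (rep_module H (\<lambda>_. 0))"
      using isomorphism_short_exact fg_left_module[OF M] left_module_rep_module[OF rep] by blast
    then have "frag_of (rep_module H \<rho>) - frag_of M - frag_of (rep_module H (\<lambda>_. 0)) \<in> exact_relations H"
      by (intro short_exact_relation M rep_module_fg rep zero_rep)
    then have "0 - (frag_of (rep_module H \<rho>) - frag_of M - frag_of (rep_module H (\<lambda>_. 0))) \<in> exact_relations H"
      by (rule exact_relations_closed(3)[OF exact_relations_closed(1)])
    then show "?P (frag_of M)" using rep zero_rep
      by (intro exI[of _ \<rho>] exI[of _ "\<lambda>_. 0"]) (simp add: algebra_simps)
  next
    fix a b assume "?P a" "?P b"
    then obtain \<rho>1 \<sigma>1 \<rho>2 \<sigma>2 :: "'a \<Rightarrow> 'k fmat" where reps: "mat_rep H \<rho>1" "mat_rep H \<sigma>1" "mat_rep H \<rho>2" "mat_rep H \<sigma>2"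
      and a: "a - (frag_of (rep_module H \<rho>1) - frag_of (rep_module H \<sigma>1)) \<in> exact_relations H"
      and b: "b - (frag_of (rep_module H \<rho>2) - frag_of (rep_module H \<sigma>2)) \<in> exact_relations H" by blast
    \<comment> \<open>Subtraction exchanges the two parts of the second difference, so
      \<open>\<rho>1\<close> is joined with \<open>\<sigma>2\<close> and \<open>\<sigma>1\<close>
      with \<open>\<rho>2\<close>.\<close>
    obtain \<rho> where \<rho>: "mat_rep H \<rho>" "split_exact H \<rho>1 \<rho> \<sigma>2" using direct_sum_rep[OF reps(1,4)] by blast
    obtain \<sigma> where \<sigma>: "mat_rep H \<sigma>" "split_exact H \<sigma>1 \<sigma> \<rho>2" using direct_sum_rep[OF reps(2,3)] by blast
    let ?f = "\<lambda>\<rho>. frag_of (rep_module H \<rho>)"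
    have 1: "?f \<rho> - ?f \<rho>1 - ?f \<sigma>2 \<in> exact_relations H" "?f \<sigma> - ?f \<sigma>1 - ?f \<rho>2 \<in> exact_relations H"
      using \<rho> \<sigma> reps by (auto intro!: short_exact_relation rep_module_fg split_exact_short_exact)
    have "((a - (?f \<rho>1 - ?f \<sigma>1)) - (b - (?f \<rho>2 - ?f \<sigma>2))) - ((?f \<rho> - ?f \<rho>1 - ?f \<sigma>2) - (?f \<sigma> - ?f \<sigma>1 - ?f \<rho>2)) \<in> exact_relations H"
      by (rule exact_relations_closed(3)[OF exact_relations_closed(3)[OF a b] exact_relations_closed(3)[OF 1]])
    then have "(a - b) - (?f \<rho> - ?f \<sigma>) \<in> exact_relations H" by (simp add: algebra_simps)
    then show "?P (a - b)" using \<rho> \<sigma> by blast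
  qed
qed

text \<open>Modulo relations a formal sum is a difference of two representations, and these are
  congruent as soon as their characters agree. So characters separate the elements of the
  Grothendieck group.\<close>

lemma exact_relations_iff:
  fixes c :: "('a, 'k::field_char_0) gmodule \<Rightarrow>\<^sub>0 int"
  assumes c: "c \<in> carrier (module_frags H)"
  shows "c \<in> exact_relations H \<longleftrightarrow> (\<forall>h\<in>carrier H. frag_char H c h = 0)"
proof
  assume zero: "\<forall>h\<in>carrier H. frag_char H c h = 0"
  obtain \<rho> \<sigma> :: "'a \<Rightarrow> 'k fmat" where rep: "mat_rep H \<rho>" "mat_rep H \<sigma>"
    and diff: "c - (frag_of (rep_module H \<rho>) - frag_of (rep_module H \<sigma>)) \<in> exact_relations H"
    using frag_as_difference[OF c] by blast
  have "frag_of (rep_module H \<rho>) - frag_of (rep_module H \<sigma>) \<in> exact_relations H"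
  proof (rule equal_characters_congruent[of "exact_relations H" "\<lambda>\<rho>. frag_of (rep_module H \<rho>)", OF _ _ _ rep])
    fix h assume h: "h \<in> carrier H"
    show "trace_fmat (\<rho> h) = trace_fmat (\<sigma> h)"
      using frag_char_exact[OF diff h] zero h rep by (simp add: frag_char_diff rep_module_char)
  next
    show "frag_of (rep_module H \<rho>) - frag_of (rep_module H \<rho>') - frag_of (rep_module H \<rho>'') \<in> exact_relations H"
      if "mat_rep H \<rho>'" "mat_rep H \<rho>" "mat_rep H \<rho>''" "split_exact H \<rho>' \<rho> \<rho>''" for \<rho>' \<rho> \<rho>'' :: "'a \<Rightarrow> 'k fmat"
      using that by (intro short_exact_relation rep_module_fg split_exact_short_exact)
  qed (rule exact_relations_closed; assumption?)+
  from exact_relations_closed(4)[OF diff this] show "c \<in> exact_relations H" by simp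
qed (auto intro: frag_char_exact)

section \<open>Symmetries and pairing of virtual characters\<close>

lemma virtual_char_difference:
  assumes "virtual_char H f"
  shows "\<exists>\<rho> \<sigma>. mat_rep H \<rho> \<and> mat_rep H \<sigma> \<and> (\<forall>h\<in>carrier H. f h = trace_fmat (\<rho> h) - trace_fmat (\<sigma> h))"
proof -
  obtain c where c: "c \<in> carrier (module_frags H)" "\<And>h. h \<in> carrier H \<Longrightarrow> f h = frag_char H c h"
    using assms unfolding virtual_char_def by blast
  then obtain \<rho> \<sigma> where rep: "mat_rep H \<rho>" "mat_rep H \<sigma>"
    and diff: "c - (frag_of (rep_module H \<rho>) - frag_of (rep_module H \<sigma>)) \<in> exact_relations H"
    using frag_as_difference by blast
  have "f h = trace_fmat (\<rho> h) - trace_fmat (\<sigma> h)" if h: "h \<in> carrier H" for h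
    using frag_char_exact[OF diff h] c(2)[OF h] rep h by (simp add: frag_char_diff rep_module_char)
  with rep show ?thesis by blast
qed

lemma virtual_char_same_cyclic:
  fixes f :: "'a \<Rightarrow> rat"
  assumes f: "virtual_char H f" and x: "x \<in> carrier H" and "y = x [^] (k::nat)" "x = y [^] (l::nat)"
  shows "f y = f x"
proof -
  obtain \<rho> \<sigma> where \<rho>: "mat_rep H \<rho>" "mat_rep H \<sigma>" "\<And>h. h \<in> carrier H \<Longrightarrow> f h = trace_fmat (\<rho> h) - trace_fmat (\<sigma> h)"
    using virtual_char_difference[OF f] by blast
  have "y \<in> carrier H" using x assms(3) nat_pow_closed by blast
  then show ?thesis using \<rho>(3) x trace_same_cyclic[OF \<rho>(1) assms(2-4)] trace_same_cyclic[OF \<rho>(2) assms(2-4)] by simp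
qed

text \<open>Writing both characters as differences gives four pairings of representations, each |H|
  times a natural number.\<close>

lemma virtual_char_pairing:
  fixes f g :: "'a \<Rightarrow> 'k::field_char_0"
  assumes f: "virtual_char H f" and g: "virtual_char H g"
  shows "\<exists>n. (\<Sum>h\<in>carrier H. f h * g (inv h)) = of_int (int (card (carrier H)) * n)"
proof -
  obtain \<rho> \<sigma> where \<rho>: "mat_rep H \<rho>" "mat_rep H \<sigma>" "\<And>h. h \<in> carrier H \<Longrightarrow> f h = trace_fmat (\<rho> h) - trace_fmat (\<sigma> h)"
    using virtual_char_difference[OF f] by blast
  obtain \<upsilon> \<tau> where \<upsilon>: "mat_rep H \<upsilon>" "mat_rep H \<tau>" "\<And>h. h \<in> carrier H \<Longrightarrow> g h = trace_fmat (\<upsilon> h) - trace_fmat (\<tau> h)"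
    using virtual_char_difference[OF g] by blast
  have "\<exists>n::nat. (\<Sum>h\<in>carrier H. trace_fmat (\<rho> h) * trace_fmat (\<sigma> (inv h))) = (of_nat (card (carrier H)) * of_nat n :: 'k)"
    if "mat_rep H \<rho>" "mat_rep H \<sigma>" for \<rho> \<sigma> :: "'a \<Rightarrow> 'k fmat"
    using character_pairing[OF that] by metis
  then obtain n1 n2 n3 n4 :: nat where n:
    "(\<Sum>h\<in>carrier H. trace_fmat (\<rho> h) * trace_fmat (\<upsilon> (inv h))) = of_nat (card (carrier H)) * of_nat n1"
    "(\<Sum>h\<in>carrier H. trace_fmat (\<rho> h) * trace_fmat (\<tau> (inv h))) = of_nat (card (carrier H)) * of_nat n2"
    "(\<Sum>h\<in>carrier H. trace_fmat (\<sigma> h) * trace_fmat (\<upsilon> (inv h))) = of_nat (card (carrier H)) * of_nat n3"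
    "(\<Sum>h\<in>carrier H. trace_fmat (\<sigma> h) * trace_fmat (\<tau> (inv h))) = of_nat (card (carrier H)) * of_nat n4"
    using \<rho>(1,2) \<upsilon>(1,2) by meson
  have "(\<Sum>h\<in>carrier H. f h * g (inv h)) =
      (\<Sum>h\<in>carrier H. trace_fmat (\<rho> h) * trace_fmat (\<upsilon> (inv h)) - trace_fmat (\<rho> h) * trace_fmat (\<tau> (inv h))
        - trace_fmat (\<sigma> h) * trace_fmat (\<upsilon> (inv h)) + trace_fmat (\<sigma> h) * trace_fmat (\<tau> (inv h)))"
    by (rule sum.cong) (simp_all add: \<rho>(3) \<upsilon>(3) algebra_simps)
  also have "\<dots> = of_int (int (card (carrier H)) * (int n1 - int n2 - int n3 + int n4))"
    by (simp add: sum.distrib sum_subtractf n algebra_simps)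
  finally show ?thesis by blast
qed

lemma virtual_char_conjugate:
  assumes f: "virtual_char H f" and g: "g \<in> carrier H" and x: "x \<in> carrier H"
  shows "f (g \<otimes> x \<otimes> inv g) = f x"
proof -
  obtain \<rho> \<sigma> where \<rho>: "mat_rep H \<rho>" "mat_rep H \<sigma>" "\<And>h. h \<in> carrier H \<Longrightarrow> f h = trace_fmat (\<rho> h) - trace_fmat (\<sigma> h)"
    using virtual_char_difference[OF f] by blast
  have "trace_fmat (\<rho> (g \<otimes> x \<otimes> inv g)) = trace_fmat (\<rho> x)" if \<rho>: "mat_rep H \<rho>" for \<rho> :: "'a \<Rightarrow> 'b fmat"
  proof -
    have "\<rho> (g \<otimes> x \<otimes> inv g) = \<rho> (g \<otimes> x) * \<rho> (inv g)" using \<rho> g x by (simp add: mat_rep_mult)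
    then have "trace_fmat (\<rho> (g \<otimes> x \<otimes> inv g)) = trace_fmat (\<rho> (inv g) * \<rho> (g \<otimes> x))" by (simp add: trace_commute)
    also have "\<rho> (inv g) * \<rho> (g \<otimes> x) = \<rho> (inv g \<otimes> (g \<otimes> x))" using \<rho> g x by (simp add: mat_rep_mult)
    also have "inv g \<otimes> (g \<otimes> x) = x" using g x by (simp flip: m_assoc)
    finally show ?thesis .
  qed
  with \<rho> show ?thesis using g x by simp
qed

section \<open>Elements of the Grothendieck ring and their characters\<close>

lemma mem_coset_relations:
  "d \<in> exact_relations H #>\<^bsub>module_frags H\<^esub> c \<longleftrightarrow> d - c \<in> exact_relations H"
  by (auto simp: r_coset_def module_frags_def intro!: exI[of _ "d - c"] bexI[of _ "d - c"])

lemma coset_relations_eq: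
  fixes c d :: "('a, 'k::field_char_0) gmodule \<Rightarrow>\<^sub>0 int"
  assumes "c \<in> carrier (module_frags H)" "d \<in> carrier (module_frags H)"
    "\<And>h. h \<in> carrier H \<Longrightarrow> frag_char H c h = frag_char H d h"
  shows "exact_relations H #>\<^bsub>module_frags H\<^esub> c = exact_relations H #>\<^bsub>module_frags H\<^esub> d"
proof -
  have "c - d \<in> carrier (module_frags H)" using assms keys_diff[of c d] by auto
  then have "c - d \<in> exact_relations H" using assms by (simp add: exact_relations_iff frag_char_diff)
  then have "a - c \<in> exact_relations H \<longleftrightarrow> a - d \<in> exact_relations H" for a
    using exact_relations_closed(3)[of "a - d" "c - d"] exact_relations_closed(4)[of "a - c" "c - d"] by auto
  then show ?thesis by (auto simp: mem_coset_relations)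
qed

lemma groth_char_coset:
  assumes c: "c \<in> carrier (module_frags H)" and h: "h \<in> carrier H"
  shows "groth_char H (exact_relations H #>\<^bsub>module_frags H\<^esub> c) h = frag_char H c h"
proof -
  let ?A = "exact_relations H #>\<^bsub>module_frags H\<^esub> c"
  have "c \<in> ?A" by (simp add: mem_coset_relations exact_relations_closed(1))
  then have "(SOME d. d \<in> ?A) \<in> ?A" by (rule someI[of "\<lambda>d. d \<in> ?A"])
  then have "(SOME d. d \<in> ?A) - c \<in> exact_relations H" by (rule mem_coset_relations[THEN iffD1])
  from frag_char_exact[OF this h] show ?thesis by (simp add: groth_char_def frag_char_diff)
qed

lemma carrier_grothendieck_ring:
  "carrier (grothendieck_ring H) = (\<lambda>c. exact_relations H #>\<^bsub>module_frags H\<^esub> c) ` carrier (module_frags H)"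
  by (auto simp: grothendieck_ring_def Let_def FactGroup_def RCOSETS_def)

lemma virtual_char_groth_char:
  assumes "A \<in> carrier (grothendieck_ring H)"
  shows "virtual_char H (groth_char H A)"
proof -
  obtain c where "c \<in> carrier (module_frags H)" "A = exact_relations H #>\<^bsub>module_frags H\<^esub> c"
    using assms by (auto simp only: carrier_grothendieck_ring)
  then show ?thesis unfolding virtual_char_def using groth_char_coset by metis
qed

lemma virtual_char_realised:
  assumes "virtual_char H f"
  shows "\<exists>A\<in>carrier (grothendieck_ring H). \<forall>h\<in>carrier H. groth_char H A h = f h"
proof -
  obtain c where c: "c \<in> carrier (module_frags H)" "\<And>h. h \<in> carrier H \<Longrightarrow> f h = frag_char H c h"
    using assms unfolding virtual_char_def by blast
  show ?thesis
    by (rule bexI[of _ "exact_relations H #>\<^bsub>module_frags H\<^esub> c"])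
      (use c groth_char_coset carrier_grothendieck_ring in auto)
qed

lemma groth_char_inject:
  fixes A B :: "('a, 'k::field_char_0) groth"
  assumes "A \<in> carrier (grothendieck_ring H)" "B \<in> carrier (grothendieck_ring H)"
    "\<And>h. h \<in> carrier H \<Longrightarrow> groth_char H A h = groth_char H B h"
  shows "A = B"
proof -
  obtain c d where cd: "c \<in> carrier (module_frags H)" "A = exact_relations H #>\<^bsub>module_frags H\<^esub> c"
    "d \<in> carrier (module_frags H)" "B = exact_relations H #>\<^bsub>module_frags H\<^esub> d"
    using assms by (auto simp only: carrier_grothendieck_ring)
  have "frag_char H c h = frag_char H d h" if "h \<in> carrier H" for h
    using assms(3)[OF that] cd that by (simp only: groth_char_coset)
  then show ?thesis unfolding cd(2,4) by (intro coset_relations_eq cd)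
qed

lemma groth_add:
  assumes "A \<in> carrier (grothendieck_ring H)" "B \<in> carrier (grothendieck_ring H)"
  shows "A \<oplus>\<^bsub>grothendieck_ring H\<^esub> B \<in> carrier (grothendieck_ring H)"
    "h \<in> carrier H \<Longrightarrow> groth_char H (A \<oplus>\<^bsub>grothendieck_ring H\<^esub> B) h = groth_char H A h + groth_char H B h"
proof -
  obtain c d where cd: "c \<in> carrier (module_frags H)" "A = exact_relations H #>\<^bsub>module_frags H\<^esub> c"
    "d \<in> carrier (module_frags H)" "B = exact_relations H #>\<^bsub>module_frags H\<^esub> d"
    using assms by (auto simp only: carrier_grothendieck_ring)
  have "c + d \<in> carrier (module_frags H)" using cd keys_add[of c d] by auto
  moreover have "A \<oplus>\<^bsub>grothendieck_ring H\<^esub> B = exact_relations H #>\<^bsub>module_frags H\<^esub> (c + d)"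
  proof -
    interpret F: comm_group "module_frags H :: (('a, 'b) gmodule \<Rightarrow>\<^sub>0 int) monoid"
      unfolding module_frags_def by (rule abelian_free_Abelian_group)
    have "exact_relations H \<lhd> (module_frags H :: (('a, 'b) gmodule \<Rightarrow>\<^sub>0 int) monoid)"
      by (rule F.subgroup_imp_normal[OF exact_relations_subgroup])
    from normal.rcos_sum[OF this cd(1,3)] show ?thesis
      by (simp add: cd(2,4) grothendieck_ring_def Let_def FactGroup_def) (simp add: module_frags_def)
  qed
  ultimately show "A \<oplus>\<^bsub>grothendieck_ring H\<^esub> B \<in> carrier (grothendieck_ring H)"
    "h \<in> carrier H \<Longrightarrow> groth_char H (A \<oplus>\<^bsub>grothendieck_ring H\<^esub> B) h = groth_char H A h + groth_char H B h"
    using cd by (auto simp: carrier_grothendieck_ring groth_char_coset frag_char_add)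
qed

section \<open>Pullback along a homomorphism\<close>

lemma frag_char_restrict:
  fixes c :: "('b, 'k::field) gmodule \<Rightarrow>\<^sub>0 int"
  assumes K: "finite_group K" and \<phi>: "\<phi> \<in> hom H K" and c: "c \<in> carrier (module_frags K)" and h: "h \<in> carrier H"
  defines "P \<equiv> frag_extend (\<lambda>M. frag_of (restrict_scalars (group_ring_map \<phi>) M))"
  shows "P c \<in> carrier (module_frags H)" "frag_char H (P c) h = frag_char K c (\<phi> h)"
proof -
  have keys: "Poly_Mapping.keys c \<subseteq> fg_modules (group_ring K)" using c by simp
  have "P c \<in> carrier (module_frags H) \<and> frag_char H (P c) h = frag_char K c (\<phi> h)"
  proof (rule free_Abelian_group_induct[OF keys])
    show "P 0 \<in> carrier (module_frags H) \<and> frag_char H (P 0) h = frag_char K 0 (\<phi> h)" by (simp add: P_def)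
  next
    fix M :: "('b, 'k) gmodule"
    assume M: "M \<in> fg_modules (group_ring K)"
    obtain \<rho> where \<rho>: "affords K M \<rho>" using finite_group.fg_module_affords[OF K M] by blast
    have \<phi>h: "\<phi> h \<in> carrier K" using \<phi> h by (rule hom_in_carrier)
    have "module_char H (restrict_scalars (group_ring_map \<phi>) M) h = module_char K M (\<phi> h)"
      using module_char_eq[OF restrict_scalars_fg[OF K \<phi> M] restrict_scalars_affords[OF K \<phi> \<rho>] h]
        finite_group.module_char_eq[OF K M \<rho> \<phi>h] by simp
    then show "P (frag_of M) \<in> carrier (module_frags H) \<and> frag_char H (P (frag_of M)) h = frag_char K (frag_of M) (\<phi> h)"
      using restrict_scalars_fg[OF K \<phi> M] by (simp add: P_def)
  next
    fix c d
    assume "P c \<in> carrier (module_frags H) \<and> frag_char H (P c) h = frag_char K c (\<phi> h)"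
      "P d \<in> carrier (module_frags H) \<and> frag_char H (P d) h = frag_char K d (\<phi> h)"
    then show "P (c - d) \<in> carrier (module_frags H) \<and> frag_char H (P (c - d)) h = frag_char K (c - d) (\<phi> h)"
      using keys_diff[of "P c" "P d"] by (auto simp: P_def frag_extend_diff frag_char_diff)
  qed
  then show "P c \<in> carrier (module_frags H)" "frag_char H (P c) h = frag_char K c (\<phi> h)" by auto
qed

text \<open>The cosets in the defining union have equal characters, so they coincide and the union
  is a single coset; on characters the pullback is composition with \<phi>.\<close>

lemma groth_pullback:
  fixes A :: "('b, 'k::field_char_0) groth"
  assumes K: "finite_group K" and \<phi>: "\<phi> \<in> hom H K" and A: "A \<in> carrier (grothendieck_ring K)"
  shows "groth_pullback H \<phi> A \<in> carrier (grothendieck_ring H)"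
    "h \<in> carrier H \<Longrightarrow> groth_char H (groth_pullback H \<phi> A) h = groth_char K A (\<phi> h)"
proof -
  interpret K: finite_group K by (rule K)
  let ?P = "frag_extend (\<lambda>M. frag_of (restrict_scalars (group_ring_map \<phi>) M))"
  obtain c where c: "c \<in> carrier (module_frags K)" "A = exact_relations K #>\<^bsub>module_frags K\<^esub> c"
    using A by (auto simp only: K.carrier_grothendieck_ring)
  have in_A: "d \<in> carrier (module_frags K)" "x \<in> carrier K \<Longrightarrow> frag_char K d x = frag_char K c x" if "d \<in> A" for d x
  proof -
    have dc: "d - c \<in> exact_relations K" using that by (simp add: c(2) K.mem_coset_relations)
    then have "d - c \<in> carrier (module_frags K)" by (rule K.exact_relations_closed(2))
    then show "d \<in> carrier (module_frags K)" using c(1) keys_add[of "d - c" c] by auto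
    show "x \<in> carrier K \<Longrightarrow> frag_char K d x = frag_char K c x" using K.frag_char_exact[OF dc] by (simp add: frag_char_diff)
  qed
  have "exact_relations H #>\<^bsub>module_frags H\<^esub> ?P d = exact_relations H #>\<^bsub>module_frags H\<^esub> ?P c" if "d \<in> A" for d
  proof (rule coset_relations_eq)
    show "?P d \<in> carrier (module_frags H)" "?P c \<in> carrier (module_frags H)"
      using frag_char_restrict(1)[OF K \<phi> _ one_closed] in_A(1)[OF that] c(1) by blast+
    show "frag_char H (?P d) h = frag_char H (?P c) h" if h: "h \<in> carrier H" for h
      using frag_char_restrict(2)[OF K \<phi> in_A(1)[OF \<open>d \<in> A\<close>] h] frag_char_restrict(2)[OF K \<phi> c(1) h]
        in_A(2)[OF \<open>d \<in> A\<close> hom_in_carrier[OF \<phi> h]] by (simp only:)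
  qed
  moreover have "c \<in> A" by (simp add: c(2) K.mem_coset_relations K.exact_relations_closed(1))
  ultimately have eq: "groth_pullback H \<phi> A = exact_relations H #>\<^bsub>module_frags H\<^esub> ?P c"
    unfolding groth_pullback_def by blast
  then show "groth_pullback H \<phi> A \<in> carrier (grothendieck_ring H)"
    using frag_char_restrict(1)[OF K \<phi> c(1) one_closed] by (simp only: carrier_grothendieck_ring) blast
  assume h: "h \<in> carrier H"
  have "groth_char H (groth_pullback H \<phi> A) h = frag_char H (?P c) h"
    unfolding eq using frag_char_restrict(1)[OF K \<phi> c(1) h] h by (rule groth_char_coset)
  also have "\<dots> = frag_char K c (\<phi> h)" by (rule frag_char_restrict(2)[OF K \<phi> c(1) h])
  also have "\<dots> = groth_char K A (\<phi> h)"
    unfolding c(2) using c(1) hom_in_carrier[OF \<phi> h] by (rule K.groth_char_coset[symmetric])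
  finally show "groth_char H (groth_pullback H \<phi> A) h = groth_char K A (\<phi> h)" .
qed

end

section \<open>Artin's theorem\<close>

text \<open>For elements of finite order the natural powers already form the cyclic subgroup. The
  set does not depend on the carrier, so it is unchanged on passing to a subgroup.\<close>

definition powers :: "('a, 'c) monoid_scheme \<Rightarrow> 'a \<Rightarrow> 'a set" where
  "powers G x = range (\<lambda>k::nat. x [^]\<^bsub>G\<^esub> k)"

lemma self_in_powers: "group G \<Longrightarrow> x \<in> carrier G \<Longrightarrow> x \<in> powers G x"
  unfolding powers_def by (rule image_eqI[of _ _ 1]) (auto simp: group.is_monoid)

lemma trace_unit: "trace_fmat (unit_fmat q p c) = (if q = p then c else 0)"
proof -
  have "{i. entry (unit_fmat q p c) i i \<noteq> 0} = (if q = p \<and> c \<noteq> 0 then {q} else {})"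
    by (auto simp: entry_unit)
  then show ?thesis by (auto simp: trace_fmat_def entry_unit)
qed

lemma (in group) conj_nat_pow:
  assumes "g \<in> carrier G" "x \<in> carrier G"
  shows "(g \<otimes> x \<otimes> inv g) [^] (n::nat) = g \<otimes> x [^] n \<otimes> inv g"
proof (induction n)
  case 0
  then show ?case using assms by simp
next
  case (Suc n)
  have "(g \<otimes> x [^] n \<otimes> inv g) \<otimes> (g \<otimes> x \<otimes> inv g) = g \<otimes> x [^] n \<otimes> (inv g \<otimes> g) \<otimes> x \<otimes> inv g"
    using assms by (simp only: m_assoc m_closed inv_closed nat_pow_closed)
  then show ?case using assms Suc by (simp add: m_assoc)
qed

section \<open>Cyclic subgroups and induced characters\<close>

context finite_group begin

lemma powers_eq_generate: "x \<in> carrier H \<Longrightarrow> powers H x = generate H {x}"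
  using generate_pow_on_finite_carrier[OF finite_carrier] by (auto simp: powers_def)

lemma card_powers: "x \<in> carrier H \<Longrightarrow> card (powers H x) = ord x"
  using generate_pow_card powers_eq_generate by simp

lemma powers_subgroup: "x \<in> carrier H \<Longrightarrow> subgroup (powers H x) H"
  using generate_is_subgroup powers_eq_generate by simp

lemma powers_subset: "subgroup C H \<Longrightarrow> x \<in> C \<Longrightarrow> powers H x \<subseteq> C"
  using powers_eq_generate[of x] generate_subgroup_incl[of "{x}" C] subgroup.mem_carrier[of C H x] by simp

lemma ord_conj:
  assumes "g \<in> carrier H" "x \<in> carrier H"
  shows "ord (inv g \<otimes> x \<otimes> g) = ord x"
proof -
  have pow: "(inv g \<otimes> x \<otimes> g) [^] n = inv g \<otimes> x [^] n \<otimes> g" for n :: nat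
    using conj_nat_pow[of "inv g" x n] assms by simp
  have "inv g \<otimes> y \<otimes> g = \<one> \<longleftrightarrow> y = \<one>" if y: "y \<in> carrier H" for y
  proof
    assume "inv g \<otimes> y \<otimes> g = \<one>"
    then have "g \<otimes> (inv g \<otimes> y \<otimes> g) \<otimes> inv g = g \<otimes> \<one> \<otimes> inv g" by simp
    moreover have "g \<otimes> (inv g \<otimes> y \<otimes> g) \<otimes> inv g = (g \<otimes> inv g) \<otimes> y \<otimes> (g \<otimes> inv g)"
      using assms y by (simp only: m_assoc m_closed inv_closed)
    ultimately show "y = \<one>" using assms y by simp
  qed (use assms in simp)
  then have "(inv g \<otimes> x \<otimes> g) [^] n = \<one> \<longleftrightarrow> x [^] n = \<one>" for n :: nat using assms pow by simp
  then have dvd: "ord (inv g \<otimes> x \<otimes> g) dvd n \<longleftrightarrow> ord x dvd n" for n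
    using assms pow_eq_id[of "inv g \<otimes> x \<otimes> g" n] pow_eq_id[of x n] by simp
  show ?thesis
    by (rule dvd_antisym[OF dvd[THEN iffD2, OF dvd_refl] dvd[THEN iffD1, OF dvd_refl]])
qed

lemma ord_le_card: "x \<in> carrier H \<Longrightarrow> ord x \<le> card (carrier H)"
  using card_powers powers_subset[OF subgroup_self] card_mono[OF finite_carrier] by metis

text \<open>
  The representation induced from the trivial representation of \<open>C\<close>, realised inside the group ring as the
  image of right multiplication by the idempotent \<open>|C|\<^sup>-\<^sup>1 \<Sum> c\<close>.
\<close>

lemma induced_trivial_char:
  assumes C: "subgroup C H"
  shows "virtual_char H (\<lambda>h. of_nat (card {x \<in> carrier H. inv x \<otimes> h \<otimes> x \<in> C}) :: 'k::field_char_0)"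
proof -
  interpret C: subgroup C H by (rule C)
  have finC: "finite C" using C.subset finite_carrier finite_subset by blast
  have "C \<noteq> {}" using C.one_closed by blast
  then have cardC: "(of_nat (card C) :: 'k) \<noteq> 0" using finC by simp
  \<comment> \<open>Group elements are numbered to serve as matrix coordinates.\<close>
  obtain e :: "'a \<Rightarrow> nat" where e: "inj_on e (carrier H)"
    using finite_imp_inj_to_nat_seg[OF finite_carrier] by blast
  define perm :: "('a \<Rightarrow> 'a) \<Rightarrow> 'k fmat" where "perm p = (\<Sum>x\<in>carrier H. unit_fmat (e (p x)) (e x) 1)" for p
  have perm_mult: "perm p * perm q = perm (\<lambda>x. p (q x))" if q: "\<And>x. x \<in> carrier H \<Longrightarrow> q x \<in> carrier H" for p q
  proof -
    have "perm p * perm q = (\<Sum>y\<in>carrier H. \<Sum>x\<in>carrier H. unit_fmat (e (p x)) (e x) 1 * unit_fmat (e (q y)) (e y) 1)"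
      unfolding perm_def sum_product by (rule sum.swap)
    also have "\<dots> = (\<Sum>y\<in>carrier H. \<Sum>x\<in>carrier H. if x = q y then unit_fmat (e (p x)) (e y) 1 else 0)"
      using q e by (intro sum.cong refl) (auto simp: unit_times_unit dest: inj_onD)
    also have "\<dots> = perm (\<lambda>x. p (q x))"
      unfolding perm_def using q finite_carrier by (intro sum.cong refl) (simp add: sum.delta)
    finally show ?thesis .
  qed
  have perm_trace: "trace_fmat (perm p) = of_nat (card {x \<in> carrier H. p x = x})"
    if p: "\<And>x. x \<in> carrier H \<Longrightarrow> p x \<in> carrier H" for p
  proof -
    have "trace_fmat (perm p) = (\<Sum>x\<in>carrier H. if p x = x then 1 else 0)"
      unfolding perm_def trace_sum using p e by (intro sum.cong refl) (auto simp: trace_unit dest: inj_onD)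
    also have "\<dots> = of_nat (card {x \<in> carrier H. p x = x})"
      using finite_carrier by (simp add: sum.If_cases Int_def)
    finally show ?thesis .
  qed
  have perm_cong: "perm p = perm q" if "\<And>x. x \<in> carrier H \<Longrightarrow> p x = q x" for p q
    unfolding perm_def using that by (intro sum.cong refl) auto
  \<comment> \<open>Left multiplication by \<open>h\<close> is combined with averaging over right
    multiplication by \<open>C\<close>; \<open>\<rho> \<one>\<close> is the averaging
    projection.\<close>
  define \<rho> where "\<rho> h = scale_fmat (1 / of_nat (card C)) (\<Sum>c\<in>C. perm (\<lambda>x. h \<otimes> x \<otimes> c))" for h
  have rep: "mat_rep H \<rho>"
    unfolding mat_rep_def
  proof (intro ballI)
    fix g h assume gh: "g \<in> carrier H" "h \<in> carrier H"
    have "(\<Sum>c\<in>C. perm (\<lambda>x. g \<otimes> x \<otimes> c)) * (\<Sum>d\<in>C. perm (\<lambda>x. h \<otimes> x \<otimes> d))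
        = (\<Sum>c\<in>C. \<Sum>d\<in>C. perm (\<lambda>x. (g \<otimes> h) \<otimes> x \<otimes> (d \<otimes> c)))"
      unfolding sum_product
    proof (intro sum.cong refl)
      fix c d assume "c \<in> C" "d \<in> C"
      then have cd: "c \<in> carrier H" "d \<in> carrier H" by auto
      have "perm (\<lambda>x. g \<otimes> x \<otimes> c) * perm (\<lambda>x. h \<otimes> x \<otimes> d) = perm (\<lambda>x. g \<otimes> (h \<otimes> x \<otimes> d) \<otimes> c)"
        by (rule perm_mult) (use gh cd in auto)
      also have "\<dots> = perm (\<lambda>x. (g \<otimes> h) \<otimes> x \<otimes> (d \<otimes> c))"
        by (rule perm_cong) (use gh cd in \<open>simp add: m_assoc\<close>)
      finally show "perm (\<lambda>x. g \<otimes> x \<otimes> c) * perm (\<lambda>x. h \<otimes> x \<otimes> d) = perm (\<lambda>x. (g \<otimes> h) \<otimes> x \<otimes> (d \<otimes> c))" .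
    qed
    also have "\<dots> = (\<Sum>c\<in>C. \<Sum>d\<in>C. perm (\<lambda>x. (g \<otimes> h) \<otimes> x \<otimes> d))"
    proof (rule sum.cong[OF refl])
      fix c assume c: "c \<in> C"
      show "(\<Sum>d\<in>C. perm (\<lambda>x. (g \<otimes> h) \<otimes> x \<otimes> (d \<otimes> c))) = (\<Sum>d\<in>C. perm (\<lambda>x. (g \<otimes> h) \<otimes> x \<otimes> d))"
      proof -
        have "bij_betw (\<lambda>d. d \<otimes> c) C C"
          by (rule bij_betwI[where g = "\<lambda>d. d \<otimes> inv c"]) (use c in \<open>auto simp: m_assoc\<close>)
        from sum.reindex_bij_betw[OF this, of "\<lambda>d. perm (\<lambda>x. (g \<otimes> h) \<otimes> x \<otimes> d)"] show ?thesis .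
      qed
    qed
    also have "\<dots> = scale_fmat (of_nat (card C)) (\<Sum>d\<in>C. perm (\<lambda>x. (g \<otimes> h) \<otimes> x \<otimes> d))"
      by (rule fmat_eqI) simp
    finally show "\<rho> (g \<otimes> h) = \<rho> g * \<rho> h"
      using cardC by (simp add: \<rho>_def scale_times_left scale_times_right)
  qed
  \<comment> \<open>The stated function is \<open>card C\<close> times the induced character: it
    counts the pairs \<open>(x, c)\<close> with \<open>h \<otimes> x \<otimes> c = x\<close>, and
    \<open>x\<close> determines \<open>c\<close>.\<close>
  have "of_nat (card C) * trace_fmat (\<rho> h) = of_nat (card {x \<in> carrier H. inv x \<otimes> h \<otimes> x \<in> C})" if h: "h \<in> carrier H" for h
  proof -
    have "of_nat (card C) * trace_fmat (\<rho> h) = (\<Sum>c\<in>C. trace_fmat (perm (\<lambda>x. h \<otimes> x \<otimes> c)))"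
      using cardC by (simp add: \<rho>_def trace_scale trace_sum)
    also have "\<dots> = (\<Sum>c\<in>C. \<Sum>x\<in>carrier H. if h \<otimes> x \<otimes> c = x then 1 else 0)"
    proof (intro sum.cong refl)
      fix c assume "c \<in> C"
      then have "trace_fmat (perm (\<lambda>x. h \<otimes> x \<otimes> c)) = of_nat (card {x \<in> carrier H. h \<otimes> x \<otimes> c = x})"
        using h by (intro perm_trace) auto
      then show "trace_fmat (perm (\<lambda>x. h \<otimes> x \<otimes> c)) = (\<Sum>x\<in>carrier H. if h \<otimes> x \<otimes> c = x then 1 else 0)"
        using finite_carrier by (simp add: sum.If_cases Int_def)
    qed
    also have "\<dots> = (\<Sum>x\<in>carrier H. \<Sum>c\<in>C. if h \<otimes> x \<otimes> c = x then 1 else 0)" by (rule sum.swap)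
    also have "\<dots> = (\<Sum>x\<in>carrier H. if inv x \<otimes> h \<otimes> x \<in> C then 1 else 0)"
    proof (intro sum.cong refl)
      fix x assume x: "x \<in> carrier H"
      have "h \<otimes> x \<otimes> c = x \<longleftrightarrow> c = inv (inv x \<otimes> h \<otimes> x)" if c: "c \<in> C" for c
      proof -
        have "inv (inv x \<otimes> h \<otimes> x) = inv (h \<otimes> x) \<otimes> x"
          using x h by (simp add: inv_mult_group m_assoc)
        moreover have "h \<otimes> x \<otimes> c = x \<longleftrightarrow> c = inv (h \<otimes> x) \<otimes> x"
          using x h c by (metis C.mem_carrier inv_solve_left m_closed)
        ultimately show ?thesis by simp
      qed
      then have "(\<Sum>c\<in>C. if h \<otimes> x \<otimes> c = x then 1 else 0 :: 'k) = (\<Sum>c\<in>C. if c = inv (inv x \<otimes> h \<otimes> x) then 1 else 0)"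
        by (intro sum.cong refl) auto
      also have "\<dots> = (if inv (inv x \<otimes> h \<otimes> x) \<in> C then 1 else 0)" using finC by (simp add: sum.delta)
      also have "inv (inv x \<otimes> h \<otimes> x) \<in> C \<longleftrightarrow> inv x \<otimes> h \<otimes> x \<in> C"
        using x h C.m_inv_closed[of "inv x \<otimes> h \<otimes> x"] C.m_inv_closed[of "inv (inv x \<otimes> h \<otimes> x)"] by auto
      finally show "(\<Sum>c\<in>C. if h \<otimes> x \<otimes> c = x then 1 else 0 :: 'k) = (if inv x \<otimes> h \<otimes> x \<in> C then 1 else 0)" .
    qed
    also have "\<dots> = of_nat (card {x \<in> carrier H. inv x \<otimes> h \<otimes> x \<in> C})"
      using finite_carrier by (simp add: sum.If_cases Int_def)
    finally show ?thesis .
  qed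
  then show ?thesis by (rule virtual_char_cong[OF virtual_char_of_nat[OF virtual_char_trace[OF rep]]])
qed

text \<open>Artin's induction theorem: the values at elements of order \<open>k\<close>, \<open>k - 1\<close>, ... are cleared in turn.\<close>

lemma artin_bounded_order:
  fixes f :: "'a \<Rightarrow> int"
  assumes "\<And>x y. \<lbrakk>x \<in> carrier H; y \<in> carrier H; powers H x = powers H y\<rbrakk> \<Longrightarrow> f x = f y"
    and "\<And>x g. \<lbrakk>x \<in> carrier H; g \<in> carrier H\<rbrakk> \<Longrightarrow> f (inv g \<otimes> x \<otimes> g) = f x"
    and "\<And>x. \<lbrakk>x \<in> carrier H; ord x > k\<rbrakk> \<Longrightarrow> f x = 0"
  shows "virtual_char H (\<lambda>h. of_nat (card (carrier H) ^ k) * of_int (f h) :: rat)"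
  using assms
proof (induction k arbitrary: f)
  case 0
  have "f x = 0" if "x \<in> carrier H" for x
    using 0(3)[OF that] ord_ge_1[OF finite_carrier that] by simp
  then show ?case by (intro virtual_char_cong[OF virtual_char_zero]) simp
next
  case (Suc k)
  define S where "S = {powers H c | c. c \<in> carrier H \<and> ord c = Suc k}"
  have "S \<subseteq> powers H ` carrier H" by (auto simp: S_def)
  then have finS: "finite S" using finite_carrier finite_surj by blast
  \<comment> \<open>\<open>f\<close> is constant on the generators of a cyclic subgroup, so any
    generator may represent it.\<close>
  define val where "val C = f (SOME c. c \<in> carrier H \<and> powers H c = C)" for C
  have val: "val (powers H c) = f c" if c: "c \<in> carrier H" for c
  proof -
    have "(SOME d. d \<in> carrier H \<and> powers H d = powers H c) \<in> carrier H \<and>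
        powers H (SOME d. d \<in> carrier H \<and> powers H d = powers H c) = powers H c"
      by (rule someI[of "\<lambda>d. d \<in> carrier H \<and> powers H d = powers H c" c]) (simp add: c)
    then show ?thesis unfolding val_def using Suc.prems(1) c by blast
  qed
  \<comment> \<open>At elements of order \<open>Suc k\<close> this combination of induced characters
    equals \<open>card (carrier H) * f\<close>, and it vanishes at larger orders.\<close>
  define u where "u h = (\<Sum>C\<in>S. val C * int (card {x \<in> carrier H. inv x \<otimes> h \<otimes> x \<in> C}))" for h
  have u: "virtual_char H (\<lambda>h. of_int (u h) :: rat)"
  proof -
    have "virtual_char H (\<lambda>h. of_int (val C) * of_nat (card {x \<in> carrier H. inv x \<otimes> h \<otimes> x \<in> C}) :: rat)"
      if "C \<in> S" for C
    proof -
      have "subgroup C H" using that powers_subgroup by (auto simp: S_def)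
      then show ?thesis by (intro virtual_char_of_int induced_trivial_char)
    qed
    from virtual_char_sum[OF this] show ?thesis by (simp add: u_def)
  qed
  \<comment> \<open>Each order that is cleared costs a factor \<open>card (carrier H)\<close>, which
    explains the exponent \<open>k\<close>.\<close>
  define f' where "f' h = int (card (carrier H)) * f h - u h" for h
  have u_conj: "u (inv g \<otimes> x \<otimes> g) = u x" if "x \<in> carrier H" "g \<in> carrier H" for x g
    using virtual_char_conjugate[OF u, of "inv g" x] that by simp
  have u_cyc: "u x = u y" if xy: "x \<in> carrier H" "y \<in> carrier H" "powers H x = powers H y" for x y
  proof -
    have "x \<in> powers H y" "y \<in> powers H x"
      using xy(3) self_in_powers[OF is_group xy(1)] self_in_powers[OF is_group xy(2)] by simp_all
    then obtain k l :: nat where kl: "x = y [^] k" "y = x [^] l" unfolding powers_def by blast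
    show ?thesis using virtual_char_same_cyclic[OF u xy(2) kl] by simp
  qed
  \<comment> \<open>An element of order at least \<open>Suc k\<close> inside a cyclic group of order
    \<open>Suc k\<close> generates it.\<close>
  have conj_pow: "powers H (inv x \<otimes> h \<otimes> x) = C"
    if hx: "h \<in> carrier H" "x \<in> carrier H" "C \<in> S" "inv x \<otimes> h \<otimes> x \<in> C" "ord h \<ge> Suc k" for h x C
  proof (rule card_subset_eq)
    obtain c where c: "c \<in> carrier H" "ord c = Suc k" "C = powers H c" using hx(3) by (auto simp: S_def)
    then have sub: "subgroup C H" using powers_subgroup by simp
    show "finite C" using subgroup.subset[OF sub] finite_carrier finite_subset by blast
    show incl: "powers H (inv x \<otimes> h \<otimes> x) \<subseteq> C" by (rule powers_subset[OF sub hx(4)])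
    have "card (powers H (inv x \<otimes> h \<otimes> x)) = ord h" using hx by (simp add: card_powers ord_conj)
    moreover have "card C = Suc k" using c by (simp add: card_powers)
    ultimately show "card (powers H (inv x \<otimes> h \<otimes> x)) = card C"
      using card_mono[OF \<open>finite C\<close> incl] hx(5) by simp
  qed
  have vanish: "f' x = 0" if x: "x \<in> carrier H" "ord x > k" for x
  proof (cases "ord x = Suc k")
    case True
    have "u x = (\<Sum>C\<in>S. \<Sum>y\<in>carrier H. if inv y \<otimes> x \<otimes> y \<in> C then val C else 0)"
      unfolding u_def using finite_carrier by (intro sum.cong refl) (simp add: sum.If_cases Int_def mult.commute)
    also have "\<dots> = (\<Sum>y\<in>carrier H. \<Sum>C\<in>S. if inv y \<otimes> x \<otimes> y \<in> C then val C else 0)" by (rule sum.swap)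
    also have "\<dots> = (\<Sum>y\<in>carrier H. f x)"
    proof (intro sum.cong refl)
      fix y assume y: "y \<in> carrier H"
      let ?z = "inv y \<otimes> x \<otimes> y"
      have z: "?z \<in> carrier H" "ord ?z = Suc k" using x y True by (simp_all add: ord_conj)
      \<comment> \<open>Each conjugate of \<open>x\<close> lies in exactly one member of
        \<open>S\<close>, the subgroup it generates.\<close>
      have "?z \<in> C \<longleftrightarrow> C = powers H ?z" if "C \<in> S" for C
        using conj_pow[OF x(1) y that] True self_in_powers[OF is_group z(1)] by auto
      then have "(\<Sum>C\<in>S. if ?z \<in> C then val C else 0) = (\<Sum>C\<in>S. if C = powers H ?z then val C else 0)"
        by (intro sum.cong refl) auto
      also have "\<dots> = val (powers H ?z)" using finS z by (simp add: sum.delta) (auto simp: S_def)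
      also have "\<dots> = f x" using val[OF z(1)] Suc.prems(2)[OF x(1) y] by simp
      finally show "(\<Sum>C\<in>S. if ?z \<in> C then val C else 0) = f x" .
    qed
    finally show ?thesis by (simp add: f'_def)
  next
    case False
    have empty: "{y \<in> carrier H. inv y \<otimes> x \<otimes> y \<in> C} = {}" if C: "C \<in> S" for C
    proof -
      have "ord x = Suc k" if y: "y \<in> carrier H" "inv y \<otimes> x \<otimes> y \<in> C" for y
      proof -
        have "powers H (inv y \<otimes> x \<otimes> y) = C" using conj_pow[OF x(1) y(1) C y(2)] x(2) by simp
        moreover obtain c where "c \<in> carrier H" "ord c = Suc k" "C = powers H c" using C by (auto simp: S_def)
        moreover have "inv y \<otimes> x \<otimes> y \<in> carrier H" using x y by simp
        ultimately show ?thesis using card_powers ord_conj[OF y(1) x(1)] by metis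
      qed
      with False show ?thesis by blast
    qed
    have "u x = 0"
      unfolding u_def by (intro sum.neutral ballI) (simp only: empty card.empty of_nat_0 mult_zero_right)
    then show ?thesis using Suc.prems(3)[OF x(1)] x(2) False by (simp add: f'_def)
  qed
  have "virtual_char H (\<lambda>h. of_nat (card (carrier H) ^ k) * of_int (f' h) :: rat)"
  proof (rule Suc.IH)
    fix x y assume xy: "x \<in> carrier H" "y \<in> carrier H" "powers H x = powers H y"
    show "f' x = f' y" unfolding f'_def Suc.prems(1)[OF xy] u_cyc[OF xy] ..
  next
    fix x g assume xg: "x \<in> carrier H" "g \<in> carrier H"
    show "f' (inv g \<otimes> x \<otimes> g) = f' x" unfolding f'_def Suc.prems(2)[OF xg] u_conj[OF xg] ..
  qed (rule vanish)
  from virtual_char_add[OF this virtual_char_of_nat[OF u, of "card (carrier H) ^ k"]]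
  show ?case by (rule virtual_char_cong) (simp add: f'_def algebra_simps)
qed

text \<open>No element has order above the order of the group, so
  \<open>k = card (carrier H)\<close> makes the vanishing condition empty.\<close>

lemma artin:
  fixes f :: "'a \<Rightarrow> int"
  assumes "\<And>x y. \<lbrakk>x \<in> carrier H; y \<in> carrier H; powers H x = powers H y\<rbrakk> \<Longrightarrow> f x = f y"
    and "\<And>x g. \<lbrakk>x \<in> carrier H; g \<in> carrier H\<rbrakk> \<Longrightarrow> f (inv g \<otimes> x \<otimes> g) = f x"
  shows "virtual_char H (\<lambda>h. of_nat (card (carrier H) ^ card (carrier H)) * of_int (f h) :: rat)"
  using assms by (rule artin_bounded_order) (use ord_le_card in force)+

text \<open>Pairing \<open>f\<close> with Artin's multiple of the indicator of the generators gives
  an integer. Since \<open>f\<close> is constant on the generators, this integer is their number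
  times \<open>n ^ n * f g\<close>, where \<open>n\<close> is the order of the group.\<close>

lemma generator_char_denominator:
  fixes f :: "'a \<Rightarrow> rat"
  assumes f: "virtual_char H f" and g: "g \<in> carrier H" "powers H g = carrier H"
  shows "of_nat (card (carrier H) ^ card (carrier H) * fact (card (carrier H))) * f g \<in> \<int>"
proof -
  let ?n = "card (carrier H)"
  let ?G = "{h \<in> carrier H. ord h = ?n}"
  have "virtual_char H (\<lambda>h. of_nat (?n ^ ?n) * of_int (if ord h = ?n then 1 else 0) :: rat)"
  proof (rule artin)
    show "(if ord x = ?n then 1 else 0) = (if ord y = ?n then 1 else 0 :: int)"
      if "x \<in> carrier H" "y \<in> carrier H" "powers H x = powers H y" for x y
      using card_powers[OF that(1)] card_powers[OF that(2)] that(3) by simp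
  qed (simp add: ord_conj)
  then obtain m where m: "(\<Sum>h\<in>carrier H. f h * (of_nat (?n ^ ?n) * of_int (if ord (inv h) = ?n then 1 else 0))) = of_int (int ?n * m)"
    using virtual_char_pairing[OF f] by blast
  have gen: "f h = f g" if "h \<in> ?G" for h
  proof -
    have h: "h \<in> carrier H" "card (powers H h) = ?n" using that card_powers by auto
    then have "powers H h = carrier H" using card_subset_eq[OF finite_carrier powers_subset[OF subgroup_self]] by blast
    with h g have "h \<in> powers H g" "g \<in> powers H h" by auto
    then obtain k l :: nat where "h = g [^] k" "g = h [^] l" unfolding powers_def by blast
    then show ?thesis by (rule virtual_char_same_cyclic[OF f g(1)])
  qed
  have "(\<Sum>h\<in>carrier H. f h * (of_nat (?n ^ ?n) * of_int (if ord (inv h) = ?n then 1 else 0)))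
      = (\<Sum>h\<in>carrier H. if ord h = ?n then f h * of_nat (?n ^ ?n) else 0)"
    by (intro sum.cong refl) simp
  also have "\<dots> = (\<Sum>h\<in>?G. f h * of_nat (?n ^ ?n))"
    using finite_carrier by (simp add: sum.If_cases Int_def)
  also have "\<dots> = (\<Sum>h\<in>?G. f g * of_nat (?n ^ ?n))"
    by (rule sum.cong[OF refl]) (simp only: gen)
  also have "\<dots> = of_nat (card ?G) * (of_nat (?n ^ ?n) * f g)" by simp
  finally have 1: "of_nat (card ?G) * (of_nat (?n ^ ?n) * f g) \<in> \<int>" using m by (metis Ints_of_int)
  have "card ?G \<le> ?n" using finite_carrier by (intro card_mono) auto
  moreover have "g \<in> ?G" using g card_powers by force
  then have "card ?G > 0" using finite_carrier by (intro card_gt_0_iff[THEN iffD2]) auto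
  \<comment> \<open>Every positive number up to \<open>n\<close> divides \<open>fact n\<close>,
    which gives a bound depending on \<open>n\<close> only.\<close>
  ultimately have "card ?G dvd (fact ?n :: nat)" by (intro dvd_fact) auto
  then obtain r where r: "(fact ?n :: nat) = card ?G * r" by blast
  have eq: "of_nat (?n ^ ?n * fact ?n) * f g = of_nat r * (of_nat (card ?G) * (of_nat (?n ^ ?n) * f g))"
    unfolding r by (simp add: mult_ac)
  show ?thesis unfolding eq by (rule Ints_mult[OF Ints_of_nat 1])
qed

end

section \<open>Full lattices in \<open>\<rat>\<^sup>n\<close>\<close>

definition lattice_comb :: "(nat \<Rightarrow> nat \<Rightarrow> rat) \<Rightarrow> nat \<Rightarrow> (nat \<Rightarrow> int) \<Rightarrow> nat \<Rightarrow> rat" where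
  "lattice_comb b n c j = (\<Sum>i<n. of_int (c i) * b i j)"

text \<open>A triangular basis: among the members of \<open>A\<close> that vanish after coordinate
  \<open>i\<close>, \<open>b i\<close> has the least positive entry at \<open>i\<close>. The
  multiples of unit vectors make such members exist, and the common denominator \<open>D\<close>
  makes a least entry exist.\<close>

lemma lattice_free:
  fixes A :: "(nat \<Rightarrow> rat) set"
  assumes supp: "\<And>a i. a \<in> A \<Longrightarrow> n \<le> i \<Longrightarrow> a i = 0"
    and diff: "\<And>a b. a \<in> A \<Longrightarrow> b \<in> A \<Longrightarrow> (\<lambda>i. a i - b i) \<in> A"
    and N: "N > 0" "\<And>i. i < n \<Longrightarrow> (\<lambda>j. if j = i then of_nat N else 0) \<in> A"
    and D: "D > 0" "\<And>a i. a \<in> A \<Longrightarrow> of_nat D * a i \<in> \<int>" and zero: "(\<lambda>_. 0) \<in> A"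
  obtains b where "bij_betw (\<lambda>x :: nat \<Rightarrow>\<^sub>0 int. lattice_comb b n (Poly_Mapping.lookup x))
    (carrier (free_Abelian_group {..<n})) A"
proof -
  have neg: "(\<lambda>i. - a i) \<in> A" if "a \<in> A" for a using diff[OF zero that] by simp
  have add: "(\<lambda>i. a i + b i) \<in> A" if "a \<in> A" "b \<in> A" for a b using diff[OF that(1) neg[OF that(2)]] by simp
  have nat_mult: "(\<lambda>i. of_nat k * a i) \<in> A" if "a \<in> A" for k :: nat and a
    by (induction k) (use zero add[OF that] in \<open>simp_all add: distrib_right\<close>)
  have int_mult: "(\<lambda>i. of_int k * a i) \<in> A" if "a \<in> A" for k :: int and a
  proof (cases k)
    case (nonneg m)
    then show ?thesis using nat_mult[OF that, of m] by simp
  next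
    case (neg m)
    then show ?thesis using \<open>\<And>a. a \<in> A \<Longrightarrow> (\<lambda>i. - a i) \<in> A\<close>[OF nat_mult[OF that, of "Suc m"]]
      by (simp only: of_int_minus of_int_of_nat_eq mult_minus_left)
  qed
  \<comment> \<open>Multiplying by \<open>D\<close> turns positive leading entries into natural
    numbers, so that a least one can be taken.\<close>
  define lead where "lead i d \<longleftrightarrow> d > 0 \<and> (\<exists>a\<in>A. (\<forall>j>i. a j = 0) \<and> of_nat D * a i = of_nat d)" for i d :: nat
  have "\<exists>a\<in>A. (\<forall>j>i. a j = 0) \<and> a i > 0 \<and> (\<forall>x\<in>A. (\<forall>j>i. x j = 0) \<longrightarrow> (\<exists>m. x i = of_int m * a i))"
    if i: "i < n" for i
  proof -
    have "lead i (D * N)" unfolding lead_def using N(2)[OF i] N(1) D(1)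
      by (intro conjI bexI[of _ "\<lambda>j. if j = i then of_nat N else 0"]) auto
    define d where "d = (LEAST d. lead i d)"
    have "lead i d" unfolding d_def using \<open>lead i (D * N)\<close> by (rule LeastI)
    then obtain a where a: "a \<in> A" "\<And>j. j > i \<Longrightarrow> a j = 0" "of_nat D * a i = of_nat d" and "d > 0"
      unfolding lead_def by blast
    have "\<exists>m. x i = of_int m * a i" if x: "x \<in> A" "\<And>j. j > i \<Longrightarrow> x j = 0" for x
    proof -
      obtain q where q: "of_nat D * x i = of_int q" using D(2)[OF x(1)] by (metis Ints_cases)
      \<comment> \<open>Division with remainder: a nonzero remainder would be a smaller leading
        entry.\<close>
      let ?m = "q div int d"
      let ?y = "\<lambda>j. x j - of_int ?m * a j"
      have y: "?y \<in> A" by (rule diff[OF x(1) int_mult[OF a(1)]])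
      have "q - ?m * int d = q mod int d" using minus_div_mult_eq_mod[of q "int d"] by simp
      then have "of_nat D * ?y i = of_int (q mod int d)"
        using q a(3) by (simp add: right_diff_distrib mult.left_commute[of _ "of_int _"] flip: of_int_mult of_int_diff)
          (metis of_int_diff of_int_mult of_int_of_nat_eq)
      also have "\<dots> = of_nat (nat (q mod int d))" using \<open>d > 0\<close> by simp
      finally have "of_nat D * ?y i = of_nat (nat (q mod int d))" .
      then have "lead i (nat (q mod int d))" if "nat (q mod int d) > 0"
        unfolding lead_def using y that x(2) a(2) by (intro conjI bexI[of _ ?y]) auto
      moreover have "nat (q mod int d) < d" using \<open>d > 0\<close> by (simp add: nat_less_iff)
      then have "\<not> lead i (nat (q mod int d))" unfolding d_def by (rule not_less_Least)
      ultimately have "nat (q mod int d) = 0" by blast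
      then have "of_nat D * ?y i = 0" using \<open>of_nat D * ?y i = of_nat (nat (q mod int d))\<close> by simp
      then show ?thesis using D(1) by auto
    qed
    moreover have "a i > 0" using a(3) \<open>d > 0\<close> D(1) by (metis of_nat_0_less_iff zero_less_mult_pos)
    ultimately show ?thesis using a by blast
  qed
  then have "\<forall>i. \<exists>a. i < n \<longrightarrow> a \<in> A \<and> (\<forall>j>i. a j = 0) \<and> a i > 0 \<and> (\<forall>x\<in>A. (\<forall>j>i. x j = 0) \<longrightarrow> (\<exists>m. x i = of_int m * a i))"
    by blast
  from choice[OF this] obtain b where b: "\<And>i. i < n \<Longrightarrow> b i \<in> A" "\<And>i j. i < n \<Longrightarrow> i < j \<Longrightarrow> b i j = 0" "\<And>i. i < n \<Longrightarrow> b i i > 0"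
    "\<And>i x. i < n \<Longrightarrow> x \<in> A \<Longrightarrow> (\<forall>j>i. x j = 0) \<Longrightarrow> \<exists>m. x i = of_int m * b i i" by blast
  have comb_Suc: "lattice_comb b (Suc k) c = (\<lambda>j. lattice_comb b k c j + of_int (c k) * b k j)" for k c
    by (rule ext) (simp add: lattice_comb_def)
  have comb_in: "lattice_comb b k c \<in> A" if "k \<le> n" for k c
    using that
  proof (induction k)
    case 0
    have "lattice_comb b 0 c = (\<lambda>_. 0)" by (rule ext) (simp add: lattice_comb_def)
    then show ?case using zero by simp
  next
    case (Suc k)
    then have "lattice_comb b k c \<in> A" "b k \<in> A" using b(1) by auto
    then show ?case unfolding comb_Suc by (intro add int_mult)
  qed
  have comb_upper: "lattice_comb b k c j = 0" if "k \<le> n" "k \<le> j" for k c j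
    unfolding lattice_comb_def by (rule sum.neutral) (use that b(2) in auto)
  \<comment> \<open>By triangularity the last coefficient is read off at the last
    coordinate.\<close>
  have indep: "c i = 0" if "\<And>j. lattice_comb b k c j = 0" "k \<le> n" "i < k" for k c i
    using that
  proof (induction k)
    case (Suc k)
    have "lattice_comb b (Suc k) c k = of_int (c k) * b k k" using comb_upper[of k k c] Suc.prems(2) by (simp add: comb_Suc)
    then have "c k = 0" using Suc.prems b(3)[of k] by auto
    moreover have "lattice_comb b k c j = 0" for j using Suc.prems(1)[of j] \<open>c k = 0\<close> by (simp add: comb_Suc)
    ultimately show ?case using Suc by (cases "i = k") auto
  qed simp
  \<comment> \<open>The last coordinate is cleared by an integer multiple of \<open>b k\<close>, and
    what is left has shorter support.\<close>
  have spans: "\<exists>c. a = lattice_comb b k c" if "k \<le> n" "a \<in> A" "\<And>j. k \<le> j \<Longrightarrow> a j = 0" for k a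
    using that
  proof (induction k arbitrary: a)
    case 0
    then have "a = lattice_comb b 0 c" for c by (intro ext) (simp add: lattice_comb_def)
    then show ?case by blast
  next
    case (Suc k)
    then obtain m where m: "a k = of_int m * b k k" using b(4)[of k a] by (auto simp: Suc_le_eq)
    let ?a = "\<lambda>j. a j - of_int m * b k j"
    have "?a \<in> A" using Suc.prems b(1)[of k] by (intro diff int_mult) auto
    moreover have "?a j = 0" if "k \<le> j" for j
      using that Suc.prems(1,3) m b(2)[of k j] by (cases "j = k") auto
    ultimately obtain c where c: "?a = lattice_comb b k c" using Suc.IH[of ?a] Suc.prems(1) by auto
    have "a = lattice_comb b (Suc k) (c(k := m))"
    proof
      fix j
      have "lattice_comb b k (c(k := m)) j = lattice_comb b k c j" by (simp add: lattice_comb_def)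
      then show "a j = lattice_comb b (Suc k) (c(k := m)) j" using fun_cong[OF c, of j] by (simp add: comb_Suc)
    qed
    then show ?case by blast
  qed
  have "bij_betw (\<lambda>x :: nat \<Rightarrow>\<^sub>0 int. lattice_comb b n (Poly_Mapping.lookup x)) (carrier (free_Abelian_group {..<n})) A"
    unfolding bij_betw_def
  proof
    show "inj_on (\<lambda>x :: nat \<Rightarrow>\<^sub>0 int. lattice_comb b n (Poly_Mapping.lookup x)) (carrier (free_Abelian_group {..<n}))"
    proof (rule inj_onI)
      fix x y :: "nat \<Rightarrow>\<^sub>0 int"
      assume xy: "x \<in> carrier (free_Abelian_group {..<n})" "y \<in> carrier (free_Abelian_group {..<n})"
        "lattice_comb b n (Poly_Mapping.lookup x) = lattice_comb b n (Poly_Mapping.lookup y)"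
      let ?c = "\<lambda>i. Poly_Mapping.lookup x i - Poly_Mapping.lookup y i"
      have "lattice_comb b n ?c j = 0" for j
        using fun_cong[OF xy(3), of j] by (simp add: lattice_comb_def left_diff_distrib sum_subtractf)
      then have "?c i = 0" if "i < n" for i using indep[of n ?c i] that by blast
      moreover have "?c i = 0" if "\<not> i < n" for i
        using that xy(1,2) by (simp add: subset_iff) (metis in_keys_iff diff_self)
      ultimately show "x = y" by (intro poly_mapping_eqI) (metis eq_iff_diff_eq_0)
    qed
    show "(\<lambda>x. lattice_comb b n (Poly_Mapping.lookup x)) ` carrier (free_Abelian_group {..<n}) = A"
    proof
      show "(\<lambda>x. lattice_comb b n (Poly_Mapping.lookup x)) ` carrier (free_Abelian_group {..<n}) \<subseteq> A"
        using comb_in by blast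
      show "A \<subseteq> (\<lambda>x. lattice_comb b n (Poly_Mapping.lookup x)) ` carrier (free_Abelian_group {..<n})"
      proof
        fix a assume "a \<in> A"
        then obtain c where c: "a = lattice_comb b n c" using spans[of n a] supp by auto
        define x :: "nat \<Rightarrow>\<^sub>0 int" where "x = (\<Sum>i<n. Poly_Mapping.single i (c i))"
        have x: "Poly_Mapping.lookup x i = (if i < n then c i else 0)" for i
          by (simp add: x_def lookup_sum lookup_single when_def)
        have "a = lattice_comb b n (Poly_Mapping.lookup x)" by (rule ext) (simp add: c lattice_comb_def x)
        moreover have "x \<in> carrier (free_Abelian_group {..<n})" by (auto simp: in_keys_iff x split: if_splits)
        ultimately show "a \<in> (\<lambda>x. lattice_comb b n (Poly_Mapping.lookup x)) ` carrier (free_Abelian_group {..<n})" by blast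
      qed
    qed
  qed
  then show thesis by (rule that)
qed

section \<open>The inverse limit\<close>

lemma (in group) conj_subgroup_image:
  "conj_subgroup G \<gamma> H = (\<lambda>h. \<gamma> \<otimes> (h \<otimes> inv \<gamma>)) ` H"
  by (auto simp: conj_subgroup_def l_coset_def r_coset_def)

lemma (in group) conj_subgroup_mult:
  assumes "C \<subseteq> carrier G" "\<gamma> \<in> carrier G" "\<delta> \<in> carrier G"
  shows "conj_subgroup G \<delta> (conj_subgroup G \<gamma> C) = conj_subgroup G (\<delta> \<otimes> \<gamma>) C"
  unfolding conj_subgroup_image image_image
proof (rule image_cong[OF refl])
  fix x assume "x \<in> C"
  then have "x \<in> carrier G" using assms by blast
  then show "\<delta> \<otimes> (\<gamma> \<otimes> (x \<otimes> inv \<gamma>) \<otimes> inv \<delta>) = \<delta> \<otimes> \<gamma> \<otimes> (x \<otimes> inv (\<delta> \<otimes> \<gamma>))"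
    using assms by (simp add: inv_mult_group m_assoc)
qed

lemma (in group) conj_subgroup_one: "C \<subseteq> carrier G \<Longrightarrow> conj_subgroup G \<one> C = C"
  unfolding conj_subgroup_image by (auto simp: subset_iff image_iff)

lemma (in group) self_in_conj_class: "C \<subseteq> carrier G \<Longrightarrow> C \<in> conj_class G C"
  unfolding conj_class_def using conj_subgroup_one one_closed by blast

lemma (in group) conj_class_conj:
  assumes "C \<subseteq> carrier G" "\<gamma> \<in> carrier G"
  shows "conj_class G (conj_subgroup G \<gamma> C) = conj_class G C"
proof
  show "conj_class G (conj_subgroup G \<gamma> C) \<subseteq> conj_class G C"
    unfolding conj_class_def using assms conj_subgroup_mult by (auto intro: m_closed)
  show "conj_class G C \<subseteq> conj_class G (conj_subgroup G \<gamma> C)"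
  proof
    fix D assume "D \<in> conj_class G C"
    then obtain \<delta> where \<delta>: "\<delta> \<in> carrier G" "D = conj_subgroup G \<delta> C" unfolding conj_class_def by blast
    have "D = conj_subgroup G (\<delta> \<otimes> inv \<gamma>) (conj_subgroup G \<gamma> C)"
      using conj_subgroup_mult[OF assms, of "\<delta> \<otimes> inv \<gamma>"] assms \<delta> by (simp add: m_assoc)
    then show "D \<in> conj_class G (conj_subgroup G \<gamma> C)"
      unfolding conj_class_def using assms \<delta> by blast
  qed
qed

lemma (in group) powers_conj:
  assumes "\<gamma> \<in> carrier G" "h \<in> carrier G"
  shows "powers G (\<gamma> \<otimes> h \<otimes> inv \<gamma>) = conj_subgroup G \<gamma> (powers G h)"
proof -
  have "(\<gamma> \<otimes> h \<otimes> inv \<gamma>) [^] k = \<gamma> \<otimes> (h [^] k \<otimes> inv \<gamma>)" for k :: nat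
    by (subst conj_nat_pow) (use assms in \<open>simp_all add: m_assoc\<close>)
  then show ?thesis by (simp only: powers_def conj_subgroup_image image_image)
qed

section \<open>Families of finite subgroups and their limit\<close>

locale finite_subgroup_family = group G for G :: "('a, 'c) monoid_scheme" (structure) +
  fixes F :: "'a set set"
  assumes family: "family_of_finite_subgroups G F"
    and finite_classes: "finite (conj_class G ` {H. subgroup H G \<and> finite H})"
begin

abbreviation sub :: "'a set \<Rightarrow> ('a, 'c) monoid_scheme" where
  "sub H \<equiv> G\<lparr>carrier := H\<rparr>"

lemma family_subgroup: "H \<in> F \<Longrightarrow> subgroup H G" "H \<in> F \<Longrightarrow> finite H" "H \<in> F \<Longrightarrow> H \<subseteq> carrier G"
  using family subgroup.subset unfolding family_of_finite_subgroups_def by blast+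

lemma family_conj: "H \<in> F \<Longrightarrow> \<gamma> \<in> carrier G \<Longrightarrow> conj_subgroup G \<gamma> H \<in> F"
  using family unfolding family_of_finite_subgroups_def by blast

lemma family_down: "H \<in> F \<Longrightarrow> subgroup L G \<Longrightarrow> L \<subseteq> H \<Longrightarrow> L \<in> F"
  using family unfolding family_of_finite_subgroups_def by blast

lemma sub_finite_group: "H \<in> F \<Longrightarrow> finite_group (sub H)"
  using family_subgroup subgroup_imp_group by (simp add: finite_group_def finite_group_axioms_def)

lemma powers_sub: "powers (sub H) x = powers G x"
  by (simp add: powers_def flip: nat_pow_consistent)

lemma powers_family:
  assumes "H \<in> F" "h \<in> H"
  shows "powers G h \<in> F" "powers G h \<subseteq> H"
proof -
  interpret H: finite_group "sub H" by (rule sub_finite_group[OF assms(1)])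
  have *: "subgroup (powers G h) (sub H)" using H.powers_subgroup[of h] assms(2) by (simp add: powers_sub)
  then show "powers G h \<subseteq> H" using subgroup.subset by fastforce
  moreover have "subgroup (powers G h) G" using incl_subgroup[OF family_subgroup(1)[OF assms(1)] *] .
  ultimately show "powers G h \<in> F" using family_down assms(1) by blast
qed

text \<open>In a finite group integer powers are natural powers.\<close>

lemma cyclic_iff_powers:
  assumes "H \<in> F"
  shows "cyclic_group (sub H) \<longleftrightarrow> (\<exists>g\<in>H. H = powers G g)"
proof -
  interpret H: finite_group "sub H" by (rule sub_finite_group[OF assms])
  have "range (\<lambda>n::int. x [^]\<^bsub>sub H\<^esub> n) = powers G x" if "x \<in> H" for x
    using H.generate_pow[of x] H.powers_eq_generate[of x] that by (auto simp: powers_sub)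
  then show ?thesis unfolding H.cyclic_group by simp
qed

lemma conj_hom:
  assumes "H \<in> F" "\<gamma> \<in> carrier G"
  shows "(\<lambda>h. \<gamma> \<otimes> h \<otimes> inv \<gamma>) \<in> hom (sub H) (sub (conj_subgroup G \<gamma> H))"
proof (rule homI)
  fix x assume "x \<in> carrier (sub H)"
  then have "x \<in> H" "x \<in> carrier G" using family_subgroup(3)[OF assms(1)] by auto
  then show "\<gamma> \<otimes> x \<otimes> inv \<gamma> \<in> carrier (sub (conj_subgroup G \<gamma> H))"
    using assms(2) by (auto simp: conj_subgroup_image m_assoc)
next
  fix x y assume "x \<in> carrier (sub H)" "y \<in> carrier (sub H)"
  then have xy: "x \<in> carrier G" "y \<in> carrier G" using family_subgroup(3)[OF assms(1)] by auto
  have "\<gamma> \<otimes> x \<otimes> inv \<gamma> \<otimes> (\<gamma> \<otimes> y \<otimes> inv \<gamma>) = \<gamma> \<otimes> x \<otimes> (inv \<gamma> \<otimes> \<gamma>) \<otimes> y \<otimes> inv \<gamma>"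
    using assms(2) xy by (simp only: m_assoc m_closed inv_closed)
  then show "\<gamma> \<otimes> (x \<otimes>\<^bsub>sub H\<^esub> y) \<otimes> inv \<gamma> = \<gamma> \<otimes> x \<otimes> inv \<gamma> \<otimes>\<^bsub>sub (conj_subgroup G \<gamma> H)\<^esub> (\<gamma> \<otimes> y \<otimes> inv \<gamma>)"
    using assms(2) xy by (simp add: m_assoc)
qed

lemma incl_hom: "H \<subseteq> K \<Longrightarrow> (\<lambda>h. h) \<in> hom (sub H) (sub K)"
  by (auto simp: hom_def)

text \<open>Conjugate subgroups have equal order and there are finitely many classes. The bound
  provides one multiple and one denominator for all members of the family.\<close>

lemma bounded_order: "\<exists>B. \<forall>H\<in>F. card H \<le> B"
proof -
  have "card K = card H" if "H \<in> F" "K \<in> conj_class G H" for H K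
  proof -
    obtain \<gamma> where \<gamma>: "\<gamma> \<in> carrier G" "K = (\<lambda>h. \<gamma> \<otimes> (h \<otimes> inv \<gamma>)) ` H"
      using \<open>K \<in> conj_class G H\<close> unfolding conj_class_def conj_subgroup_image by blast
    moreover have "inj_on (\<lambda>h. \<gamma> \<otimes> (h \<otimes> inv \<gamma>)) H"
    proof (rule inj_onI)
      fix x y assume xy: "x \<in> H" "y \<in> H" "\<gamma> \<otimes> (x \<otimes> inv \<gamma>) = \<gamma> \<otimes> (y \<otimes> inv \<gamma>)"
      then have "x \<in> carrier G" "y \<in> carrier G" using family_subgroup(3)[OF \<open>H \<in> F\<close>] by blast+
      then show "x = y" using xy(3) \<gamma>(1) by simp
    qed
    ultimately show ?thesis by (simp add: card_image)
  qed
  then have "card H = card (SOME K. K \<in> conj_class G H)" if "H \<in> F" for H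
    using someI[of "\<lambda>K. K \<in> conj_class G H" H] self_in_conj_class family_subgroup(3) that by metis
  then have "card ` F \<subseteq> (\<lambda>A. card (SOME K. K \<in> A)) ` conj_class G ` {H. subgroup H G \<and> finite H}"
    using family_subgroup by (auto simp: image_iff) (metis)
  then have "finite (card ` F)" using finite_classes finite_surj by blast
  then show ?thesis by (metis finite_nat_set_iff_bounded_le imageI)
qed

lemma groth_limit_iff:
  "x \<in> carrier (groth_limit TYPE('k::field) G F) \<longleftrightarrow>
    x \<in> (\<Pi>\<^sub>E H\<in>F. carrier (grothendieck_ring (sub H) :: ('a, 'k) groth ring)) \<and>
    (\<forall>H\<in>F. \<forall>K\<in>F. H \<subseteq> K \<longrightarrow> groth_pullback (sub H) (\<lambda>h. h) (x K) = x H) \<and>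
    (\<forall>H\<in>F. \<forall>\<gamma>\<in>carrier G.
      groth_pullback (sub H) (\<lambda>h. \<gamma> \<otimes> h \<otimes> inv \<gamma>) (x (conj_subgroup G \<gamma> H)) = x H)"
proof -
  have "(\<forall>H\<in>F. \<forall>K\<in>F. \<forall>\<gamma>\<in>carrier G. K = conj_subgroup G \<gamma> H \<longrightarrow> P H K \<gamma>) \<longleftrightarrow>
      (\<forall>H\<in>F. \<forall>\<gamma>\<in>carrier G. P H (conj_subgroup G \<gamma> H) \<gamma>)" for P
    using family_conj by blast
  then show ?thesis by (simp only: groth_limit_def Let_def partial_object.simps mem_Collect_eq)
qed

text \<open>The isomorphism evaluates the characters of a compatible family at one generator
  \<open>g i\<close> per class of cyclic subgroups. Its image \<open>A\<close> satisfies the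
  conditions of \<open>lattice_free\<close>.\<close>

theorem groth_limit_free:
  "free_abelian_of_rank (add_monoid (groth_limit TYPE(rat) G F)) (num_cyclic_classes G F)"
proof -
  let ?L = "groth_limit TYPE(rat) G F"
  let ?cyc = "{H \<in> F. cyclic_group (sub H)}"
  define n where "n = num_cyclic_classes G F"
  have "conj_class G ` ?cyc \<subseteq> conj_class G ` {H. subgroup H G \<and> finite H}" using family_subgroup by blast
  then have "finite (conj_class G ` ?cyc)" using finite_classes finite_subset by blast
  from ex_bij_betw_nat_finite[OF this] obtain e where e: "bij_betw e {..<n} (conj_class G ` ?cyc)"
    by (auto simp: n_def num_cyclic_classes_def atLeast0LessThan)
  \<comment> \<open>The number of the class of the cyclic subgroup generated by \<open>h\<close>; it
    is the same for conjugate elements and for all generators of one cyclic subgroup.\<close>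
  define idx where "idx h = inv_into {..<n} e (conj_class G (powers G h))" for h
  have idx: "idx h < n" "e (idx h) = conj_class G (powers G h)" if "H \<in> F" "h \<in> H" for H h
  proof -
    have "h \<in> carrier G" using family_subgroup(3)[OF that(1)] that(2) by blast
    then have "powers G h \<in> ?cyc"
      using powers_family(1)[OF that] cyclic_iff_powers self_in_powers[OF is_group] by blast
    then have "conj_class G (powers G h) \<in> e ` {..<n}" using e by (simp add: bij_betw_def)
    then show "idx h < n" "e (idx h) = conj_class G (powers G h)"
      unfolding idx_def using inv_into_into f_inv_into_f by (metis lessThan_iff, metis)
  qed
  have idx_eqI: "idx h = i" if "conj_class G (powers G h) = e i" "i < n" for h i
    unfolding idx_def that(1) using e that(2) by (simp add: bij_betw_def inv_into_f_f)
  have idx_conj: "idx (\<gamma> \<otimes> h \<otimes> inv \<gamma>) = idx h" if "\<gamma> \<in> carrier G" "H \<in> F" "h \<in> H" for \<gamma> H h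
  proof -
    have "h \<in> carrier G" using family_subgroup(3) that by blast
    moreover have "powers G h \<subseteq> carrier G" using powers_family(2) family_subgroup(3) that by blast
    ultimately show ?thesis using that(1) by (simp add: idx_def powers_conj conj_class_conj)
  qed
  have "\<forall>i. \<exists>g. i < n \<longrightarrow> powers G g \<in> F \<and> g \<in> powers G g \<and> conj_class G (powers G g) = e i"
  proof (intro allI)
    fix i
    show "\<exists>g. i < n \<longrightarrow> powers G g \<in> F \<and> g \<in> powers G g \<and> conj_class G (powers G g) = e i"
    proof (cases "i < n")
      case True
      then have "e i \<in> conj_class G ` ?cyc" using e by (auto simp: bij_betw_def)
      then obtain C where "C \<in> F" "cyclic_group (sub C)" "conj_class G C = e i" by auto
      then show ?thesis using cyclic_iff_powers by metis
    qed simp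
  qed
  from choice[OF this] obtain g where
    g: "\<And>i. i < n \<Longrightarrow> powers G (g i) \<in> F" "\<And>i. i < n \<Longrightarrow> g i \<in> powers G (g i)"
      "\<And>i. i < n \<Longrightarrow> conj_class G (powers G (g i)) = e i" by blast
  let ?char = "\<lambda>x H. groth_char (sub H) (x H) :: 'a \<Rightarrow> rat"
  define \<Psi> where "\<Psi> x i = (if i < n then ?char x (powers G (g i)) (g i) else 0)" for x i
  \<comment> \<open>Factoring through \<open>idx\<close> encodes compatibility with restriction and
    conjugation, so being a virtual character on each member is the only condition left.\<close>
  define A where "A = {a. (\<forall>i\<ge>n. a i = 0) \<and> (\<forall>H\<in>F. virtual_char (sub H) (\<lambda>h. a (idx h) :: rat))}"
  have L_in: "x H \<in> carrier (grothendieck_ring (sub H))" if "x \<in> carrier ?L" "H \<in> F" for x H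
    using that unfolding groth_limit_iff by (auto dest: PiE_mem)
  have char_res: "?char x H h = ?char x K h" if "x \<in> carrier ?L" "H \<in> F" "K \<in> F" "H \<subseteq> K" "h \<in> H" for x H K h
  proof -
    interpret H: finite_group "sub H" by (rule sub_finite_group[OF that(2)])
    have "x H = groth_pullback (sub H) (\<lambda>h. h) (x K)" using that(1-4) unfolding groth_limit_iff by auto
    then show ?thesis
      using H.groth_pullback(2)[OF sub_finite_group[OF that(3)] incl_hom[OF that(4)] L_in[OF that(1,3)]] that(5) by simp
  qed
  have char_conj: "?char x H h = ?char x (conj_subgroup G \<gamma> H) (\<gamma> \<otimes> h \<otimes> inv \<gamma>)"
    if "x \<in> carrier ?L" "H \<in> F" "\<gamma> \<in> carrier G" "h \<in> H" for x H \<gamma> h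
  proof -
    interpret H: finite_group "sub H" by (rule sub_finite_group[OF that(2)])
    let ?K = "conj_subgroup G \<gamma> H"
    have K: "?K \<in> F" by (rule family_conj[OF that(2,3)])
    have "x H = groth_pullback (sub H) (\<lambda>h. \<gamma> \<otimes> h \<otimes> inv \<gamma>) (x ?K)" using that(1-3) unfolding groth_limit_iff by auto
    then show ?thesis
      using H.groth_pullback(2)[OF sub_finite_group[OF K] conj_hom[OF that(2,3)] L_in[OF that(1) K]] that(4) by simp
  qed
  \<comment> \<open>Restriction moves the value to the cyclic subgroup of \<open>h\<close>,
    conjugation to the chosen subgroup of its class, and Galois invariance to the chosen
    generator.\<close>
  have char_\<Psi>: "?char x H h = \<Psi> x (idx h)" if x: "x \<in> carrier ?L" and H: "H \<in> F" "h \<in> H" for x H h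
  proof -
    let ?C = "powers G h" and ?i = "idx h"
    let ?D = "powers G (g ?i)"
    have h: "h \<in> carrier G" "h \<in> ?C" using family_subgroup(3)[OF H(1)] H(2) self_in_powers[OF is_group] by blast+
    have C: "?C \<in> F" "?C \<subseteq> H" by (rule powers_family[OF H])+
    have i: "?i < n" "conj_class G ?D = conj_class G ?C" using idx[OF H] g(3)[of ?i] by auto
    have D: "?D \<in> F" "g ?i \<in> ?D" using g i(1) by blast+
    have "?D \<in> conj_class G ?C" using self_in_conj_class[OF family_subgroup(3)[OF D(1)]] i(2) by simp
    then obtain \<gamma> where \<gamma>: "\<gamma> \<in> carrier G" "?D = conj_subgroup G \<gamma> ?C" unfolding conj_class_def by blast
    interpret D: finite_group "sub ?D" by (rule sub_finite_group[OF D(1)])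
    let ?y = "\<gamma> \<otimes> h \<otimes> inv \<gamma>"
    have "?D = powers G ?y" using \<gamma> h by (simp add: powers_conj)
    moreover have "?y \<in> powers G ?y" using self_in_powers[OF is_group] \<gamma>(1) h(1) by simp
    ultimately obtain k l :: nat where "?y = g ?i [^] k" "g ?i = ?y [^] l" using D(2) unfolding powers_def by blast
    then have kl: "?y = g ?i [^]\<^bsub>sub ?D\<^esub> k" "g ?i = ?y [^]\<^bsub>sub ?D\<^esub> l" by (simp_all flip: nat_pow_consistent)
    have "?char x H h = ?char x ?C h" using char_res[OF x C(1) H(1) C(2) h(2)] by simp
    also have "\<dots> = ?char x ?D ?y" using char_conj[OF x C(1) \<gamma>(1) h(2)] \<gamma>(2) by simp
    also have "\<dots> = ?char x ?D (g ?i)"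
      using D.virtual_char_same_cyclic[OF D.virtual_char_groth_char[OF L_in[OF x D(1)]] _ kl] D(2) by simp
    finally show ?thesis using i(1) by (simp add: \<Psi>_def)
  qed
  have \<Psi>_in: "\<Psi> x \<in> A" if x: "x \<in> carrier ?L" for x
  proof -
    have "virtual_char (sub H) (\<lambda>h. \<Psi> x (idx h))" if H: "H \<in> F" for H
    proof -
      interpret H: finite_group "sub H" by (rule sub_finite_group[OF H])
      show ?thesis
        by (rule virtual_char_cong[OF H.virtual_char_groth_char[OF L_in[OF x H]]]) (use char_\<Psi>[OF x H] in simp)
    qed
    then show ?thesis by (simp add: A_def \<Psi>_def)
  qed
  have \<Psi>_add: "\<Psi> (x \<oplus>\<^bsub>?L\<^esub> y) = (\<lambda>i. \<Psi> x i + \<Psi> y i)" if xy: "x \<in> carrier ?L" "y \<in> carrier ?L" for x y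
  proof
    fix i
    show "\<Psi> (x \<oplus>\<^bsub>?L\<^esub> y) i = \<Psi> x i + \<Psi> y i"
    proof (cases "i < n")
      case True
      let ?D = "powers G (g i)"
      have D: "?D \<in> F" "g i \<in> ?D" using g True by blast+
      interpret D: finite_group "sub ?D" by (rule sub_finite_group[OF D(1)])
      have "(x \<oplus>\<^bsub>?L\<^esub> y) ?D = x ?D \<oplus>\<^bsub>grothendieck_ring (sub ?D)\<^esub> y ?D"
        using D(1) by (simp add: groth_limit_def Let_def)
      then show ?thesis
        using True D(2) D.groth_add(2)[OF L_in[OF xy(1) D(1)] L_in[OF xy(2) D(1)]] by (simp add: \<Psi>_def)
    qed (simp add: \<Psi>_def)
  qed
  have \<Psi>_inj: "inj_on \<Psi> (carrier ?L)"
  proof (rule inj_onI)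
    fix x y assume xy: "x \<in> carrier ?L" "y \<in> carrier ?L" "\<Psi> x = \<Psi> y"
    have eq: "x H = y H" if H: "H \<in> F" for H
    proof -
      interpret H: finite_group "sub H" by (rule sub_finite_group[OF H])
      show ?thesis
        by (rule H.groth_char_inject[OF L_in[OF xy(1) H] L_in[OF xy(2) H]])
          (use char_\<Psi>[OF xy(1) H] char_\<Psi>[OF xy(2) H] xy(3) in simp)
    qed
    from xy(1,2)[unfolded groth_limit_iff, THEN conjunct1] eq show "x = y" by (rule PiE_ext)
  qed
  \<comment> \<open>On each member an element with the prescribed character is chosen; the choices
    are compatible because characters separate elements and \<open>idx\<close> is invariant under
    conjugation.\<close>
  have \<Psi>_surj: "\<exists>x\<in>carrier ?L. \<Psi> x = a" if a: "a \<in> A" for a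
  proof -
    have "\<exists>Y\<in>carrier (grothendieck_ring (sub H)). \<forall>h\<in>H. groth_char (sub H) Y h = a (idx h)" if H: "H \<in> F" for H
    proof -
      interpret H: finite_group "sub H" by (rule sub_finite_group[OF H])
      have "virtual_char (sub H) (\<lambda>h. a (idx h))" using a H by (simp add: A_def)
      from H.virtual_char_realised[OF this] show ?thesis by simp
    qed
    then obtain Y where Y: "\<And>H. H \<in> F \<Longrightarrow> Y H \<in> carrier (grothendieck_ring (sub H))"
      "\<And>H h. H \<in> F \<Longrightarrow> h \<in> H \<Longrightarrow> groth_char (sub H) (Y H) h = a (idx h)" by metis
    define x where "x = restrict Y F"
    have "x \<in> carrier ?L"
      unfolding groth_limit_iff
    proof (intro conjI ballI impI)
      show "x \<in> (\<Pi>\<^sub>E H\<in>F. carrier (grothendieck_ring (sub H)))" using Y(1) by (auto simp: x_def)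
    next
      fix H K assume HK: "H \<in> F" "K \<in> F" "H \<subseteq> K"
      interpret H: finite_group "sub H" by (rule sub_finite_group[OF HK(1)])
      note pull = H.groth_pullback[OF sub_finite_group[OF HK(2)] incl_hom[OF HK(3)] Y(1)[OF HK(2)]]
      have "groth_pullback (sub H) (\<lambda>h. h) (Y K) = Y H"
        by (rule H.groth_char_inject[OF pull(1) Y(1)[OF HK(1)]]) (use pull(2) Y(2) HK in auto)
      then show "groth_pullback (sub H) (\<lambda>h. h) (x K) = x H" using HK by (simp add: x_def)
    next
      fix H \<gamma> assume H: "H \<in> F" and \<gamma>: "\<gamma> \<in> carrier G"
      interpret H: finite_group "sub H" by (rule sub_finite_group[OF H])
      let ?K = "conj_subgroup G \<gamma> H"
      have K: "?K \<in> F" by (rule family_conj[OF H \<gamma>])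
      note pull = H.groth_pullback[OF sub_finite_group[OF K] conj_hom[OF H \<gamma>] Y(1)[OF K]]
      have "groth_pullback (sub H) (\<lambda>h. \<gamma> \<otimes> h \<otimes> inv \<gamma>) (Y ?K) = Y H"
      proof (rule H.groth_char_inject[OF pull(1) Y(1)[OF H]])
        fix h assume h: "h \<in> carrier (sub H)"
        have "\<gamma> \<otimes> h \<otimes> inv \<gamma> \<in> ?K" using hom_in_carrier[OF conj_hom[OF H \<gamma>] h] by simp
        then show "groth_char (sub H) (groth_pullback (sub H) (\<lambda>h. \<gamma> \<otimes> h \<otimes> inv \<gamma>) (Y ?K)) h = groth_char (sub H) (Y H) h"
          using pull(2)[OF h] Y(2)[OF K] Y(2)[OF H] idx_conj[OF \<gamma> H] h by simp
      qed
      then show "groth_pullback (sub H) (\<lambda>h. \<gamma> \<otimes> h \<otimes> inv \<gamma>) (x ?K) = x H" using H K by (simp add: x_def)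
    qed
    moreover have "\<Psi> x = a"
    proof
      fix i
      show "\<Psi> x i = a i"
      proof (cases "i < n")
        case True
        then have "\<Psi> x i = a (idx (g i))" using g Y(2) by (simp add: \<Psi>_def x_def)
        then show ?thesis using idx_eqI[OF g(3)[OF True] True] by simp
      next
        case False
        then show ?thesis using a by (simp add: \<Psi>_def A_def)
      qed
    qed
    ultimately show ?thesis by blast
  qed
  obtain B where B: "\<And>H. H \<in> F \<Longrightarrow> card H \<le> B" using bounded_order by blast
  \<comment> \<open>All orders up to \<open>B\<close> are covered at once; the factor at 0 is
    \<open>0 ^ 0 = 1\<close>, so \<open>N\<close> is positive.\<close>
  define N where "N = (\<Prod>k\<in>{..B}. k ^ k)"
  have N_pos: "N > 0" unfolding N_def by (rule prod_pos) (auto simp: zero_less_power_eq)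
  have N_dvd: "card H ^ card H dvd N" if "H \<in> F" for H
    unfolding N_def by (rule dvd_prodI[of _ _ "\<lambda>k. k ^ k"]) (use B[OF that] in auto)
  have "\<exists>b. bij_betw (\<lambda>x :: nat \<Rightarrow>\<^sub>0 int. lattice_comb b n (Poly_Mapping.lookup x)) (carrier (free_Abelian_group {..<n})) A"
  proof (rule lattice_free[of A n N "N * fact B"])
    show "a i = 0" if "a \<in> A" "n \<le> i" for a i using that by (simp add: A_def)
    show "(\<lambda>i. a i - b i) \<in> A" if "a \<in> A" "b \<in> A" for a b
      using that virtual_char_diff by (fastforce simp: A_def)
    show "(\<lambda>_. 0) \<in> A" by (simp add: A_def virtual_char_zero)
    show "N > 0" "N * fact B > 0" using N_pos by simp_all
    \<comment> \<open>On each member this is Artin's theorem for the indicator of the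
      \<open>i\<close>-th class.\<close>
    show "(\<lambda>j. if j = i then of_nat N else 0) \<in> A" if i: "i < n" for i
    proof -
      have "virtual_char (sub H) (\<lambda>h. if idx h = i then of_nat N else 0 :: rat)" if H: "H \<in> F" for H
      proof -
        interpret H: finite_group "sub H" by (rule sub_finite_group[OF H])
        let ?ind = "\<lambda>h. if idx h = i then 1 else 0 :: int"
        have "?ind x = ?ind y" if "powers (sub H) x = powers (sub H) y" for x y
          using that by (simp add: idx_def powers_sub)
        moreover have "?ind (inv\<^bsub>sub H\<^esub> k \<otimes>\<^bsub>sub H\<^esub> x \<otimes>\<^bsub>sub H\<^esub> k) = ?ind x"
          if "x \<in> carrier (sub H)" "k \<in> carrier (sub H)" for x k
        proof -
          have xk: "x \<in> H" "k \<in> H" using that by simp_all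
          then have "k \<in> carrier G" using family_subgroup(3)[OF H] by blast
          moreover have "inv\<^bsub>sub H\<^esub> k = inv k" by (rule m_inv_consistent[OF family_subgroup(1)[OF H] xk(2)])
          ultimately show ?thesis using idx_conj[of "inv k" H x] H xk by simp
        qed
        ultimately have "virtual_char (sub H) (\<lambda>h. of_nat (card (carrier (sub H)) ^ card (carrier (sub H))) * of_int (?ind h) :: rat)"
          by (intro H.artin)
        then have ind: "virtual_char (sub H) (\<lambda>h. of_nat (card H ^ card H) * of_int (?ind h) :: rat)"
          by simp
        obtain m where m: "N = card H ^ card H * m" using N_dvd[OF H] by blast
        show ?thesis by (rule virtual_char_cong[OF virtual_char_of_nat[OF ind, of m]]) (simp add: m)
      qed
      then show ?thesis using i by (simp add: A_def)
    qed
    \<comment> \<open>The denominator is controlled on the cyclic group generated by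
      \<open>g i\<close>, where \<open>a i\<close> is the value of a virtual character at a
      generator.\<close>
    show "of_nat (N * fact B) * a i \<in> \<int>" if a: "a \<in> A" for a i
    proof (cases "i < n")
      case True
      let ?D = "powers G (g i)"
      have D: "?D \<in> F" "g i \<in> ?D" using g True by blast+
      interpret D: finite_group "sub ?D" by (rule sub_finite_group[OF D(1)])
      have "virtual_char (sub ?D) (\<lambda>h. a (idx h))" using a D(1) by (simp add: A_def)
      from D.generator_char_denominator[OF this, of "g i"] D(2)
      have *: "of_nat (card ?D ^ card ?D * fact (card ?D)) * a i \<in> \<int>"
        using idx_eqI[OF g(3)[OF True] True] by (simp add: powers_sub)
      have "card ?D ^ card ?D * fact (card ?D) dvd N * fact B"
        using N_dvd[OF D(1)] fact_dvd[OF B[OF D(1)]] by (rule mult_dvd_mono)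
      then obtain m where m: "N * fact B = card ?D ^ card ?D * fact (card ?D) * m" by blast
      have "of_nat (N * fact B) * a i = of_nat m * (of_nat (card ?D ^ card ?D * fact (card ?D)) * a i)"
        unfolding m by (simp add: mult_ac)
      then show ?thesis using Ints_mult[OF Ints_of_nat *] by metis
    next
      case False
      then show ?thesis using a by (simp add: A_def)
    qed
  qed blast
  then obtain b where b: "bij_betw (\<lambda>x :: nat \<Rightarrow>\<^sub>0 int. lattice_comb b n (Poly_Mapping.lookup x)) (carrier (free_Abelian_group {..<n})) A"
    by blast
  define \<theta> where "\<theta> x = lattice_comb b n (Poly_Mapping.lookup x)" for x :: "nat \<Rightarrow>\<^sub>0 int"
  let ?Fr = "free_Abelian_group {..<n}"
  have \<theta>: "bij_betw \<theta> (carrier ?Fr) A" using b by (simp add: \<theta>_def[abs_def])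
  have \<theta>_add: "\<theta> (x + y) = (\<lambda>i. \<theta> x i + \<theta> y i)" for x y
    by (rule ext) (simp add: \<theta>_def lattice_comb_def lookup_add distrib_right sum.distrib)
  have \<Psi>: "bij_betw \<Psi> (carrier ?L) A"
    unfolding bij_betw_def using \<Psi>_inj \<Psi>_in \<Psi>_surj by blast
  \<comment> \<open>Both \<Psi> and \<theta> are additive bijections onto \<open>A\<close>.\<close>
  let ?f = "\<lambda>x. inv_into (carrier ?Fr) \<theta> (\<Psi> x)"
  have inv_\<theta>: "inv_into (carrier ?Fr) \<theta> a \<in> carrier ?Fr" "\<theta> (inv_into (carrier ?Fr) \<theta> a) = a" if "a \<in> A" for a
    using \<theta> that by (auto simp: bij_betw_def inv_into_into f_inv_into_f simp del: carrier_free_Abelian_group_iff)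
  have "bij_betw ?f (carrier ?L) (carrier ?Fr)"
    using bij_betw_trans[OF \<Psi> bij_betw_inv_into[OF \<theta>]] by (simp add: comp_def)
  moreover have "?f \<in> hom (add_monoid ?L) ?Fr"
  proof (rule homI)
    show "?f x \<in> carrier ?Fr" if "x \<in> carrier (add_monoid ?L)" for x using that \<Psi>_in inv_\<theta>(1) by simp
    fix x y assume xy: "x \<in> carrier (add_monoid ?L)" "y \<in> carrier (add_monoid ?L)"
    have "?f x + ?f y \<in> carrier ?Fr"
      using group.is_monoid[OF group_free_Abelian_group, THEN monoid.m_closed, of "?f x" "{..<n}" "?f y"]
        inv_\<theta>(1) \<Psi>_in xy by simp
    moreover have "\<theta> (?f x + ?f y) = \<Psi> (x \<oplus>\<^bsub>?L\<^esub> y)"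
      using xy \<Psi>_in inv_\<theta>(2) by (simp add: \<theta>_add \<Psi>_add)
    ultimately have "?f (x \<oplus>\<^bsub>?L\<^esub> y) = ?f x + ?f y" using \<theta> by (metis bij_betw_inv_into_left)
    then show "?f (x \<otimes>\<^bsub>add_monoid ?L\<^esub> y) = ?f x \<otimes>\<^bsub>?Fr\<^esub> ?f y" by simp
  qed
  ultimately have "?f \<in> iso (add_monoid ?L) ?Fr" by (simp add: iso_def)
  then show ?thesis unfolding free_abelian_of_rank_def is_iso_def n_def by blast
qed

end

theorem proposition2p3:
  fixes \<Gamma> :: "('a, 'c) monoid_scheme" and \<F> :: "'a set set"
  assumes "group \<Gamma>"
    and "finite (conj_class \<Gamma> ` {H. subgroup H \<Gamma> \<and> finite H})"
    and "family_of_finite_subgroups \<Gamma> \<F>"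
  shows "free_abelian_of_rank (add_monoid (groth_limit TYPE(rat) \<Gamma> \<F>)) (num_cyclic_classes \<Gamma> \<F>)"
  using assms
  by (intro finite_subgroup_family.groth_limit_free finite_subgroup_family.intro finite_subgroup_family_axioms.intro)

end
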